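(* Suppose $(\mathcal{C}_1,\mathcal{D}_1)$ and $(\mathcal{C}_2,\mathcal{D}_2)$ are pseudo-Cartan inclusions and $(\mathcal{C}_2,\mathcal{D}_2,\alpha)$ is a regular and essential expansion of $(\mathcal{C}_1,\mathcal{D}_1)$. For $i=1,2$ let $(\mathcal{A}_i,\mathcal{B}_i,\tau_i)$ be Cartan envelopes for $(\mathcal{C}_i,\mathcal{D}_i)$, with conditional expectations $\Delta_i:\mathcal{A}_i\to\mathcal{B}_i$. Then: (a) there is a unique $*$-monomorphism $\breve\alpha:\mathcal{A}_1\to\mathcal{A}_2$ such that $\breve\alpha\circ\tau_1=\tau_2\circ\alpha$; (b) $(\mathcal{A}_2,\mathcal{B}_2,\breve\alpha)$ is a regular, essential expansion of $(\mathcal{A}_1,\mathcal{B}_1)$; (c) $\breve\alpha\circ\Delta_1=\Delta_2\circ\breve\alpha$ and $\breve\alpha\circ\Delta_1\circ\tau_1=\Delta_2\circ\tau_2\circ\alpha$.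
   Context: Inclusion: C*-algebra with C*-subalgebra. $\mathcal{N}(\mathcal{C},\mathcal{D})=\{v: v\mathcal{D}v^*\cup v^*\mathcal{D}v\subseteq\mathcal{D}\}$; regular: span dense. $\mathcal{D}^c$: relative commutant. Ideal intersection property: every nonzero closed ideal of the larger algebra meets the subalgebra nontrivially. Pseudo-Cartan inclusion: regular, $\mathcal{D}$ and $\mathcal{D}^c$ abelian, $(\mathcal{C},\mathcal{D}^c)$ and $(\mathcal{D}^c,\mathcal{D})$ with the ideal intersection property. Regular $*$-homomorphism: maps normalizers to normalizers. An expansion of $(\mathcal{C},\mathcal{D})$ is $(\mathcal{A},\mathcal{B},\alpha)$ with $(\mathcal{A},\mathcal{B})$ an inclusion, $\alpha:\mathcal{C}\to\mathcal{A}$ a $*$-monomorphism, $\alpha(\mathcal{D})\subseteq\mathcal{B}$; essential if $(\mathcal{B},\alpha(\mathcal{D}))$ has the ideal intersection property; regular if $\alpha$ is regular. Cartan inclusion $(\mathcal{A},\mathcal{B})$: regular, $\mathcal{B}$ maximal abelian, with faithful conditional expectation $\Delta$. Cartan envelope for regular $(\mathcal{C},\mathcal{D})$: a regular essential expansion $(\mathcal{A},\mathcal{B},\alpha)$ with $(\mathcal{A},\mathcal{B})$ Cartan, $\mathcal{B}=C^*(\Delta(\alpha(\mathcal{C})))$, $\mathcal{A}=C^*(\alpha(\mathcal{C})\cup\mathcal{B})$. *)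

theory Defs
  imports "HOL-Analysis.Analysis"
begin

text \<open>An ambient complex C*-algebra: a real Banach algebra equipped with a
complex scalar multiplication extending the real one, and an involution
satisfying the C*-identity.  A C*-algebra of the paper is modelled as a
C*-subalgebra (closed *-subalgebra) of such an ambient type (any C*-algebra is
one, taking the ambient type to be the algebra itself).\<close>

class cstar_ambient = banach + real_normed_algebra +
  fixes adj :: "'a \<Rightarrow> 'a"
    and cscale :: "complex \<Rightarrow> 'a \<Rightarrow> 'a"
  assumes cscale_add_left: "cscale (a + b) x = cscale a x + cscale b x"
    and cscale_add_right: "cscale a (x + y) = cscale a x + cscale a y"
    and cscale_cscale: "cscale a (cscale b x) = cscale (a * b) x"
    and cscale_of_real: "cscale (complex_of_real r) x = scaleR r x"
    and norm_cscale: "norm (cscale a x) = cmod a * norm x"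
    and mult_cscale_left: "cscale a x * y = cscale a (x * y)"
    and mult_cscale_right: "x * cscale a y = cscale a (x * y)"
    and adj_adj: "adj (adj x) = x"
    and adj_add: "adj (x + y) = adj x + adj y"
    and adj_cscale: "adj (cscale a x) = cscale (cnj a) (adj x)"
    and adj_mult: "adj (x * y) = adj y * adj x"
    and cstar_identity: "norm (adj x * x) = (norm x)\<^sup>2"

definition cspan :: "'a::cstar_ambient set \<Rightarrow> 'a set" where
  "cspan S = {x. \<exists>F c. finite F \<and> F \<subseteq> S \<and> x = (\<Sum>v\<in>F. cscale (c v) v)}"

definition csubspace :: "'a::cstar_ambient set \<Rightarrow> bool" where
  "csubspace S \<longleftrightarrow> 0 \<in> S \<and> (\<forall>x\<in>S. \<forall>y\<in>S. x + y \<in> S) \<and>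
     (\<forall>a. \<forall>x\<in>S. cscale a x \<in> S)"

definition cstar_subalgebra :: "'a::cstar_ambient set \<Rightarrow> bool" where
  "cstar_subalgebra S \<longleftrightarrow> csubspace S \<and> closed S \<and>
     (\<forall>x\<in>S. \<forall>y\<in>S. x * y \<in> S) \<and> (\<forall>x\<in>S. adj x \<in> S)"

definition cstar_gen :: "'a::cstar_ambient set \<Rightarrow> 'a set" where
  "cstar_gen S = \<Inter> {T. cstar_subalgebra T \<and> S \<subseteq> T}"

definition inclusion :: "'a::cstar_ambient set \<Rightarrow> 'a set \<Rightarrow> bool" where
  "inclusion C D \<longleftrightarrow> cstar_subalgebra C \<and> cstar_subalgebra D \<and> D \<subseteq> C"

definition normalizers :: "'a::cstar_ambient set \<Rightarrow> 'a set \<Rightarrow> 'a set" where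
  "normalizers C D = {v \<in> C. \<forall>d\<in>D. v * d * adj v \<in> D \<and> adj v * d * v \<in> D}"

definition regular_incl :: "'a::cstar_ambient set \<Rightarrow> 'a set \<Rightarrow> bool" where
  "regular_incl C D \<longleftrightarrow> closure (cspan (normalizers C D)) = C"

definition rel_commutant :: "'a::cstar_ambient set \<Rightarrow> 'a set \<Rightarrow> 'a set" where
  "rel_commutant C D = {x \<in> C. \<forall>d\<in>D. x * d = d * x}"

definition abelian :: "'a::cstar_ambient set \<Rightarrow> bool" where
  "abelian S \<longleftrightarrow> (\<forall>x\<in>S. \<forall>y\<in>S. x * y = y * x)"

definition closed_ideal :: "'a::cstar_ambient set \<Rightarrow> 'a set \<Rightarrow> bool" where
  "closed_ideal C J \<longleftrightarrow> J \<subseteq> C \<and> csubspace J \<and> closed J \<and>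
     (\<forall>c\<in>C. \<forall>j\<in>J. c * j \<in> J \<and> j * c \<in> J)"

definition ideal_intersection_property :: "'a::cstar_ambient set \<Rightarrow> 'a set \<Rightarrow> bool" where
  "ideal_intersection_property C D \<longleftrightarrow>
     (\<forall>J. closed_ideal C J \<and> J \<noteq> {0} \<longrightarrow> J \<inter> D \<noteq> {0})"

definition pseudo_cartan :: "'a::cstar_ambient set \<Rightarrow> 'a set \<Rightarrow> bool" where
  "pseudo_cartan C D \<longleftrightarrow> inclusion C D \<and> regular_incl C D \<and> abelian D \<and>
     abelian (rel_commutant C D) \<and>
     ideal_intersection_property C (rel_commutant C D) \<and>
     ideal_intersection_property (rel_commutant C D) D"

definition star_hom :: "('a::cstar_ambient \<Rightarrow> 'b::cstar_ambient) \<Rightarrow> 'a set \<Rightarrow> 'b set \<Rightarrow> bool" where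
  "star_hom f C A \<longleftrightarrow> f ` C \<subseteq> A \<and>
     (\<forall>x\<in>C. \<forall>y\<in>C. f (x + y) = f x + f y \<and> f (x * y) = f x * f y) \<and>
     (\<forall>a. \<forall>x\<in>C. f (cscale a x) = cscale a (f x)) \<and>
     (\<forall>x\<in>C. f (adj x) = adj (f x))"

definition star_mono :: "('a::cstar_ambient \<Rightarrow> 'b::cstar_ambient) \<Rightarrow> 'a set \<Rightarrow> 'b set \<Rightarrow> bool" where
  "star_mono f C A \<longleftrightarrow> star_hom f C A \<and> inj_on f C"

definition regular_hom ::
  "('a::cstar_ambient \<Rightarrow> 'b::cstar_ambient) \<Rightarrow> 'a set \<Rightarrow> 'a set \<Rightarrow> 'b set \<Rightarrow> 'b set \<Rightarrow> bool" where
  "regular_hom f C D A B \<longleftrightarrow> f ` normalizers C D \<subseteq> normalizers A B"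

definition expansion ::
  "'a::cstar_ambient set \<Rightarrow> 'a set \<Rightarrow> 'b::cstar_ambient set \<Rightarrow> 'b set \<Rightarrow> ('a \<Rightarrow> 'b) \<Rightarrow> bool" where
  "expansion C D A B f \<longleftrightarrow> inclusion C D \<and> inclusion A B \<and> star_mono f C A \<and> f ` D \<subseteq> B"

definition essential_expansion ::
  "'a::cstar_ambient set \<Rightarrow> 'a set \<Rightarrow> 'b::cstar_ambient set \<Rightarrow> 'b set \<Rightarrow> ('a \<Rightarrow> 'b) \<Rightarrow> bool" where
  "essential_expansion C D A B f \<longleftrightarrow> expansion C D A B f \<and>
     ideal_intersection_property B (f ` D)"

definition regular_expansion ::
  "'a::cstar_ambient set \<Rightarrow> 'a set \<Rightarrow> 'b::cstar_ambient set \<Rightarrow> 'b set \<Rightarrow> ('a \<Rightarrow> 'b) \<Rightarrow> bool" where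
  "regular_expansion C D A B f \<longleftrightarrow> expansion C D A B f \<and> regular_hom f C D A B"

definition positive_in :: "'a::cstar_ambient set \<Rightarrow> 'a \<Rightarrow> bool" where
  "positive_in A x \<longleftrightarrow> (\<exists>y\<in>A. x = adj y * y)"

definition cond_exp :: "'a::cstar_ambient set \<Rightarrow> 'a set \<Rightarrow> ('a \<Rightarrow> 'a) \<Rightarrow> bool" where
  "cond_exp A B E \<longleftrightarrow> E ` A \<subseteq> B \<and> (\<forall>b\<in>B. E b = b) \<and>
     (\<forall>x\<in>A. \<forall>y\<in>A. E (x + y) = E x + E y) \<and>
     (\<forall>a. \<forall>x\<in>A. E (cscale a x) = cscale a (E x)) \<and>
     (\<forall>b1\<in>B. \<forall>b2\<in>B. \<forall>x\<in>A. E (b1 * x * b2) = b1 * E x * b2) \<and>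
     (\<forall>x\<in>A. positive_in B (E (adj x * x)))"

definition faithful_cond_exp :: "'a::cstar_ambient set \<Rightarrow> 'a set \<Rightarrow> ('a \<Rightarrow> 'a) \<Rightarrow> bool" where
  "faithful_cond_exp A B E \<longleftrightarrow> cond_exp A B E \<and> (\<forall>x\<in>A. E (adj x * x) = 0 \<longrightarrow> x = 0)"

definition maximal_abelian :: "'a::cstar_ambient set \<Rightarrow> 'a set \<Rightarrow> bool" where
  "maximal_abelian A B \<longleftrightarrow> abelian B \<and>
     (\<forall>S. cstar_subalgebra S \<and> B \<subseteq> S \<and> S \<subseteq> A \<and> abelian S \<longrightarrow> S = B)"

definition cartan :: "'a::cstar_ambient set \<Rightarrow> 'a set \<Rightarrow> ('a \<Rightarrow> 'a) \<Rightarrow> bool" where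
  "cartan A B E \<longleftrightarrow> inclusion A B \<and> regular_incl A B \<and> maximal_abelian A B \<and>
     faithful_cond_exp A B E"

definition cartan_envelope ::
  "'a::cstar_ambient set \<Rightarrow> 'a set \<Rightarrow> 'b::cstar_ambient set \<Rightarrow> 'b set \<Rightarrow> ('a \<Rightarrow> 'b)
     \<Rightarrow> ('b \<Rightarrow> 'b) \<Rightarrow> bool" where
  "cartan_envelope C D A B f E \<longleftrightarrow> regular_incl C D \<and>
     regular_expansion C D A B f \<and> essential_expansion C D A B f \<and>
     cartan A B E \<and> B = cstar_gen (E ` f ` C) \<and> A = cstar_gen (f ` C \<union> B)"

end

theory Submission
  imports Defs
begin

text \<open>Both \<open>\<tau>\<^sub>1\<close> and \<open>\<tau>\<^sub>2 \<circ> \<alpha>\<close> represent \<open>C\<^sub>1\<close> in a Cartan inclusion \<open>(A, B, E)\<close> such that normalizers go to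
normalizers and the image of \<open>D\<^sub>1\<close> is essential in \<open>B\<close>. In such a representation \<open>f\<close>, each nonzero
\<open>d \<in> D\<^sub>1\<close> has, for a given normalizer \<open>v\<close>, a nonzero multiple \<open>e\<close> for which \<open>f(e) E(f(v))\<close> is either \<open>0\<close>
or \<open>f(e v)\<close>, and the alternative depends on \<open>C\<^sub>1\<close> alone (Frolik decomposition). Hence any noncommutative
polynomial in the \<open>f(v)\<close> and \<open>E(f(v))\<close> is carried into \<open>f(C\<^sub>1)\<close> by suitable \<open>f(e)\<close>, independently of \<open>f\<close>.
As \<open>f(D\<^sub>1)\<close> is essential, this determines the norm of the expectation of the polynomial \<open>p\<close>, and as \<open>E\<close>
is faithful the growth of \<open>E((p\<^sup>* p)\<^sup>n)\<close> determines the norm of \<open>p\<close> itself. So corresponding polynomials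
have equal norms, and the correspondence closes up to the required monomorphism. Uniqueness, the
intertwining of the expectations and regularity follow from the same localisation.\<close>

text \<open>Essentiality of \<open>D1\<close> is a statement about ideals of \<open>B\<close>, so
  multiplying by elements of \<open>D1\<close> detects norms only in \<open>B\<close> and says
  nothing directly about norms in \<open>A\<close>. This is why norms are compared after applying
  the expectation, and why \<open>E_power_growth\<close> is needed to return to \<open>A\<close>.
  The alternative for \<open>E (f v)\<close> depends on \<open>C1\<close> alone because both cases
  are equations in \<open>C1\<close>: either \<open>d * v\<close> commutes with \<open>D1\<close>,
  or \<open>e * v * e = 0\<close> for a nonzero multiple \<open>e\<close> of \<open>d\<close>. The
  other obstacle is the missing unit. Characters are extracted from minimal C*-seminorms, functional
  calculus yields only products of the form g(h) b, and a normalizer \<open>v\<close> is recovered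
  approximately from \<open>v * (adj v * v) * y\<close>. Regularity of the extension is the least
  direct part: a normalizer of \<open>B1\<close> is a limit of polynomials that need not normalize
  anything. It is treated through the ideal of those \<open>j\<close> in \<open>B1\<close> for which
  the conjugation condition holds once the image of \<open>j\<close> is inserted.\<close>

lemma cscale_one [simp]: "cscale 1 x = (x::'a::cstar_ambient)"
  using cscale_of_real[of 1 x] by simp

lemma cscale_zero [simp]: "cscale 0 x = (0::'a::cstar_ambient)"
  using cscale_of_real[of 0 x] by simp

lemma cscale_zero_right [simp]: "cscale a 0 = (0::'a::cstar_ambient)"
  using cscale_add_right[of a 0 0] by simp

lemma cscale_minus_left: "cscale (- a) x = - cscale a (x::'a::cstar_ambient)"
  using cscale_add_left[of "- a" a x] by (simp add: eq_neg_iff_add_eq_0)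

lemma cscale_minus_right: "cscale a (- x) = - cscale a (x::'a::cstar_ambient)"
  using cscale_add_right[of a "- x" x] by (simp add: eq_neg_iff_add_eq_0)

lemma cscale_diff_right: "cscale a (x - y) = cscale a x - cscale a (y::'a::cstar_ambient)"
  using cscale_add_right[of a x "- y"] by (simp add: cscale_minus_right)

lemma cscale_diff_left: "cscale (a - b) x = cscale a x - cscale b (x::'a::cstar_ambient)"
  using cscale_add_left[of a "- b" x] by (simp add: cscale_minus_left)

lemma minus_eq_cscale: "- x = cscale (- 1) (x::'a::cstar_ambient)"
  by (simp add: cscale_minus_left)

lemma adj_zero [simp]: "adj 0 = (0::'a::cstar_ambient)"
  using adj_add[of 0 0] by simp

lemma adj_minus: "adj (- x) = - adj (x::'a::cstar_ambient)"
  using adj_add[of "- x" x] by (simp add: eq_neg_iff_add_eq_0)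

lemma adj_diff: "adj (x - y) = adj x - adj (y::'a::cstar_ambient)"
  using adj_add[of x "- y"] by (simp add: adj_minus)

lemma norm_adj [simp]: "norm (adj x) = norm (x::'a::cstar_ambient)"
proof -
  have le: "norm y \<le> norm (adj y)" for y :: 'a
  proof (cases "y = 0")
    case False
    have "norm y * norm y \<le> norm (adj y) * norm y"
      using norm_mult_ineq[of "adj y" y] by (simp add: cstar_identity power2_eq_square)
    then show ?thesis using False by simp
  qed simp
  show ?thesis using le[of x] le[of "adj x"] by (simp add: adj_adj)
qed

lemma cstar_identity': "norm (x * adj x) = (norm (x::'a::cstar_ambient))\<^sup>2"
  using cstar_identity[of "adj x"] by (simp add: adj_adj)

lemma adj_mult_self_eq_0 [simp]: "adj x * x = 0 \<longleftrightarrow> x = (0::'a::cstar_ambient)"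
  using cstar_identity[of x] by auto

lemma mult_adj_self_eq_0 [simp]: "x * adj x = 0 \<longleftrightarrow> x = (0::'a::cstar_ambient)"
  using cstar_identity'[of x] by auto

lemma adj_eq_0_iff [simp]: "adj x = 0 \<longleftrightarrow> x = (0::'a::cstar_ambient)"
  by (metis adj_adj adj_zero)

lemma bounded_linear_adj: "bounded_linear (adj :: 'a::cstar_ambient \<Rightarrow> 'a)"
proof (rule bounded_linear_intro[where K = 1])
  show "adj (r *\<^sub>R x) = r *\<^sub>R adj x" for r and x :: 'a
    using adj_cscale[of "complex_of_real r" x] by (simp add: cscale_of_real)
qed (simp_all add: adj_add)

lemma bounded_linear_cscale: "bounded_linear (cscale a :: 'a::cstar_ambient \<Rightarrow> 'a)"
proof (rule bounded_linear_intro[where K = "cmod a"])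
  show "cscale a (r *\<^sub>R x) = r *\<^sub>R cscale a x" for r and x :: 'a
    by (simp add: cscale_of_real[symmetric] cscale_cscale mult.commute)
qed (simp_all add: cscale_add_right norm_cscale)

lemmas tendsto_adj [tendsto_intros] = bounded_linear.tendsto[OF bounded_linear_adj]
lemmas tendsto_cscale [tendsto_intros] = bounded_linear.tendsto[OF bounded_linear_cscale]

lemma tendsto_norm_le:
  fixes l :: "'a::real_normed_vector" and m :: "'b::real_normed_vector"
  assumes "\<And>k. norm (g k - l) \<le> norm (h k - m)" "h \<longlonglongrightarrow> m"
  shows "g \<longlonglongrightarrow> l"
proof -
  have "(\<lambda>k. norm (h k - m)) \<longlonglongrightarrow> 0" using assms(2) by (simp add: LIM_zero tendsto_norm_zero)
  then have "(\<lambda>k. g k - l) \<longlonglongrightarrow> 0" by (rule Lim_null_comparison[rotated]) (simp add: assms(1))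
  then show ?thesis by (rule LIM_zero_cancel)
qed

text \<open>Closedness is split off because the image of a C*-algebra under a star-homomorphism is
  not known to be closed when characters of it are needed.\<close>

definition star_alg :: "'a::cstar_ambient set \<Rightarrow> bool" where
  "star_alg S \<longleftrightarrow> csubspace S \<and> (\<forall>x\<in>S. \<forall>y\<in>S. x * y \<in> S) \<and> (\<forall>x\<in>S. adj x \<in> S)"

lemma cstar_subalgebra_iff: "cstar_subalgebra S \<longleftrightarrow> star_alg S \<and> closed S"
  by (auto simp: cstar_subalgebra_def star_alg_def)

lemma csubspaceD:
  assumes "csubspace S"
  shows csubspace_0: "0 \<in> S"
    and csubspace_add: "\<And>x y. x \<in> S \<Longrightarrow> y \<in> S \<Longrightarrow> x + y \<in> S"
    and csubspace_cscale: "\<And>a x. x \<in> S \<Longrightarrow> cscale a x \<in> S"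
    and csubspace_minus: "\<And>x. x \<in> S \<Longrightarrow> - x \<in> S"
    and csubspace_diff: "\<And>x y. x \<in> S \<Longrightarrow> y \<in> S \<Longrightarrow> x - y \<in> S"
proof -
  show *: "0 \<in> S" "\<And>x y. x \<in> S \<Longrightarrow> y \<in> S \<Longrightarrow> x + y \<in> S" "\<And>a x. x \<in> S \<Longrightarrow> cscale a x \<in> S"
    using assms by (auto simp: csubspace_def)
  show **: "\<And>x. x \<in> S \<Longrightarrow> - x \<in> S" using *(3)[of _ "- 1"] by (simp add: minus_eq_cscale)
  show "\<And>x y. x \<in> S \<Longrightarrow> y \<in> S \<Longrightarrow> x - y \<in> S" using *(2) ** by (metis diff_conv_add_uminus)
qed

lemma star_algD:
  assumes "star_alg S"
  shows star_alg_0: "0 \<in> S"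
    and star_alg_add: "\<And>x y. x \<in> S \<Longrightarrow> y \<in> S \<Longrightarrow> x + y \<in> S"
    and star_alg_cscale: "\<And>a x. x \<in> S \<Longrightarrow> cscale a x \<in> S"
    and star_alg_minus: "\<And>x. x \<in> S \<Longrightarrow> - x \<in> S"
    and star_alg_diff: "\<And>x y. x \<in> S \<Longrightarrow> y \<in> S \<Longrightarrow> x - y \<in> S"
    and star_alg_mult: "\<And>x y. x \<in> S \<Longrightarrow> y \<in> S \<Longrightarrow> x * y \<in> S"
    and star_alg_adj: "\<And>x. x \<in> S \<Longrightarrow> adj x \<in> S"
  using assms csubspaceD[of S] by (auto simp: star_alg_def)

text \<open>The zero functional counts as a character. The norm bound is part of the definition
  because \<open>S\<close> may fail to be complete; for closed \<open>S\<close> it is automatic by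
  \<open>characterI\<close>.\<close>

definition character :: "'a::cstar_ambient set \<Rightarrow> ('a \<Rightarrow> complex) \<Rightarrow> bool" where
  "character S \<phi> \<longleftrightarrow>
     (\<forall>x\<in>S. \<forall>y\<in>S. \<phi> (x + y) = \<phi> x + \<phi> y \<and> \<phi> (x * y) = \<phi> x * \<phi> y) \<and>
     (\<forall>a. \<forall>x\<in>S. \<phi> (cscale a x) = a * \<phi> x) \<and>
     (\<forall>x\<in>S. \<phi> (adj x) = cnj (\<phi> x)) \<and> (\<forall>x\<in>S. cmod (\<phi> x) \<le> norm x)"

subsection \<open>Characters of commutative star-algebras\<close>

locale comm_star_alg =
  fixes S :: "'a::cstar_ambient set"
  assumes star_alg: "star_alg S" and abelian: "abelian S"
begin

lemmas closed_ops [simp, intro] = star_algD[OF star_alg]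

lemma comm: "x \<in> S \<Longrightarrow> y \<in> S \<Longrightarrow> x * y = y * x"
  using abelian by (auto simp: abelian_def)

lemma left_comm: "x \<in> S \<Longrightarrow> y \<in> S \<Longrightarrow> x * (y * z) = y * (x * z)"
  using comm[of x y] by (metis mult.assoc)

text \<open>This is a^n x. Without a unit, powers are iterated multiplication operators, so that the
  case n = 0 makes sense.\<close>

abbreviation L :: "'a \<Rightarrow> nat \<Rightarrow> 'a \<Rightarrow> 'a" where "L a n \<equiv> ((*) a) ^^ n"

lemma L_in [simp, intro]: "a \<in> S \<Longrightarrow> x \<in> S \<Longrightarrow> L a n x \<in> S"
  by (induction n) auto

lemma L_mult: "L a n (x * y) = L a n x * y"
  by (induction n) (auto simp: mult.assoc)

lemma L_linear: "L a n (x + y) = L a n x + L a n y" "L a n (cscale c x) = cscale c (L a n x)"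
  by (induction n) (auto simp: distrib_left mult_cscale_right)

lemma L_double: assumes "a \<in> S" "x \<in> S" "y \<in> S" shows "L a (n + n) (x * y) = L a n x * L a n y"
  using assms by (simp only: funpow_add o_apply)
    (metis L_mult comm L_in)

lemma adj_L: "x \<in> S \<Longrightarrow> a \<in> S \<Longrightarrow> adj (L a n x) = L (adj a) n (adj x)"
  by (induction n) (auto simp: adj_mult comm)

section \<open>C*-seminorms and their localisations\<close>

definition cstar_seminorm :: "('a \<Rightarrow> real) \<Rightarrow> bool" where
  "cstar_seminorm q \<longleftrightarrow> (\<forall>x\<in>S. 0 \<le> q x \<and> q x \<le> norm x) \<and>
     (\<forall>x\<in>S. \<forall>y\<in>S. q (x + y) \<le> q x + q y \<and> q (x * y) \<le> q x * q y) \<and>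
     (\<forall>a. \<forall>x\<in>S. q (cscale a x) = cmod a * q x) \<and> (\<forall>x\<in>S. q (adj x * x) = (q x)\<^sup>2)"

context
  fixes q assumes q: "cstar_seminorm q"
begin

lemma q_nonneg: "x \<in> S \<Longrightarrow> 0 \<le> q x"
  and q_le: "x \<in> S \<Longrightarrow> q x \<le> norm x"
  and q_add: "x \<in> S \<Longrightarrow> y \<in> S \<Longrightarrow> q (x + y) \<le> q x + q y"
  and q_mult: "x \<in> S \<Longrightarrow> y \<in> S \<Longrightarrow> q (x * y) \<le> q x * q y"
  and q_cscale: "x \<in> S \<Longrightarrow> q (cscale a x) = cmod a * q x"
  and q_star: "x \<in> S \<Longrightarrow> q (adj x * x) = (q x)\<^sup>2"
  using q by (auto simp: cstar_seminorm_def)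

lemma q_adj: assumes "x \<in> S" shows "q (adj x) = q x"
proof -
  have le: "q y \<le> q (adj y)" if "y \<in> S" for y
  proof (cases "q y = 0")
    case False
    have "q y * q y \<le> q (adj y) * q y"
      using q_mult[of "adj y" y] q_star[of y] that by (simp add: power2_eq_square)
    then show ?thesis using False q_nonneg[OF that] by simp
  qed (use that q_nonneg in auto)
  show ?thesis using le[of x] le[of "adj x"] assms by (simp add: adj_adj)
qed

lemma q_mult_sq: assumes "x \<in> S" "y \<in> S" shows "(q (x * y))\<^sup>2 = q (adj x * x * (adj y * y))"
proof -
  have "adj (x * y) * (x * y) = adj x * x * (adj y * y)"
    using assms by (simp add: adj_mult mult.assoc comm[of "adj y"] left_comm[of y])
  then show ?thesis using q_star[of "x * y"] assms by simp
qed

text \<open>\<open>q_mult_sq\<close> expresses the square of either side through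
  \<open>adj x * x\<close>, which commutativity makes symmetric in \<open>x\<close> and
  \<open>adj x\<close>.\<close>

lemma q_mult_adj: assumes "x \<in> S" "y \<in> S" shows "q (adj x * y) = q (x * y)"
proof -
  have "(q (adj x * y))\<^sup>2 = (q (x * y))\<^sup>2"
    using q_mult_sq[of "adj x" y] q_mult_sq[of x y] assms by (simp add: adj_adj comm[of x])
  then show ?thesis using assms q_nonneg by (simp add: power2_eq_iff_nonneg)
qed

lemma q_square: "x \<in> S \<Longrightarrow> q (x * x) = (q x)\<^sup>2"
  using q_mult_adj[of x x] q_star by simp

lemma q_diff: "x \<in> S \<Longrightarrow> y \<in> S \<Longrightarrow> q (x - y) \<le> q x + q y"
  using q_add[of x "- y"] q_cscale[of y "- 1"] by (simp add: cscale_minus_left)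

lemma q_L_adj: assumes "a \<in> S" "x \<in> S" shows "q (L (adj a) n x) = q (L a n x)"
  using assms(2)
proof (induction n arbitrary: x)
  case (Suc n)
  have "q (L (adj a) (Suc n) x) = q (L (adj a) n (adj a * x))" by (simp add: funpow_swap1)
  also have "\<dots> = q (L a n (adj a * x))" using Suc assms by simp
  also have "\<dots> = q (adj a * L a n x)"
    using Suc.prems assms by (metis comm L_mult L_in closed_ops(7))
  also have "\<dots> = q (L a (Suc n) x)" using q_mult_adj[of a "L a n x"] assms Suc.prems by simp
  finally show ?case .
qed simp

text \<open>The limit of \<open>loc a x\<close> is again a C*-seminorm in \<open>x\<close> and lies below \<open>q\<close>; comparing the two shows
that a minimal \<open>q\<close> is multiplicative.\<close>

definition loc :: "'a \<Rightarrow> 'a \<Rightarrow> nat \<Rightarrow> real" where "loc a x n = q (L a n x) / q a ^ n"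

context
  fixes a assumes a: "a \<in> S" "q a \<noteq> 0"
begin

lemma qa_pos: "0 < q a" using a q_nonneg[of a] by simp

lemma loc_decseq: assumes "x \<in> S" shows "decseq (loc a x)"
proof (rule decseq_SucI)
  fix n
  have "q (L a (Suc n) x) \<le> q a * q (L a n x)" using q_mult[of a "L a n x"] a assms by simp
  then show "loc a x (Suc n) \<le> loc a x n" using qa_pos by (simp add: loc_def field_simps)
qed

lemma loc_nonneg: "x \<in> S \<Longrightarrow> 0 \<le> loc a x n"
  using qa_pos a by (auto simp: loc_def intro!: divide_nonneg_nonneg q_nonneg)

lemma loc_0: "loc a x 0 = q x" by (simp add: loc_def)

lemma loc_le: "x \<in> S \<Longrightarrow> loc a x n \<le> q x"
  using decseqD[OF loc_decseq, of x 0 n] by (simp add: loc_0)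

lemma loc_convergent: "x \<in> S \<Longrightarrow> convergent (loc a x)"
  using decseq_convergent[OF loc_decseq[of x], of 0] loc_nonneg[of x] convergentI by metis

lemma loc_lim: "x \<in> S \<Longrightarrow> loc a x \<longlonglongrightarrow> lim (loc a x)"
  using loc_convergent convergent_LIMSEQ_iff by blast

lemma loc_lim_double: "x \<in> S \<Longrightarrow> (\<lambda>n. loc a x (n + n)) \<longlonglongrightarrow> lim (loc a x)"
  using LIMSEQ_subseq_LIMSEQ[OF loc_lim, of x "\<lambda>n. n + n"] by (simp add: o_def strict_mono_def)

lemma loc_seminorm: "cstar_seminorm (\<lambda>x. lim (loc a x))"
  unfolding cstar_seminorm_def
proof (intro conjI ballI allI)
  fix x assume x: "x \<in> S"
  show "0 \<le> lim (loc a x)" by (rule LIMSEQ_le_const[OF loc_lim[OF x]]) (use loc_nonneg x in auto)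
  have "lim (loc a x) \<le> q x" by (rule LIMSEQ_le_const2[OF loc_lim[OF x]]) (use loc_le x in auto)
  then show "lim (loc a x) \<le> norm x" using q_le[OF x] by simp
  show "lim (loc a (cscale c x)) = cmod c * lim (loc a x)" for c
  proof -
    have "loc a (cscale c x) = (\<lambda>n. cmod c * loc a x n)"
      using x a by (auto simp: loc_def L_linear q_cscale)
    then show ?thesis using tendsto_mult_left[OF loc_lim[OF x], of "cmod c"] by (simp add: limI)
  qed
  \<comment> \<open>Doubling the index splits a^(2n) x^* x into two factors a^n. One of these is
    traded for a power of \<open>adj a\<close> by \<open>q_L_adj\<close>, which produces the shape
    required by the C*-identity.\<close>
  have "loc a (adj x * x) (n + n) = (loc a x n)\<^sup>2" for n
  proof -
    have "q (L a (n + n) (adj x * x)) = q (L a n (adj x) * L a n x)"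
      using L_double[of a "adj x" x n] a x by simp
    also have "\<dots> = q (L a n (adj x * L a n x))" by (simp add: L_mult)
    also have "\<dots> = q (L (adj a) n (adj x * L a n x))" using q_L_adj[of a "adj x * L a n x" n] a x by simp
    also have "\<dots> = q (adj (L a n x) * L a n x)" using a x by (simp add: L_mult adj_L)
    also have "\<dots> = (q (L a n x))\<^sup>2" using a x by (simp add: q_star)
    finally show ?thesis by (simp add: loc_def power_divide power_add power2_eq_square)
  qed
  then have "(\<lambda>n. (loc a x n)\<^sup>2) \<longlonglongrightarrow> lim (loc a (adj x * x))"
    using loc_lim_double[of "adj x * x"] x by simp
  then show "lim (loc a (adj x * x)) = (lim (loc a x))\<^sup>2"
    using LIMSEQ_unique tendsto_power[OF loc_lim[OF x]] by blast
  fix y assume y: "y \<in> S"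
  show "lim (loc a (x + y)) \<le> lim (loc a x) + lim (loc a y)"
  proof (rule LIMSEQ_le[OF loc_lim tendsto_add[OF loc_lim loc_lim]])
    show "\<exists>N. \<forall>n\<ge>N. loc a (x + y) n \<le> loc a x n + loc a y n"
      using x y a qa_pos by (auto simp: loc_def L_linear add_divide_distrib[symmetric] intro!: divide_right_mono q_add)
  qed (use x y in auto)
  show "lim (loc a (x * y)) \<le> lim (loc a x) * lim (loc a y)"
  proof (rule LIMSEQ_le[OF loc_lim_double tendsto_mult[OF loc_lim loc_lim]])
    have "loc a (x * y) (n + n) \<le> loc a x n * loc a y n" for n
    proof -
      have "q (L a (n + n) (x * y)) \<le> q (L a n x) * q (L a n y)"
        using q_mult[of "L a n x" "L a n y"] L_double[of a x y n] x y a by simp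
      then show ?thesis using qa_pos by (simp add: loc_def power_add divide_right_mono)
    qed
    then show "\<exists>N. \<forall>n\<ge>N. loc a (x * y) (n + n) \<le> loc a x n * loc a y n" by blast
  qed (use x y in auto)
qed

text \<open>Multiplication by \<open>a\<close> shifts the sequence by one place and contributes a
  factor \<open>q a\<close>. So wherever the limit agrees with \<open>q\<close>, multiplication by
  \<open>a\<close> is \<open>q\<close>-multiplicative.\<close>

lemma lim_loc_mult: assumes "x \<in> S" shows "lim (loc a (a * x)) = q a * lim (loc a x)"
proof -
  have "loc a (a * x) = (\<lambda>n. q a * loc a x (Suc n))"
    using qa_pos by (auto simp: loc_def funpow_swap1)
  then have "(\<lambda>n. q a * loc a x (Suc n)) \<longlonglongrightarrow> lim (loc a (a * x))"
    using loc_lim[of "a * x"] assms a by simp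
  moreover have "(\<lambda>n. q a * loc a x (Suc n)) \<longlonglongrightarrow> q a * lim (loc a x)"
    using loc_lim[OF assms] by (intro tendsto_mult_left) (simp add: LIMSEQ_Suc)
  ultimately show ?thesis using LIMSEQ_unique by blast
qed

text \<open>This is the power law for q(a^(n+1)). Squaring passes from exponent m + 1 to 2m + 2, so
  equality holds for arbitrarily large indices; monotonicity fills the gaps.\<close>

lemma loc_self: "loc a a n = q a"
proof -
  have "\<exists>m\<ge>k. loc a a m = q a" for k
  proof (induction k)
    case (Suc k)
    then obtain m where m: "m \<ge> k" "loc a a m = q a" by blast
    have "L a (Suc (m + m)) a = L a m a * L a m a"
      using L_double[of a a a m] a funpow_swap1[of "(*) a" "m + m" a] by simp
    then have "q (L a (Suc (m + m)) a) = (q (L a m a))\<^sup>2" using q_square a by simp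
    then have "loc a a (Suc (m + m)) = (loc a a m)\<^sup>2 / q a"
      by (simp add: loc_def power_divide power_add power2_eq_square)
    then have "loc a a (Suc (m + m)) = q a" using m qa_pos by (simp add: power2_eq_square)
    then show ?case using m by (intro exI[of _ "Suc (m + m)"]) auto
  qed (use loc_0 in auto)
  then obtain m where "m \<ge> n" "loc a a m = q a" by blast
  then show ?thesis using decseqD[OF loc_decseq[of a], of n m] loc_le[of a n] a by simp
qed

end
end

text \<open>An infimum of seminorms need not be subadditive. In a chain a single member approximates
  the infimum at finitely many points at once, so each axiom, involving only the points in
  \<open>P\<close>, survives as a limit along a sequence of members.\<close>

lemma seminorm_Inf:
  assumes "K \<noteq> {}" and K: "\<And>q. q \<in> K \<Longrightarrow> cstar_seminorm q"
    and chain: "\<And>p q. p \<in> K \<Longrightarrow> q \<in> K \<Longrightarrow> (\<forall>x. p x \<le> q x) \<or> (\<forall>x. q x \<le> p x)"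
  shows "cstar_seminorm (\<lambda>x. INF q\<in>K. q x)"
proof -
  define m where "m = (\<lambda>x. INF q\<in>K. q x)"
  have bdd: "bdd_below ((\<lambda>q. q x) ` K)" if "x \<in> S" for x
    using K that by (auto intro!: bdd_belowI[of _ 0] q_nonneg)
  have lower: "m x \<le> q x" if "x \<in> S" "q \<in> K" for x q
    unfolding m_def using bdd that by (intro cINF_lower) auto
  have approx: "\<exists>q\<in>K. \<forall>x\<in>P. q x < m x + e" if "finite P" "P \<subseteq> S" "e > 0" for P e
    using that
  proof (induction P)
    case (insert x P)
    obtain p where p: "p \<in> K" "p x < m x + e"
      using cINF_less_iff[of K "\<lambda>q. q x" "m x + e"] bdd[of x] assms(1) insert.prems by (auto simp: m_def)
    obtain r where r: "r \<in> K" "\<forall>x\<in>P. r x < m x + e" using insert by auto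
    show ?case using chain[OF p(1) r(1)]
    proof
      assume "\<forall>x. p x \<le> r x"
      then show ?thesis using p r(2) by (intro bexI[of _ p]) (auto intro: le_less_trans)
    next
      assume "\<forall>x. r x \<le> p x"
      then show ?thesis using p r by (intro bexI[of _ r]) (auto intro: le_less_trans)
    qed
  qed (use assms(1) in auto)
  have props: "0 \<le> m x \<and> m x \<le> norm x \<and> m (x + y) \<le> m x + m y \<and> m (x * y) \<le> m x * m y \<and>
      m (cscale c x) = cmod c * m x \<and> m (adj x * x) = (m x)\<^sup>2" if xy: "x \<in> S" "y \<in> S" for x y c
  proof -
    define P where "P = {x, y, x + y, x * y, cscale c x, adj x * x}"
    have P: "finite P" "P \<subseteq> S" using xy by (auto simp: P_def)
    have "\<exists>q\<in>K. \<forall>w\<in>P. q w < m w + inverse (Suc k)" for k :: nat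
      by (rule approx[OF P]) simp
    then obtain s where s: "\<And>k. s k \<in> K" "\<And>k w. w \<in> P \<Longrightarrow> s k w < m w + inverse (Suc k)" by metis
    have lim: "(\<lambda>k. s k w) \<longlonglongrightarrow> m w" if w: "w \<in> P" for w
    proof (rule tendsto_norm_le[OF _ LIMSEQ_inverse_real_of_nat])
      show "norm (s k w - m w) \<le> norm (inverse (real (Suc k)) - 0)" for k
        using s(2)[OF w, of k] lower[of w "s k"] w P s(1)[of k] by auto
    qed
    have l: "(\<lambda>k. s k x) \<longlonglongrightarrow> m x" "(\<lambda>k. s k y) \<longlonglongrightarrow> m y" "(\<lambda>k. s k (x + y)) \<longlonglongrightarrow> m (x + y)"
      "(\<lambda>k. s k (x * y)) \<longlonglongrightarrow> m (x * y)" "(\<lambda>k. s k (cscale c x)) \<longlonglongrightarrow> m (cscale c x)"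
      "(\<lambda>k. s k (adj x * x)) \<longlonglongrightarrow> m (adj x * x)" by (auto intro: lim simp: P_def)
    note q = K[OF s(1)]
    have "0 \<le> m x" by (rule LIMSEQ_le_const[OF l(1)]) (use q_nonneg[OF q xy(1)] in blast)
    moreover have "m x \<le> norm x" by (rule LIMSEQ_le_const2[OF l(1)]) (use q_le[OF q xy(1)] in blast)
    moreover have "m (x + y) \<le> m x + m y"
      by (rule LIMSEQ_le[OF l(3) tendsto_add[OF l(1,2)]]) (use q_add[OF q xy] in blast)
    moreover have "m (x * y) \<le> m x * m y"
      by (rule LIMSEQ_le[OF l(4) tendsto_mult[OF l(1,2)]]) (use q_mult[OF q xy] in blast)
    moreover have "m (cscale c x) = cmod c * m x"
      using l(5) tendsto_mult_left[OF l(1), of "cmod c"] unfolding q_cscale[OF q xy(1)] by (rule LIMSEQ_unique)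
    moreover have "m (adj x * x) = (m x)\<^sup>2"
      using l(6) tendsto_power[OF l(1), of 2] unfolding q_star[OF q xy(1)] by (rule LIMSEQ_unique)
    ultimately show ?thesis by blast
  qed
  show ?thesis unfolding m_def[symmetric] cstar_seminorm_def using props by blast
qed

end

context comm_star_alg
begin

lemma cstar_seminorm_cong:
  assumes "\<And>x. x \<in> S \<Longrightarrow> p x = q x" shows "cstar_seminorm p \<longleftrightarrow> cstar_seminorm q"
  using assms by (simp add: cstar_seminorm_def)

lemma ex_minimal_seminorm:
  assumes "b \<in> S" "norm b = 1"
  obtains q where "cstar_seminorm q" "q b = 1"
    "\<And>p x. cstar_seminorm p \<Longrightarrow> p b = 1 \<Longrightarrow> (\<And>x. x \<in> S \<Longrightarrow> p x \<le> q x) \<Longrightarrow> x \<in> S \<Longrightarrow> p x = q x"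
proof -
  \<comment> \<open>The value 0 off \<open>S\<close> makes minimality among functions on the whole
    type express minimality on \<open>S\<close>. The order \<open>R\<close> is reversed because
    Zorn's lemma delivers a maximal element.\<close>
  define P where "P = {q. cstar_seminorm q \<and> q b = 1 \<and> (\<forall>x. x \<notin> S \<longrightarrow> q x = 0)}"
  define R :: "('a \<Rightarrow> real) \<Rightarrow> ('a \<Rightarrow> real) \<Rightarrow> bool" where "R = (\<lambda>p q. q \<le> p)"
  have "\<exists>m\<in>P. \<forall>p\<in>P. R m p \<longrightarrow> p = m"
  proof (rule predicate_Zorn)
    show "partial_order_on P (relation_of R P)"
      by (rule partial_order_on_relation_ofI) (auto simp: R_def)
    fix K assume K: "K \<in> Chains (relation_of R P)"
    show "\<exists>u\<in>P. \<forall>p\<in>K. R p u"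
    proof (cases "K = {}")
      case True
      have "cstar_seminorm norm"
        by (auto simp: cstar_seminorm_def norm_triangle_ineq norm_mult_ineq norm_cscale cstar_identity)
      then have "cstar_seminorm (\<lambda>x. if x \<in> S then norm x else 0)"
        by (subst cstar_seminorm_cong[of _ norm]) auto
      then show ?thesis using True assms by (intro bexI[of _ "\<lambda>x. if x \<in> S then norm x else 0"]) (auto simp: P_def)
    next
      case False
      have KP: "K \<subseteq> P" using K by (rule Chains_relation_of)
      have "cstar_seminorm (\<lambda>x. INF q\<in>K. q x)"
      proof (rule seminorm_Inf[OF False])
        show "cstar_seminorm q" if "q \<in> K" for q using KP that by (auto simp: P_def)
        show "(\<forall>x. p x \<le> q x) \<or> (\<forall>x. q x \<le> p x)" if "p \<in> K" "q \<in> K" for p q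
          using K that by (auto simp: Chains_def relation_of_def R_def le_fun_def)
      qed
      moreover have "(INF q\<in>K. q b) = 1"
      proof -
        have "(INF q\<in>K. q b) = (INF q\<in>K. 1)" using KP by (intro INF_cong) (auto simp: P_def)
        then show ?thesis using False by simp
      qed
      moreover have "(INF q\<in>K. q x) = 0" if "x \<notin> S" for x
      proof -
        have "(INF q\<in>K. q x) = (INF q\<in>K. 0)" using KP that by (intro INF_cong) (auto simp: P_def)
        then show ?thesis using False by simp
      qed
      moreover have "(INF q\<in>K. q x) \<le> p x" if "p \<in> K" for p x
      proof (rule cINF_lower[OF _ that])
        have "0 \<le> q x" if "q \<in> K" for q
          using KP that q_nonneg[of q x] by (cases "x \<in> S") (auto simp: P_def)
        then show "bdd_below ((\<lambda>q. q x) ` K)" by (auto intro!: bdd_belowI[of _ 0])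
      qed
      ultimately show ?thesis
        by (intro bexI[of _ "\<lambda>x. INF q\<in>K. q x"]) (auto simp: P_def R_def le_fun_def)
    qed
  qed
  then obtain q where q: "q \<in> P" "\<And>p. p \<in> P \<Longrightarrow> p \<le> q \<Longrightarrow> p = q"
    by (auto simp: R_def)
  show thesis
  proof (rule that)
    show "cstar_seminorm q" "q b = 1" using q by (auto simp: P_def)
    fix p x assume p: "cstar_seminorm p" "p b = 1" "\<And>x. x \<in> S \<Longrightarrow> p x \<le> q x" and x: "x \<in> S"
    define p' where "p' = (\<lambda>x. if x \<in> S then p x else 0)"
    have "cstar_seminorm p'" using p(1) by (subst cstar_seminorm_cong[of _ p]) (auto simp: p'_def)
    then have "p' \<in> P" using p assms by (auto simp: P_def p'_def)
    moreover have "p' \<le> q" using p q(1) by (auto simp: p'_def le_fun_def P_def)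
    ultimately have "p' = q" using q by blast
    then show "p x = q x" using x by (auto simp: p'_def)
  qed
qed

text \<open>Minimality of \<open>q\<close> applies to the localisation at \<open>a\<close> only if
  the latter still takes the value 1 at \<open>b\<close>. For a = b this is the power law. It gives
  q(b x) = q(x), so q(a^n b) = q(a^n), and the power law for \<open>a\<close> settles the general
  case.\<close>

lemma ex_multiplicative_seminorm:
  assumes b: "b \<in> S" "norm b = 1"
  obtains q where "cstar_seminorm q" "q b = 1" "\<And>x y. x \<in> S \<Longrightarrow> y \<in> S \<Longrightarrow> q (x * y) = q x * q y"
proof -
  obtain q where q: "cstar_seminorm q" "q b = 1" and
    min: "\<And>p x. cstar_seminorm p \<Longrightarrow> p b = 1 \<Longrightarrow> (\<And>x. x \<in> S \<Longrightarrow> p x \<le> q x) \<Longrightarrow> x \<in> S \<Longrightarrow> p x = q x"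
    using ex_minimal_seminorm[OF b] by metis
  have step: "q (a * x) = q a * q x" if a: "a \<in> S" "q a \<noteq> 0" and l: "lim (loc q a b) = 1" and x: "x \<in> S" for a x
  proof -
    have eq: "lim (loc q a y) = q y" if "y \<in> S" for y
    proof (rule min[where p = "\<lambda>x. lim (loc q a x)"])
      show "cstar_seminorm (\<lambda>x. lim (loc q a x))" using loc_seminorm[OF q(1) a] .
      show "lim (loc q a z) \<le> q z" if "z \<in> S" for z
        by (rule LIMSEQ_le_const2[OF loc_lim[OF q(1) a that]]) (use loc_le[OF q(1) a] that in auto)
    qed (use that l in auto)
    then show ?thesis using lim_loc_mult[OF q(1) a x] a x by simp
  qed
  have qb: "q (b * x) = q x" if "x \<in> S" for x
  proof -
    have "loc q b b = (\<lambda>n. 1)" using loc_self[OF q(1) b(1)] q by auto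
    then show ?thesis using step[of b x] b q that by simp
  qed
  have "q (a * x) = q a * q x" if a: "a \<in> S" and x: "x \<in> S" for a x
  proof (cases "q a = 0")
    case True
    then show ?thesis using q_mult[OF q(1) a x] q_nonneg[OF q(1), of "a * x"] a x by simp
  next
    case False
    have "loc q a b n = 1" for n
    proof (cases n)
      case (Suc m)
      have "L a (Suc m) b = b * L a m a"
        using a b L_mult[of m a a b] comm[of "L a m a" b] by (simp add: funpow_swap1)
      then have "q (L a n b) = q (L a m a)" using qb[of "L a m a"] a Suc by simp
      then show ?thesis using loc_self[OF q(1) a False, of m] Suc False
        by (simp add: loc_def[OF q(1)] divide_eq_eq)
    qed (simp add: loc_def[OF q(1)] q)
    then have "loc q a b = (\<lambda>n. 1)" by auto
    then show ?thesis using step[OF a False _ x] by simp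
  qed
  then show thesis using that q by blast
qed

text \<open>Ostrowski's argument: the distance from \<open>T\<close> to the scalars would otherwise be constant on
discs of a fixed radius, because \<open>T^N - \<lambda>^N\<close> with \<open>N = 2^k\<close> splits into translates of \<open>T\<close>.\<close>

context
  fixes q b assumes q: "cstar_seminorm q" and b: "b \<in> S" "q b = 1"
    and qmult: "\<And>x y. x \<in> S \<Longrightarrow> y \<in> S \<Longrightarrow> q (x * y) = q x * q y"
begin

text \<open>Operators stand in for elements of a unitisation: x - l acts on \<open>S\<close> even
  when it is not an element of \<open>S\<close>.\<close>

definition multiplier :: "('a \<Rightarrow> 'a) \<Rightarrow> bool" where
  "multiplier T \<longleftrightarrow> (\<forall>x\<in>S. T x \<in> S) \<and> (\<forall>x\<in>S. \<forall>y\<in>S. T (x * y) = T x * y) \<and>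
     (\<forall>x\<in>S. \<forall>y\<in>S. T (x + y) = T x + T y) \<and> (\<forall>c. \<forall>x\<in>S. T (cscale c x) = cscale c (T x))"

text \<open>Since \<open>b * T y = T b * y\<close> and \<open>q b = 1\<close>, the element
  \<open>b\<close> serves as a unit for measuring multipliers.\<close>

lemma multiplier_norm:
  assumes T: "multiplier T" and y: "y \<in> S"
  shows "q (T y) = q (T b) * q y"
proof -
  have "q (T y) = q (b * T y)" using T y b qmult[of b "T y"] by (auto simp: multiplier_def)
  also have "b * T y = T b * y"
    using T y b comm by (metis multiplier_def)
  finally show ?thesis using T y b qmult[of "T b" y] by (auto simp: multiplier_def)
qed

lemma multiplier_comp: "multiplier T \<Longrightarrow> multiplier (T \<circ> T)"
  by (auto simp: multiplier_def)

lemma multiplier_shift: "multiplier T \<Longrightarrow> multiplier (\<lambda>y. T y - cscale l y)"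
  by (auto simp: multiplier_def mult_cscale_left cscale_add_right cscale_diff_right cscale_cscale
      algebra_simps)

lemma multiplier_square:
  assumes T: "multiplier T"
  shows "q ((T \<circ> T) b - cscale (l\<^sup>2) b) = q (T b - cscale l b) * q (T b - cscale (- l) b)"
proof -
  have "T (T b - cscale (- l) b) = T (T b) - cscale (- l) (T b)"
    using T b by (auto simp: multiplier_def cscale_minus_left)
  then have "(T \<circ> T) b - cscale (l\<^sup>2) b = T (T b - cscale (- l) b) - cscale l (T b - cscale (- l) b)"
    by (simp add: cscale_diff_right cscale_cscale cscale_minus_left power2_eq_square
        cscale_minus_right cscale_add_right)
  moreover have "T b - cscale (- l) b \<in> S" using T b by (auto simp: multiplier_def)
  ultimately show ?thesis using multiplier_norm[OF multiplier_shift[OF T], of "T b - cscale (- l) b" l] by simp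
qed

text \<open>Of the 2^k factors of T^(2^k) - l^(2^k), one is kept and the other 2^k - 1 are bounded
  below by \<open>m\<close>. The induction squares \<open>T\<close>, \<open>m\<close> and
  \<open>l\<close> together; the lower bound persists because every complex number has a square root
  and T^2 - l^2 = (T - l)(T + l).\<close>

lemma multiplier_dist_scalars:
  assumes "multiplier T" "0 \<le> m" "\<And>l. m \<le> q (T b - cscale l b)"
  shows "q (T b - cscale l b) * m ^ (2 ^ k - 1) \<le> q (T b) ^ (2 ^ k) + cmod l ^ (2 ^ k)"
  using assms
proof (induction k arbitrary: T m l)
  case 0
  have "q (T b - cscale l b) \<le> q (T b) + q (cscale l b)"
    using 0 b by (intro q_diff[OF q]) (auto simp: multiplier_def)
  then show ?case using b q_cscale[OF q b(1), of l] by simp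
next
  case (Suc k)
  have nn: "q (T b - cscale l b) \<ge> 0" for l
    using Suc.prems b by (intro q_nonneg[OF q]) (auto simp: multiplier_def)
  have low: "m\<^sup>2 \<le> q ((T \<circ> T) b - cscale l b)" for l
  proof -
    have "m\<^sup>2 \<le> q (T b - cscale (csqrt l) b) * q (T b - cscale (- csqrt l) b)"
      unfolding power2_eq_square using Suc.prems nn by (intro mult_mono) auto
    then show ?thesis using multiplier_square[OF Suc.prems(1), of "csqrt l"] by simp
  qed
  have "q (T b - cscale l b) * m ^ (2 ^ Suc k - 1) = (q (T b - cscale l b) * m) * (m\<^sup>2) ^ (2 ^ k - 1)"
  proof -
    have "(2::nat) ^ Suc k - 1 = Suc (2 * (2 ^ k - 1))"
      using one_le_power[of "2::nat" k] unfolding power_Suc by linarith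
    then show ?thesis by (simp add: power_mult)
  qed
  also have "\<dots> \<le> q ((T \<circ> T) b - cscale (l\<^sup>2) b) * (m\<^sup>2) ^ (2 ^ k - 1)"
  proof (rule mult_right_mono)
    show "q (T b - cscale l b) * m \<le> q ((T \<circ> T) b - cscale (l\<^sup>2) b)"
      unfolding multiplier_square[OF Suc.prems(1)] using Suc.prems nn by (intro mult_left_mono) auto
  qed simp
  also have "\<dots> \<le> q ((T \<circ> T) b) ^ 2 ^ k + cmod (l\<^sup>2) ^ 2 ^ k"
    using Suc.prems(2) low by (intro Suc.IH multiplier_comp Suc.prems(1)) auto
  also have "\<dots> = q (T b) ^ 2 ^ Suc k + cmod l ^ 2 ^ Suc k"
    using multiplier_norm[OF Suc.prems(1), of "T b"] Suc.prems(1) b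
    by (simp add: multiplier_def power_mult norm_power flip: power2_eq_square)
  finally show ?case .
qed

lemma ex_scalar: assumes x: "x \<in> S" shows "\<exists>l. q (x * b - cscale l b) = 0"
proof -
  define N where "N l = q (x * b - cscale l b)" for l
  have M: "multiplier (\<lambda>y. x * y)" using x
    by (auto simp: multiplier_def mult.assoc distrib_left mult_cscale_right)
  have Nnn: "N l \<ge> 0" for l unfolding N_def using x b by (intro q_nonneg[OF q]) auto
  have lip: "N l \<le> N l' + cmod (l - l')" for l l'
  proof -
    have eq: "x * b - cscale l b = (x * b - cscale l' b) + cscale (l' - l) b"
      by (simp add: cscale_diff_left)
    have "N l \<le> N l' + q (cscale (l' - l) b)"
      unfolding N_def eq using x b by (intro q_add[OF q]) auto
    then show ?thesis using b q_cscale[OF q b(1)] by (simp add: norm_minus_commute)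
  qed
  have cont: "continuous_on UNIV N"
  proof (rule continuous_onI)
    fix l l' and e :: real assume "e > 0"
    then show "\<exists>d>0. \<forall>l'\<in>UNIV. dist l' l < d \<longrightarrow> dist (N l') (N l) \<le> e" for l
    proof (intro exI[of _ e] conjI ballI impI)
      fix l' assume "dist l' l < e"
      then show "dist (N l') (N l) \<le> e" using lip[of l l'] lip[of l' l]
        by (simp add: dist_norm norm_minus_commute)
    qed
  qed
  have big: "cmod l \<le> N l + N 0" for l
  proof -
    have "cscale l b = x * b - (x * b - cscale l b)" by simp
    then have "q (cscale l b) \<le> q (x * b) + q (x * b - cscale l b)"
      using q_diff[OF q, of "x * b" "x * b - cscale l b"] x b by simp
    then show ?thesis using b q_cscale[OF q b(1)] by (simp add: N_def)
  qed
  \<comment> \<open>By \<open>big\<close>, outside this disc \<open>N l\<close> exceeds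
    \<open>N 0\<close>, so a minimum over the disc is a global one.\<close>
  have "\<exists>\<mu>\<in>cball 0 (2 * N 0). \<forall>l\<in>cball 0 (2 * N 0). N \<mu> \<le> N l"
    using Nnn[of 0] by (intro continuous_attains_inf continuous_on_subset[OF cont]) auto
  then obtain \<mu> where \<mu>: "\<And>l. cmod l \<le> 2 * N 0 \<Longrightarrow> N \<mu> \<le> N l"
    by (metis mem_cball_0)
  have min: "N \<mu> \<le> N l" for l
  proof (cases "cmod l \<le> 2 * N 0")
    case False
    then show ?thesis using \<mu>[of 0] Nnn[of 0] big[of l] by simp
  qed (use \<mu> in auto)
  define m where "m = N \<mu>"
  have "m = 0"
  proof (rule ccontr)
    assume "m \<noteq> 0"
    then have m: "m > 0" using Nnn[of \<mu>] by (simp add: m_def)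
    \<comment> \<open>A positive minimum spreads from a point to the open disc of radius
      \<open>m\<close> around it: the Ostrowski estimate bounds \<open>N\<close> there by m (1 +
      r^(2^k)) with r < 1.\<close>
    have step: "N (\<nu> + l) = m" if \<nu>: "N \<nu> = m" and l: "cmod l < m" for \<nu> l
    proof -
      define T where "T = (\<lambda>y. x * y - cscale \<nu> y)"
      have T: "multiplier T" unfolding T_def by (rule multiplier_shift[OF M])
      have TN: "q (T b - cscale l' b) = N (\<nu> + l')" for l'
        by (simp add: T_def N_def cscale_add_left algebra_simps)
      have T0: "q (T b) = m" using \<nu> by (simp add: T_def N_def)
      define r where "r = cmod l / m"
      have r: "0 \<le> r" "r < 1" using l m by (auto simp: r_def)
      have "N (\<nu> + l) \<le> m * (1 + r ^ k)" for k
      proof -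
        have "N (\<nu> + l) * m ^ (2 ^ k - 1) \<le> m ^ (2 ^ k) + cmod l ^ (2 ^ k)"
          using multiplier_dist_scalars[OF T, of m l k] min m T0 by (simp add: TN m_def)
        also have "\<dots> = m ^ (2 ^ k) * (1 + r ^ (2 ^ k))" using m by (simp add: r_def power_divide distrib_left)
        also have "\<dots> = m ^ (2 ^ k - 1) * (m * (1 + r ^ (2 ^ k)))"
          using power_minus_mult[of "2 ^ k" m] by (simp add: algebra_simps)
        finally have "N (\<nu> + l) \<le> m * (1 + r ^ (2 ^ k))" using m by (simp add: mult.commute)
        also have "\<dots> \<le> m * (1 + r ^ k)" using m r by (auto intro!: power_decreasing)
        finally show ?thesis .
      qed
      moreover have "(\<lambda>k. m * (1 + r ^ k)) \<longlonglongrightarrow> m * (1 + 0)"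
        using r by (intro tendsto_intros LIMSEQ_power_zero) auto
      ultimately have "N (\<nu> + l) \<le> m" using LIMSEQ_le_const by fastforce
      then show ?thesis using min[of "\<nu> + l"] by (simp add: m_def)
    qed
    \<comment> \<open>Walking in steps of length m/2 stays inside these discs, so \<open>N\<close>
      is constant along an unbounded sequence, against the growth in \<open>big\<close>.\<close>
    have const: "N (\<mu> + of_nat j * of_real (m / 2)) = m" for j :: nat
    proof (induction j)
      case (Suc j)
      have "\<mu> + of_nat (Suc j) * of_real (m / 2) = (\<mu> + of_nat j * of_real (m / 2)) + of_real (m / 2)"
        by (simp add: algebra_simps)
      then show ?case using step[OF Suc, of "of_real (m / 2)"] m by (simp only:) (simp add: norm_divide)
    qed (simp add: m_def)
    obtain j :: nat where j: "real j * (m / 2) > m + N 0 + cmod \<mu>"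
      using reals_Archimedean3[of "m / 2"] m by (meson half_gt_zero)
    have "real j * (m / 2) = cmod ((\<mu> + of_nat j * of_real (m / 2)) - \<mu>)"
      using m by (simp add: norm_mult)
    also have "\<dots> \<le> cmod (\<mu> + of_nat j * of_real (m / 2)) + cmod \<mu>" by (rule norm_triangle_ineq4)
    also have "\<dots> \<le> m + N 0 + cmod \<mu>" using big[of "\<mu> + of_nat j * of_real (m / 2)"] const by simp
    finally show False using j by simp
  qed
  then show ?thesis by (auto simp: m_def N_def)
qed

text \<open>The value at x is the scalar l for which x b and l b have \<open>q\<close>-distance 0.
  It is unique because \<open>q b = 1\<close>, and its modulus is \<open>q x\<close>; all algebraic
  laws follow from uniqueness.\<close>

lemma ex_character_of_seminorm: "\<exists>\<phi>. character S \<phi> \<and> cmod (\<phi> b) = 1"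
proof -
  define \<phi> where "\<phi> x = (SOME l. q (x * b - cscale l b) = 0)" for x
  have \<phi>: "q (x * b - cscale (\<phi> x) b) = 0" if "x \<in> S" for x
    unfolding \<phi>_def using ex_scalar[OF that] by (rule someI_ex)
  have unique: "\<phi> x = l" if x: "x \<in> S" and l: "q (x * b - cscale l b) = 0" for x l
  proof -
    have "cscale (\<phi> x - l) b = (x * b - cscale l b) - (x * b - cscale (\<phi> x) b)"
      by (simp add: cscale_diff_left)
    then have "q (cscale (\<phi> x - l) b) \<le> q (x * b - cscale l b) + q (x * b - cscale (\<phi> x) b)"
      using q_diff[OF q, of "x * b - cscale l b" "x * b - cscale (\<phi> x) b"] x b by simp
    then show ?thesis using l \<phi>[OF x] b q_cscale[OF q b(1)] by simp
  qed
  have mod: "cmod (\<phi> x) = q x" if x: "x \<in> S" for x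
  proof -
    have "q (x * b) \<le> q (x * b - cscale (\<phi> x) b) + q (cscale (\<phi> x) b)"
      using q_add[OF q, of "x * b - cscale (\<phi> x) b" "cscale (\<phi> x) b"] x b by simp
    moreover have "q (cscale (\<phi> x) b) \<le> q (x * b) + q (x * b - cscale (\<phi> x) b)"
      using q_diff[OF q, of "x * b" "x * b - cscale (\<phi> x) b"] x b by simp
    ultimately show ?thesis using \<phi>[OF x] b q_cscale[OF q b(1)] qmult[OF x b(1)] by simp
  qed
  have q0: "q z = 0" if "q u = 0" "q v = 0" "z = u + v" "u \<in> S" "v \<in> S" for z u v
    using q_add[OF q, of u v] q_nonneg[OF q, of z] that by auto
  have add: "\<phi> (x + y) = \<phi> x + \<phi> y" if "x \<in> S" "y \<in> S" for x y
  proof (rule unique)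
    show "q ((x + y) * b - cscale (\<phi> x + \<phi> y) b) = 0"
      by (rule q0[OF \<phi> \<phi>]) (use that b in \<open>auto simp: cscale_add_left algebra_simps\<close>)
  qed (use that in auto)
  have scale: "\<phi> (cscale c x) = c * \<phi> x" if "x \<in> S" for c x
  proof (rule unique)
    have "q (cscale c x * b - cscale (c * \<phi> x) b) = q (cscale c (x * b - cscale (\<phi> x) b))"
      by (simp add: cscale_diff_right cscale_cscale mult_cscale_left)
    then show "q (cscale c x * b - cscale (c * \<phi> x) b) = 0"
      using \<phi>[OF that] q_cscale[OF q, of "x * b - cscale (\<phi> x) b" c] that b by simp
  qed (use that in auto)
  have mult: "\<phi> (x * y) = \<phi> x * \<phi> y" if xy: "x \<in> S" "y \<in> S" for x y
  proof (rule unique)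
    show "q (x * y * b - cscale (\<phi> x * \<phi> y) b) = 0"
    proof (rule q0)
      show "q (x * (y * b - cscale (\<phi> y) b)) = 0" using qmult \<phi> xy b by simp
      show "q (cscale (\<phi> y) (x * b - cscale (\<phi> x) b)) = 0"
        using \<phi>[OF xy(1)] q_cscale[OF q, of "x * b - cscale (\<phi> x) b" "\<phi> y"] xy b by simp
    qed (use xy b in \<open>auto simp: cscale_diff_right cscale_cscale mult_cscale_left mult_cscale_right
        algebra_simps\<close>)
  qed (use xy in auto)
  \<comment> \<open>Taking adjoints of the defining relation replaces \<open>b\<close> by
    \<open>adj b\<close>. Applying the functional itself and cancelling its nonzero value at
    \<open>adj b\<close> repairs this.\<close>
  have adj: "\<phi> (adj x) = cnj (\<phi> x)" if x: "x \<in> S" for x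
  proof -
    have "adj (x * b - cscale (\<phi> x) b) = adj x * adj b - cscale (cnj (\<phi> x)) (adj b)"
      using x b by (simp add: adj_diff adj_mult adj_cscale comm)
    then have "q (adj x * adj b - cscale (cnj (\<phi> x)) (adj b)) = 0"
      using q_adj[OF q, of "x * b - cscale (\<phi> x) b"] \<phi>[OF x] x b by simp
    then have "\<phi> (adj x * adj b - cscale (cnj (\<phi> x)) (adj b)) = 0"
      using mod[of "adj x * adj b - cscale (cnj (\<phi> x)) (adj b)"] x b by simp
    moreover have "\<phi> (adj x * adj b - cscale (cnj (\<phi> x)) (adj b)) = (\<phi> (adj x) - cnj (\<phi> x)) * \<phi> (adj b)"
      using add[of "adj x * adj b" "cscale (- cnj (\<phi> x)) (adj b)"] mult[of "adj x" "adj b"]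
        scale[of "adj b" "- cnj (\<phi> x)"] x b
      by (simp add: cscale_minus_left algebra_simps)
    moreover have "\<phi> (adj b) \<noteq> 0" using mod[of "adj b"] q_adj[OF q, of b] b by auto
    ultimately show ?thesis by simp
  qed
  have "character S \<phi>" using add scale mult adj mod q_le[OF q] by (auto simp: character_def)
  then show ?thesis using mod b by auto
qed

end

text \<open>This holds without completeness: after scaling \<open>b\<close> to norm 1, a minimal
  seminorm with value 1 at \<open>b\<close> is multiplicative, and a multiplicative seminorm is the
  modulus of a character.\<close>

theorem gelfand:
  assumes "b \<in> S" shows "\<exists>\<phi>. character S \<phi> \<and> cmod (\<phi> b) = norm b"
proof (cases "b = 0")
  case True
  then show ?thesis by (intro exI[of _ "\<lambda>_. 0"]) (auto simp: character_def)
next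
  case False
  define b' where "b' = cscale (of_real (1 / norm b)) b"
  have b': "b' \<in> S" "norm b' = 1" using assms False by (auto simp: b'_def norm_cscale norm_divide)
  obtain q where "cstar_seminorm q" "q b' = 1" "\<And>x y. x \<in> S \<Longrightarrow> y \<in> S \<Longrightarrow> q (x * y) = q x * q y"
    using ex_multiplicative_seminorm[OF b'] by metis
  then obtain \<phi> where \<phi>: "character S \<phi>" "cmod (\<phi> b') = 1"
    using ex_character_of_seminorm b' by metis
  have "\<phi> b' = of_real (1 / norm b) * \<phi> b" using \<phi>(1) assms by (auto simp: b'_def character_def)
  then have "cmod (\<phi> b) = norm b" using \<phi>(2) False by (simp add: norm_mult norm_divide)
  then show ?thesis using \<phi> by blast
qed

end

subsection \<open>Functional calculus and star-homomorphisms\<close>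

lemma characterD:
  assumes "character S \<phi>"
  shows character_add: "\<And>x y. x \<in> S \<Longrightarrow> y \<in> S \<Longrightarrow> \<phi> (x + y) = \<phi> x + \<phi> y"
    and character_mult: "\<And>x y. x \<in> S \<Longrightarrow> y \<in> S \<Longrightarrow> \<phi> (x * y) = \<phi> x * \<phi> y"
    and character_cscale: "\<And>a x. x \<in> S \<Longrightarrow> \<phi> (cscale a x) = a * \<phi> x"
    and character_adj: "\<And>x. x \<in> S \<Longrightarrow> \<phi> (adj x) = cnj (\<phi> x)"
    and character_norm: "\<And>x. x \<in> S \<Longrightarrow> cmod (\<phi> x) \<le> norm x"
    and character_sa: "\<And>x. x \<in> S \<Longrightarrow> adj x = x \<Longrightarrow> \<phi> x = of_real (Re (\<phi> x))"
  using assms by (auto simp: character_def complex_eq_iff)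

lemma (in comm_star_alg)
  assumes "character S \<phi>"
  shows character_0: "\<phi> 0 = 0"
    and character_minus: "\<And>x. x \<in> S \<Longrightarrow> \<phi> (- x) = - \<phi> x"
    and character_diff: "\<And>x y. x \<in> S \<Longrightarrow> y \<in> S \<Longrightarrow> \<phi> (x - y) = \<phi> x - \<phi> y"
proof -
  show "\<phi> 0 = 0" using character_cscale[OF assms, of 0 0] by simp
  show m: "\<phi> (- x) = - \<phi> x" if "x \<in> S" for x
    using character_cscale[OF assms that, of "- 1"] by (simp add: cscale_minus_left)
  show "\<phi> (x - y) = \<phi> x - \<phi> y" if "x \<in> S" "y \<in> S" for x y
    using character_add[OF assms, of x "- y"] m that by simp
qed

lemma (in comm_star_alg) norm_le_characters:
  assumes "x \<in> S" "\<And>\<phi>. character S \<phi> \<Longrightarrow> cmod (\<phi> x) \<le> M"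
  shows "norm x \<le> M"
  using gelfand[OF assms(1)] assms(2) by fastforce

lemma (in comm_star_alg) eq_characters:
  assumes "x \<in> S" "y \<in> S" "\<And>\<phi>. character S \<phi> \<Longrightarrow> \<phi> x = \<phi> y"
  shows "x = y"
proof -
  have "norm (x - y) \<le> 0"
    using assms by (intro norm_le_characters) (auto simp: character_diff)
  then show ?thesis by simp
qed

locale comm_cstar = comm_star_alg +
  assumes closed: "closed S"

lemma comm_cstarI: "cstar_subalgebra S \<Longrightarrow> abelian S \<Longrightarrow> comm_cstar S"
  by unfold_locales (auto simp: cstar_subalgebra_iff)

context comm_cstar
begin

text \<open>Otherwise some \<open>h\<close> has norm less than 1 and value 1. The sum
  \<open>y\<close> of all its powers from the first on lies in the closed set \<open>S\<close> and
  satisfies \<open>y = h + h * y\<close>, so its value would be 1 more than itself.\<close>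

lemma characterI:
  assumes add: "\<And>x y. x \<in> S \<Longrightarrow> y \<in> S \<Longrightarrow> \<phi> (x + y) = \<phi> x + \<phi> y"
    and mult: "\<And>x y. x \<in> S \<Longrightarrow> y \<in> S \<Longrightarrow> \<phi> (x * y) = \<phi> x * \<phi> y"
    and scale: "\<And>a x. x \<in> S \<Longrightarrow> \<phi> (cscale a x) = a * \<phi> x"
    and adj: "\<And>x. x \<in> S \<Longrightarrow> \<phi> (adj x) = cnj (\<phi> x)"
  shows "character S \<phi>"
proof -
  have "cmod (\<phi> x) \<le> norm x" if x: "x \<in> S" for x
  proof (rule ccontr)
    assume "\<not> ?thesis"
    then have less: "norm x < cmod (\<phi> x)" by simp
    define h where "h = cscale (inverse (\<phi> x)) x"
    have nz: "\<phi> x \<noteq> 0" using less by auto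
    have h: "h \<in> S" "\<phi> h = 1" "norm h < 1"
      using x less nz scale[OF x, of "inverse (\<phi> x)"]
      by (auto simp: h_def norm_cscale norm_inverse norm_divide divide_simps)
    have bound: "norm (L h n h) \<le> norm h ^ n * norm h" for n
    proof (induction n)
      case (Suc n)
      have "norm (L h (Suc n) h) \<le> norm h * norm (L h n h)" by (simp add: norm_mult_ineq)
      also have "\<dots> \<le> norm h * (norm h ^ n * norm h)" using Suc by (intro mult_left_mono) auto
      finally show ?case by (simp add: mult.assoc)
    qed simp
    have sm: "summable (\<lambda>n. L h n h)"
      by (rule summable_comparison_test'[of "\<lambda>n. norm h ^ n * norm h" 0])
        (use h bound in \<open>auto intro!: summable_mult2 summable_geometric\<close>)
    define y where "y = (\<Sum>n. L h n h)"
    have "(\<lambda>n. \<Sum>i<n. L h i h) \<longlonglongrightarrow> y" unfolding y_def by (rule summable_LIMSEQ[OF sm])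
    moreover have "(\<Sum>i<n. L h i h) \<in> S" for n using h by (induction n) auto
    ultimately have y: "y \<in> S" using closed_sequentially[OF closed, of "\<lambda>n. \<Sum>i<n. L h i h" y] by simp
    have "y = L h 0 h + (\<Sum>n. L h (Suc n) h)" using suminf_split_head[OF sm] by (simp add: y_def)
    also have "(\<Sum>n. L h (Suc n) h) = h * y" using sm by (simp add: y_def suminf_mult)
    finally have "y = h + h * y" by simp
    then have "\<phi> y = 1 + \<phi> y" using add[of h "h * y"] mult[of h y] h y by simp
    then show False by simp
  qed
  then show ?thesis using assms by (auto simp: character_def)
qed

text \<open>The factor \<open>b\<close> replaces the unit: constants have no value in
  \<open>S\<close>, but their multiples of \<open>b\<close> do. Products are handled by using the
  element found for the second factor as the new \<open>b\<close>.\<close>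

lemma functional_calculus_poly:
  assumes "real_polynomial_function p" and h: "h \<in> S" "adj h = h"
  shows "b \<in> S \<Longrightarrow> \<exists>z\<in>S. \<forall>\<phi>. character S \<phi> \<longrightarrow> \<phi> z = of_real (p (Re (\<phi> h))) * \<phi> b"
  using assms(1)
proof (induction p arbitrary: b rule: real_polynomial_function.induct)
  case (linear p)
  have p: "p t = t * p 1" for t using linear(1)
    by (metis bounded_linear.linear linear_scale mult.right_neutral real_scaleR_def)
  show ?case
  proof (intro bexI allI impI)
    show "cscale (of_real (p 1)) (h * b) \<in> S" using linear h by auto
    fix \<phi> assume \<phi>: "character S \<phi>"
    show "\<phi> (cscale (of_real (p 1)) (h * b)) = of_real (p (Re (\<phi> h))) * \<phi> b"
      using linear(2) h character_sa[OF \<phi> h] unfolding p[of "Re (\<phi> h)"]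
      by (simp add: character_cscale[OF \<phi>] character_mult[OF \<phi>])
  qed
next
  case (const c)
  then show ?case by (intro bexI[of _ "cscale (of_real c) b"]) (auto simp: character_cscale[of S])
next
  case (add p1 p2)
  obtain z1 where "z1 \<in> S" "\<forall>\<phi>. character S \<phi> \<longrightarrow> \<phi> z1 = of_real (p1 (Re (\<phi> h))) * \<phi> b"
    using add.IH(1)[OF add.prems] by blast
  moreover obtain z2 where "z2 \<in> S" "\<forall>\<phi>. character S \<phi> \<longrightarrow> \<phi> z2 = of_real (p2 (Re (\<phi> h))) * \<phi> b"
    using add.IH(2)[OF add.prems] by blast
  ultimately show ?case
    by (intro bexI[of _ "z1 + z2"]) (auto simp: character_add[of S] distrib_right)
next
  case (mult p1 p2)
  obtain z2 where z2: "z2 \<in> S" "\<forall>\<phi>. character S \<phi> \<longrightarrow> \<phi> z2 = of_real (p2 (Re (\<phi> h))) * \<phi> b"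
    using mult.IH(2)[OF mult.prems] by blast
  obtain z1 where "z1 \<in> S" "\<forall>\<phi>. character S \<phi> \<longrightarrow> \<phi> z1 = of_real (p1 (Re (\<phi> h))) * \<phi> z2"
    using mult.IH(1)[OF z2(1)] by blast
  then show ?case using z2(2) by (intro bexI[of _ z1]) auto
qed

text \<open>The element is g(h) b, a limit of the polynomial ones by Weierstrass approximation on
  the interval of radius \<open>norm h\<close>. Because of the factor \<open>b\<close>, the function
  \<open>g\<close> may be nonzero at 0.\<close>

theorem functional_calculus:
  assumes h: "h \<in> S" "adj h = h" and b: "b \<in> S" and g: "continuous_on UNIV (g :: real \<Rightarrow> real)"
  shows "\<exists>z\<in>S. \<forall>\<phi>. character S \<phi> \<longrightarrow> \<phi> z = of_real (g (Re (\<phi> h))) * \<phi> b"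
proof -
  define I where "I = {- norm h..norm h}"
  have I: "Re (\<phi> h) \<in> I" if "character S \<phi>" for \<phi>
    using character_norm[OF that h(1)] abs_Re_le_cmod[of "\<phi> h"] by (auto simp: I_def)
  define e where "e k = inverse (real (Suc k))" for k
  have "\<exists>p. real_polynomial_function p \<and> (\<forall>t\<in>I. \<bar>g t - p t\<bar> < e k)" for k
  proof -
    have "compact I" "continuous_on I g" "e k > 0"
      using continuous_on_subset[OF g, of I] by (simp_all add: I_def e_def)
    from Stone_Weierstrass_real_polynomial_function[OF this] show ?thesis by metis
  qed
  then obtain p where p: "\<And>k. real_polynomial_function (p k)" "\<And>k t. t \<in> I \<Longrightarrow> \<bar>g t - p k t\<bar> < e k"
    by metis
  have "\<exists>z\<in>S. \<forall>\<phi>. character S \<phi> \<longrightarrow> \<phi> z = of_real (p k (Re (\<phi> h))) * \<phi> b" for k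
    using functional_calculus_poly[OF p(1) h b] .
  then obtain z where z: "\<And>k. z k \<in> S"
    "\<And>k \<phi>. character S \<phi> \<Longrightarrow> \<phi> (z k) = of_real (p k (Re (\<phi> h))) * \<phi> b" by metis
  have e0: "e \<longlonglongrightarrow> 0" unfolding e_def using LIMSEQ_inverse_real_of_nat by simp
  have dist: "norm (z k - z l) \<le> (e k + e l) * norm b" for k l
  proof (rule norm_le_characters)
    fix \<phi> assume \<phi>: "character S \<phi>"
    have "\<phi> (z k - z l) = of_real (p k (Re (\<phi> h)) - p l (Re (\<phi> h))) * \<phi> b"
      using z(1) by (simp add: character_diff[OF \<phi>] z(2)[OF \<phi>] left_diff_distrib)
    then have "cmod (\<phi> (z k - z l)) = \<bar>p k (Re (\<phi> h)) - p l (Re (\<phi> h))\<bar> * cmod (\<phi> b)"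
      by (simp only: norm_mult norm_of_real)
    also have "\<dots> \<le> (e k + e l) * norm b"
      using p(2)[OF I[OF \<phi>], of k] p(2)[OF I[OF \<phi>], of l] character_norm[OF \<phi> b]
      by (intro mult_mono) auto
    finally show "cmod (\<phi> (z k - z l)) \<le> (e k + e l) * norm b" .
  qed (use z in auto)
  have "Cauchy z"
  proof (rule CauchyI)
    fix d :: real assume d: "d > 0"
    define d' where "d' = d / (2 * (norm b + 1))"
    have "d' > 0" using d by (auto simp: d'_def intro!: divide_pos_pos add_nonneg_pos)
    then obtain M where M: "\<And>n. n \<ge> M \<Longrightarrow> \<bar>e n\<bar> < d'"
      using LIMSEQ_D[OF e0, of d'] by auto
    have "norm (z m - z n) < d" if "m \<ge> M" "n \<ge> M" for m n
    proof -
      have "norm (z m - z n) \<le> (e m + e n) * norm b" by (rule dist)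
      also have "\<dots> \<le> (2 * d') * norm b" using M[OF that(1)] M[OF that(2)] by (intro mult_right_mono) auto
      also have "\<dots> < (2 * d') * (norm b + 1)" using \<open>d' > 0\<close> by simp
      also have "\<dots> = d" proof -
        have "c > 0 \<Longrightarrow> 2 * (d / (2 * c)) * c = d" for c by simp
        from this[of "norm b + 1"] show ?thesis by (simp add: d'_def add_nonneg_pos)
      qed
      finally show ?thesis .
    qed
    then show "\<exists>M. \<forall>m\<ge>M. \<forall>n\<ge>M. norm (z m - z n) < d" by blast
  qed
  then obtain y where y: "z \<longlonglongrightarrow> y" using Cauchy_convergent_iff convergent_def by blast
  have yS: "y \<in> S" using closed_sequentially[OF closed, of z y] z(1) y by simp
  show ?thesis
  proof (intro bexI[OF _ yS] allI impI)
    fix \<phi> assume \<phi>: "character S \<phi>"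
    have "(\<lambda>k. norm (z k - y)) \<longlonglongrightarrow> 0" using y by (simp add: LIM_zero tendsto_norm_zero)
    then have "(\<lambda>k. \<phi> (z k) - \<phi> y) \<longlonglongrightarrow> 0"
    proof (rule Lim_null_comparison[rotated])
      show "\<forall>\<^sub>F k in sequentially. norm (\<phi> (z k) - \<phi> y) \<le> norm (z k - y)"
        using character_norm[OF \<phi>, of "z _ - y"] z yS by (simp add: character_diff[OF \<phi>])
    qed
    then have 1: "(\<lambda>k. \<phi> (z k)) \<longlonglongrightarrow> \<phi> y" by (simp add: LIM_zero_iff)
    have "(\<lambda>k. p k (Re (\<phi> h)) - g (Re (\<phi> h))) \<longlonglongrightarrow> 0"
      by (rule Lim_null_comparison[OF _ e0])
        (use p(2)[OF I[OF \<phi>]] in \<open>auto simp: abs_minus_commute less_imp_le\<close>)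
    then have "(\<lambda>k. of_real (p k (Re (\<phi> h))) * \<phi> b) \<longlonglongrightarrow> of_real (g (Re (\<phi> h))) * \<phi> b"
      by (intro tendsto_intros) (simp add: LIM_zero_iff)
    then show "\<phi> y = of_real (g (Re (\<phi> h))) * \<phi> b" using 1 z(2)[OF \<phi>] LIMSEQ_unique by auto
  qed
qed

text \<open>With h = w^* w the choice y = h / (h^2 + s^2) makes 1 - h y equal to s^2 / (h^2 + s^2).
  The squared norm of the error is then at most the supremum of |t| (s^2 / (t^2 + s^2))^2, which is
  at most s/2 because 2 s |t| \<le> t^2 + s^2; hence s = e^2. Only \<open>adj w * w\<close> must lie
  in \<open>S\<close>, so \<open>w\<close> can be a normalizer.\<close>

lemma approx_unit:
  assumes "adj w * w \<in> S" "e > 0"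
  obtains y where "y \<in> S" "norm (w - w * (adj w * w) * y) < e"
proof -
  define h where "h = adj w * w"
  have h: "h \<in> S" "adj h = h" using assms by (auto simp: h_def adj_mult adj_adj)
  define s where "s = e\<^sup>2"
  have s: "s > 0" using assms by (simp add: s_def)
  have pos: "t\<^sup>2 + s\<^sup>2 > 0" for t using s by (intro add_nonneg_pos) auto
  have cont: "continuous_on UNIV (\<lambda>t. 1 / (t\<^sup>2 + s\<^sup>2))"
    using pos by (intro continuous_intros) (auto simp: order_less_imp_not_eq2)
  obtain y where y: "y \<in> S" "\<And>\<phi>. character S \<phi> \<Longrightarrow> \<phi> y = of_real (1 / ((Re (\<phi> h))\<^sup>2 + s\<^sup>2)) * \<phi> h"
    using functional_calculus[OF h h(1) cont] by blast
  define u where "u = h - h * h * y - adj y * h * h + adj y * h * h * h * y"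
  have uS: "u \<in> S" using h y by (auto simp: u_def)
  have "adj (w - w * h * y) * (w - w * h * y) = u"
    using h(2) by (simp add: adj_diff adj_mult u_def algebra_simps) (simp add: h_def mult.assoc)
  then have "(norm (w - w * h * y))\<^sup>2 = norm u" using cstar_identity[of "w - w * h * y"] by simp
  also have "norm u \<le> s / 2"
  proof (rule norm_le_characters[OF uS])
    fix \<phi> assume \<phi>: "character S \<phi>"
    define t where "t = Re (\<phi> h)"
    have ht: "\<phi> h = of_real t" using character_sa[OF \<phi> h] by (simp add: t_def)
    have yt: "\<phi> y = of_real (t / (t\<^sup>2 + s\<^sup>2))" using y(2)[OF \<phi>] unfolding ht by simp
    have ay: "\<phi> (adj y) = of_real (t / (t\<^sup>2 + s\<^sup>2))" using character_adj[OF \<phi> y(1)] yt by simp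
    have "\<phi> u = of_real (t - t * t * (t / (t\<^sup>2 + s\<^sup>2)) - (t / (t\<^sup>2 + s\<^sup>2)) * t * t + (t / (t\<^sup>2 + s\<^sup>2)) * t * t * t * (t / (t\<^sup>2 + s\<^sup>2)))"
      using h y by (simp add: u_def character_add[OF \<phi>] character_diff[OF \<phi>] character_mult[OF \<phi>] ht yt ay)
    also have "t - t * t * (t / (t\<^sup>2 + s\<^sup>2)) - (t / (t\<^sup>2 + s\<^sup>2)) * t * t + (t / (t\<^sup>2 + s\<^sup>2)) * t * t * t * (t / (t\<^sup>2 + s\<^sup>2))
      = t * (1 - t * (t / (t\<^sup>2 + s\<^sup>2)))\<^sup>2" by (simp add: power2_eq_square algebra_simps)
    also have "1 - t * (t / (t\<^sup>2 + s\<^sup>2)) = s\<^sup>2 / (t\<^sup>2 + s\<^sup>2)" using pos[of t] s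
      by (simp add: divide_simps power2_eq_square)
    finally have "cmod (\<phi> u) = \<bar>t\<bar> / (t\<^sup>2 + s\<^sup>2) * s\<^sup>2 * (s\<^sup>2 / (t\<^sup>2 + s\<^sup>2))"
      using pos[of t] by (simp only: norm_of_real) (simp add: abs_mult power2_eq_square)
    also have "\<dots> \<le> (1 / (2 * s)) * s\<^sup>2 * 1"
    proof (intro mult_mono)
      have "2 * s * \<bar>t\<bar> \<le> t\<^sup>2 + s\<^sup>2" using sum_squares_bound[of s "\<bar>t\<bar>"] by (simp add: add.commute)
      then show "\<bar>t\<bar> / (t\<^sup>2 + s\<^sup>2) \<le> 1 / (2 * s)" using pos[of t] s by (simp add: field_simps)
      show "s\<^sup>2 / (t\<^sup>2 + s\<^sup>2) \<le> 1" using pos[of t] by (simp add: field_simps)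
    qed (use s pos[of t] in auto)
    finally show "cmod (\<phi> u) \<le> s / 2" using s by (simp add: power2_eq_square)
  qed
  also have "s / 2 < e\<^sup>2" using s by (simp add: s_def)
  finally have "norm (w - w * h * y) < e" using assms(2) by (metis less_imp_le power_less_imp_less_base)
  then show thesis using that y(1) by (simp add: h_def)
qed

end

section \<open>Generated subalgebras and norms under star-homomorphisms\<close>

lemma cstar_subalgebra_gen: "cstar_subalgebra (cstar_gen X)"
  by (auto simp: cstar_gen_def cstar_subalgebra_def csubspace_def)

lemma cstar_gen_superset: "X \<subseteq> cstar_gen X"
  by (auto simp: cstar_gen_def)

lemma cstar_gen_least: "cstar_subalgebra T \<Longrightarrow> X \<subseteq> T \<Longrightarrow> cstar_gen X \<subseteq> T"
  by (auto simp: cstar_gen_def)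

lemma cstar_subalgebra_commutant:
  assumes "\<And>x. x \<in> X \<Longrightarrow> adj x \<in> X"
  shows "cstar_subalgebra {y. \<forall>x\<in>X. x * y = y * x}"
proof -
  have "{y. \<forall>x\<in>X. x * y = y * x} = (\<Inter>x\<in>X. {y. x * y = y * x})" by auto
  moreover have "closed (\<Inter>x\<in>X. {y. x * y = y * x})"
    by (intro closed_INT ballI closed_Collect_eq continuous_intros)
  moreover have "x * adj y = adj y * x" if "\<forall>x\<in>X. x * y = y * x" "x \<in> X" for x y
  proof -
    have "adj (adj x * y) = adj (y * adj x)" using that assms by simp
    then show ?thesis by (simp add: adj_mult adj_adj)
  qed
  moreover have "x * (y * z) = y * z * x" if "x * y = y * x" "x * z = z * x" for x y z :: 'a
    using that by (metis mult.assoc)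
  ultimately show ?thesis
    by (simp add: cstar_subalgebra_def csubspace_def distrib_left distrib_right
        mult_cscale_left mult_cscale_right)
qed

text \<open>The commutant argument is run twice: first the generated algebra commutes with
  \<open>X\<close>, and then, being in the commutant of the generated algebra, \<open>X\<close>
  generates within it.\<close>

lemma abelian_cstar_gen:
  assumes adj: "\<And>x. x \<in> X \<Longrightarrow> adj x \<in> X" and comm: "\<And>x y. x \<in> X \<Longrightarrow> y \<in> X \<Longrightarrow> x * y = y * x"
  shows "abelian (cstar_gen X)"
proof -
  have 1: "cstar_gen X \<subseteq> {y. \<forall>x\<in>X. x * y = y * x}"
    by (rule cstar_gen_least[OF cstar_subalgebra_commutant]) (use assms in auto)
  have "cstar_gen X \<subseteq> {y. \<forall>x\<in>cstar_gen X. x * y = y * x}"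
  proof (rule cstar_gen_least[OF cstar_subalgebra_commutant])
    show "adj x \<in> cstar_gen X" if "x \<in> cstar_gen X" for x
      using cstar_subalgebra_gen[of X] that by (auto simp: cstar_subalgebra_def)
    show "X \<subseteq> {y. \<forall>x\<in>cstar_gen X. x * y = y * x}" using 1 by auto
  qed
  then show ?thesis by (auto simp: abelian_def)
qed

text \<open>This gives access to characters and functional calculus for a self-adjoint element of a
  noncommutative algebra.\<close>

lemma sa_comm_cstar:
  assumes "cstar_subalgebra C" "h \<in> C" "adj h = h"
  obtains S where "comm_cstar S" "h \<in> S" "S \<subseteq> C"
proof (rule that)
  show "comm_cstar (cstar_gen {h})"
    by (intro comm_cstarI cstar_subalgebra_gen abelian_cstar_gen) (use assms in auto)
  show "h \<in> cstar_gen {h}" using cstar_gen_superset by blast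
  show "cstar_gen {h} \<subseteq> C" using assms by (intro cstar_gen_least) auto
qed

lemma star_homD:
  assumes "star_hom f C A"
  shows star_hom_add: "\<And>x y. x \<in> C \<Longrightarrow> y \<in> C \<Longrightarrow> f (x + y) = f x + f y"
    and star_hom_mult: "\<And>x y. x \<in> C \<Longrightarrow> y \<in> C \<Longrightarrow> f (x * y) = f x * f y"
    and star_hom_cscale: "\<And>a x. x \<in> C \<Longrightarrow> f (cscale a x) = cscale a (f x)"
    and star_hom_adj: "\<And>x. x \<in> C \<Longrightarrow> f (adj x) = adj (f x)"
    and star_hom_in: "\<And>x. x \<in> C \<Longrightarrow> f x \<in> A"
  using assms by (auto simp: star_hom_def)

lemma
  assumes f: "star_hom f C A" and C: "star_alg C"
  shows star_hom_0: "f 0 = 0"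
    and star_hom_minus: "\<And>x. x \<in> C \<Longrightarrow> f (- x) = - f x"
    and star_hom_diff: "\<And>x y. x \<in> C \<Longrightarrow> y \<in> C \<Longrightarrow> f (x - y) = f x - f y"
proof -
  show "f 0 = 0" using star_hom_cscale[OF f star_alg_0[OF C], of 0] by simp
  show m: "f (- x) = - f x" if "x \<in> C" for x
    using star_hom_cscale[OF f that, of "- 1"] by (simp add: cscale_minus_left)
  show "f (x - y) = f x - f y" if "x \<in> C" "y \<in> C" for x y
    using star_hom_add[OF f, of x "- y"] m that star_alg_minus[OF C] by simp
qed

lemma star_hom_character:
  assumes f: "star_hom f C A" and S: "comm_cstar S" "S \<subseteq> C" and \<phi>: "character (f ` S) \<phi>"
  shows "character S (\<lambda>x. \<phi> (f x))"
proof -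
  interpret comm_cstar S by fact
  have [simp]: "x \<in> S \<Longrightarrow> x \<in> C" for x using S by auto
  show ?thesis
    by (rule characterI) (simp_all add: star_homD[OF f] characterD[OF \<phi>])
qed

lemma star_hom_image:
  assumes f: "star_hom f C A" and S: "comm_cstar S" "S \<subseteq> C"
  shows "comm_star_alg (f ` S)"
proof -
  interpret comm_cstar S by fact
  have SC: "x \<in> S \<Longrightarrow> x \<in> C" for x using S by auto
  show ?thesis
  proof
    have "0 \<in> f ` S" using star_hom_cscale[OF f, of 0 0] SC by (metis closed_ops(1) cscale_zero image_eqI)
    then show "star_alg (f ` S)"
      by (auto simp: star_alg_def csubspace_def star_homD(1-4)[OF f, symmetric] SC intro!: imageI)
    show "abelian (f ` S)"
      by (auto simp: abelian_def star_homD(1-4)[OF f, symmetric] SC comm)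
  qed
qed

text \<open>The C*-identity reduces the claim to \<open>adj x * x\<close>. A character of the image
  that norms its value pulls back to a character of a commutative subalgebra, where the bound is
  automatic.\<close>

lemma star_hom_norm_le:
  assumes f: "star_hom f C A" and C: "cstar_subalgebra C" and x: "x \<in> C"
  shows "norm (f x) \<le> norm x"
proof -
  have Ca: "star_alg C" using C by (simp add: cstar_subalgebra_iff)
  define h where "h = adj x * x"
  have h: "h \<in> C" "adj h = h" using x star_algD[OF Ca] by (auto simp: h_def adj_mult adj_adj)
  obtain S where S: "comm_cstar S" "h \<in> S" "S \<subseteq> C" using sa_comm_cstar[OF C h] .
  interpret S: comm_cstar S by fact
  interpret fS: comm_star_alg "f ` S" using star_hom_image[OF f S(1,3)] .
  have "norm (f h) \<le> norm h"
  proof (rule fS.norm_le_characters)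
    fix \<phi> assume "character (f ` S) \<phi>"
    then show "cmod (\<phi> (f h)) \<le> norm h"
      using character_norm[OF star_hom_character[OF f S(1,3)] S(2)] by blast
  qed (use S in auto)
  then have "(norm (f x))\<^sup>2 \<le> (norm x)\<^sup>2"
    using x star_algD[OF Ca] cstar_identity[of x] cstar_identity[of "f x"]
    by (simp add: h_def star_homD[OF f])
  then show ?thesis by (simp add: power2_le_iff_abs_le)
qed

text \<open>If the norm of \<open>h\<close> dropped under \<open>f\<close>, a function vanishing on
  the interval of radius \<open>norm (f h)\<close> but not at the spectral value of modulus
  \<open>norm h\<close> would give a nonzero \<open>z\<close> with \<open>f z = 0\<close>.\<close>

lemma star_mono_norm:
  assumes f: "star_mono f C A" and C: "cstar_subalgebra C" and x: "x \<in> C"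
  shows "norm (f x) = norm x"
proof -
  have hom: "star_hom f C A" and inj: "inj_on f C" using f by (auto simp: star_mono_def)
  have Ca: "star_alg C" using C by (simp add: cstar_subalgebra_iff)
  define h where "h = adj x * x"
  have h: "h \<in> C" "adj h = h" using x star_algD[OF Ca] by (auto simp: h_def adj_mult adj_adj)
  obtain S where S: "comm_cstar S" "h \<in> S" "S \<subseteq> C" using sa_comm_cstar[OF C h] .
  interpret S: comm_cstar S by fact
  interpret fS: comm_star_alg "f ` S" using star_hom_image[OF hom S(1,3)] .
  have "norm h \<le> norm (f h)"
  proof (rule ccontr)
    assume "\<not> ?thesis"
    then have less: "norm (f h) < norm h" by simp
    have cont: "continuous_on UNIV (\<lambda>t. max 0 (\<bar>t\<bar> - norm (f h)))" by (intro continuous_intros)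
    obtain z where z: "z \<in> S"
      "\<And>\<phi>. character S \<phi> \<Longrightarrow> \<phi> z = of_real (max 0 (\<bar>Re (\<phi> h)\<bar> - norm (f h))) * \<phi> h"
      using S.functional_calculus[OF S(2) h(2) S(2) cont] by blast
    have "norm (f z) \<le> 0"
    proof (rule fS.norm_le_characters)
      fix \<phi> assume \<phi>: "character (f ` S) \<phi>"
      have "cmod (\<phi> (f h)) \<le> norm (f h)" using character_norm[OF \<phi>] S by auto
      then have "\<bar>Re (\<phi> (f h))\<bar> \<le> norm (f h)" using abs_Re_le_cmod order_trans by blast
      then show "cmod (\<phi> (f z)) \<le> 0"
        using z(2)[OF star_hom_character[OF hom S(1,3) \<phi>]] by simp
    qed (use z in auto)
    then have "f z = f 0" using star_hom_0[OF hom Ca] by simp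
    then have "z = 0" using inj z S star_alg_0[OF Ca] by (auto dest: inj_onD)
    obtain \<phi> where \<phi>: "character S \<phi>" "cmod (\<phi> h) = norm h" using S.gelfand[OF S(2)] by blast
    have "\<bar>Re (\<phi> h)\<bar> = norm h" using character_sa[OF \<phi>(1) S(2) h(2)] \<phi>(2) by (metis norm_of_real)
    then have "\<phi> z \<noteq> 0" using z(2)[OF \<phi>(1)] less \<phi>(2) by auto
    then show False using \<open>z = 0\<close> S.character_0[OF \<phi>(1)] by simp
  qed
  then have "(norm x)\<^sup>2 \<le> (norm (f x))\<^sup>2"
    using x star_algD[OF Ca] cstar_identity[of x] cstar_identity[of "f x"]
    by (simp add: h_def star_homD[OF hom])
  then show ?thesis using star_hom_norm_le[OF hom C x] by (simp add: power2_le_iff_abs_le)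
qed

lemma double_cancel: "x + x = y + y \<Longrightarrow> x = (y::'a::real_vector)"
  by (metis scaleR_2 scaleR_cancel_left zero_neq_numeral)

lemma closed_approxI:
  assumes "closed S" "\<And>e. e > 0 \<Longrightarrow> \<exists>y\<in>S. norm (x - y) < e"
  shows "x \<in> (S :: 'a::real_normed_vector set)"
  using assms closed_approachable[of S x] by (metis dist_norm norm_minus_commute)

lemma small_mult:
  fixes z :: "'a::real_normed_algebra"
  assumes "e > 0"
  obtains d where "d > 0" "\<And>x. norm x < d \<Longrightarrow> norm (x * z) < e" "\<And>x. norm x < d \<Longrightarrow> norm (z * x) < e"
proof -
  define K where "K = norm z + 1"
  have K: "K > 0" by (simp add: K_def add_nonneg_pos)
  have *: "norm x * norm z < e" if "norm x < e / K" for x :: 'a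
  proof -
    have "norm x * norm z \<le> e / K * norm z" using that by (intro mult_right_mono) auto
    also have "\<dots> < e / K * K" using assms K by (intro mult_strict_left_mono) (auto simp: K_def)
    finally show ?thesis using K by simp
  qed
  show thesis
  proof (rule that[of "e / K"])
    show "e / K > 0" using assms K by simp
    fix x :: 'a assume x: "norm x < e / K"
    show "norm (x * z) < e" using *[OF x] norm_mult_ineq[of x z] by simp
    show "norm (z * x) < e" using *[OF x] norm_mult_ineq[of z x] by (simp add: mult.commute)
  qed
qed

lemma (in comm_star_alg) sa_decomp:
  assumes "x \<in> S"
  shows "x + adj x \<in> S" "adj (x + adj x) = x + adj x"
    "cscale \<i> (x - adj x) \<in> S" "adj (cscale \<i> (x - adj x)) = cscale \<i> (x - adj x)"
    "(x + adj x) + cscale (- \<i>) (cscale \<i> (x - adj x)) = x + x"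
  using assms
  by (auto simp: adj_add adj_diff adj_adj adj_cscale cscale_diff_right cscale_minus_left cscale_cscale add.commute)

text \<open>Functional calculus applies only to self-adjoint elements, so a separating element is
  replaced by one of its two self-adjoint parts.\<close>

lemma (in comm_star_alg) characters_differ_sa:
  assumes "character S \<phi>" "character S \<psi>" "c \<in> S" "\<phi> c \<noteq> \<psi> c"
  obtains c' where "c' = c + adj c \<or> c' = cscale \<i> (c - adj c)" "c' \<in> S" "adj c' = c'" "\<phi> c' \<noteq> \<psi> c'"
proof -
  have "\<phi> (c + adj c) \<noteq> \<psi> (c + adj c) \<or> \<phi> (cscale \<i> (c - adj c)) \<noteq> \<psi> (cscale \<i> (c - adj c))"
  proof (rule ccontr)
    assume "\<not> ?thesis"
    then have "\<phi> c + \<phi> (adj c) = \<psi> c + \<psi> (adj c)" "\<phi> c - \<phi> (adj c) = \<psi> c - \<psi> (adj c)"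
      using assms(3) by (simp_all add: characterD(1,3)[OF assms(1)] characterD(1,3)[OF assms(2)]
          character_diff[OF assms(1)] character_diff[OF assms(2)])
    then have "(\<phi> c + \<phi> (adj c)) + (\<phi> c - \<phi> (adj c)) = (\<psi> c + \<psi> (adj c)) + (\<psi> c - \<psi> (adj c))"
      by (simp only:)
    then show False using assms(4) by simp
  qed
  then show thesis using that sa_decomp[OF assms(3)] by metis
qed

subsection \<open>Normalizers\<close>

lemma normalizersD:
  assumes "v \<in> normalizers C D"
  shows "v \<in> C" "\<And>d. d \<in> D \<Longrightarrow> v * d * adj v \<in> D" "\<And>d. d \<in> D \<Longrightarrow> adj v * d * v \<in> D"
  using assms by (auto simp: normalizers_def)

lemma normalizers_adj:
  assumes "star_alg C" "v \<in> normalizers C D" shows "adj v \<in> normalizers C D"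
  using assms star_alg_adj[OF assms(1)] by (auto simp: normalizers_def adj_adj)

lemma normalizers_mult:
  assumes "star_alg C" "v \<in> normalizers C D" "w \<in> normalizers C D"
  shows "v * w \<in> normalizers C D"
  unfolding normalizers_def
proof (intro CollectI conjI ballI)
  fix d assume d: "d \<in> D"
  have "v * (w * d * adj w) * adj v \<in> D" "adj w * (adj v * d * v) * w \<in> D"
    using normalizersD[OF assms(2)] normalizersD[OF assms(3)] d by blast+
  then show "v * w * d * adj (v * w) \<in> D" "adj (v * w) * d * (v * w) \<in> D"
    by (simp_all add: adj_mult mult.assoc)
qed (use assms star_alg_mult in \<open>auto simp: normalizers_def\<close>)

lemma subalgebra_normalizes:
  assumes "star_alg D" "D \<subseteq> C" shows "D \<subseteq> normalizers C D"
  using assms star_algD[OF assms(1)] by (auto simp: normalizers_def)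

text \<open>No approximate unit is needed: \<open>k = [d, v\<^sup>*v]\<close> is normal and \<open>k\<^sup>3 = 0\<close>.\<close>

lemma normalizer_square_commutes:
  assumes D: "comm_star_alg D" and v: "v \<in> normalizers C D" and d: "d \<in> D"
  shows "adj v * v * d = d * (adj v * v)"
proof -
  interpret comm_star_alg D by fact
  note nv = normalizersD[OF v]
  define h where "h = adj v * v"
  have hsa: "adj h = h" by (simp add: h_def adj_mult adj_adj)
  have sa: "h * d = d * h" if d: "d \<in> D" "adj d = d" for d
  proof -
    define k where "k = d * h - h * d"
    have kk: "adj k = - k" using d hsa by (simp add: k_def adj_diff adj_mult)
    have kX: "k * (h * c * h) = 0" if c: "c \<in> D" for c
    proof -
      define X where "X = h * c * h"
      have "adj v * (v * c * adj v) * v \<in> D" using nv c by auto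
      then have X: "X \<in> D" by (simp add: X_def h_def mult.assoc)
      \<comment> \<open>The commuting elements \<open>v * a * adj v\<close> and
        \<open>v * c * adj v\<close> of \<open>D\<close> are multiplied in both orders and
        conjugated by \<open>v\<close>, which gives \<open>h * a * X = X * a * h\<close>; then
        \<open>X\<close> is moved past \<open>a\<close>.\<close>
      have hX: "h * (a * X) = a * X * h" if a: "a \<in> D" for a
      proof -
        have "adj v * ((v * a * adj v) * d) * v = adj v * (d * (v * a * adj v)) * v" if "d \<in> D" for d
          using nv a that by (subst comm[of "v * a * adj v" d]) auto
        from this[of "v * c * adj v"] have "h * a * X = X * a * h"
          using nv c by (simp add: h_def X_def mult.assoc)
        then show ?thesis using comm[OF X a] by (simp add: mult.assoc)
      qed
      have "h * (d * (adj X * X)) = d * (h * (adj X * X))"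
        using hX[of "d * adj X"] hX[of "adj X"] X d by (simp add: mult.assoc)
      then have "k * (adj X * X) = 0" by (simp add: k_def left_diff_distrib mult.assoc)
      then have "k * (X * adj X) = 0" using comm[of X "adj X"] X by simp
      then have "(k * X) * adj (k * X) = 0" by (simp add: adj_mult adj_adj mult.assoc[symmetric])
      then show ?thesis by (simp add: X_def)
    qed
    have khc: "k * h * c = 0" if c: "c \<in> D" for c
    proof -
      have "k * (h * (c * adj c) * h) * adj k = 0" using kX[of "c * adj c"] c by simp
      then have "(k * h * c) * adj (k * h * c) = 0" by (simp add: adj_mult hsa mult.assoc)
      then show ?thesis by simp
    qed
    have "adj (k * h * d) = - (d * h * k)" using d hsa kk by (simp add: adj_mult mult.assoc)
    then have "d * h * k = 0" using khc[OF d(1)] by simp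
    then have "k * k = - (h * d * k)" by (simp add: k_def algebra_simps)
    then have "k * (k * k) = - (k * h * d) * k" by (simp add: mult.assoc)
    then have k3: "k * (k * k) = 0" using khc d by simp
    have "(k * k) * adj (k * k) = 0" using k3 kk by (simp add: adj_mult mult.assoc)
    then have "k * k = 0" by simp
    then have "adj k * k = 0" using kk by simp
    then have "k = 0" by simp
    then show ?thesis by (simp add: k_def)
  qed
  have "h * (d + d) = (d + d) * h"
  proof -
    note x = sa_decomp[OF d]
    show ?thesis using sa[OF x(1,2)] sa[OF x(3,4)]
      by (simp only: x(5)[symmetric] distrib_left distrib_right mult_cscale_left mult_cscale_right)
  qed
  then show ?thesis using double_cancel[of "h * d" "d * h"] by (simp add: distrib_left distrib_right h_def)
qed

subsection \<open>Cartan inclusions\<close>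

locale cartan_incl =
  fixes A B :: "'a::cstar_ambient set" and E :: "'a \<Rightarrow> 'a"
  assumes cartan: "cartan A B E"
begin

lemma subalgebras: "cstar_subalgebra A" "cstar_subalgebra B" "B \<subseteq> A"
  and maximal: "maximal_abelian A B" and regular: "regular_incl A B"
  and cond_exp: "cond_exp A B E"
  and faithful: "\<And>x. x \<in> A \<Longrightarrow> E (adj x * x) = 0 \<Longrightarrow> x = 0"
  using cartan by (auto simp: cartan_def inclusion_def faithful_cond_exp_def)

sublocale B: comm_cstar B
  using subalgebras maximal by (intro comm_cstarI) (auto simp: maximal_abelian_def)

lemma star_alg_A: "star_alg A"
  using subalgebras by (simp add: cstar_subalgebra_iff)

lemmas A_ops [simp, intro] = star_algD[OF star_alg_A]

lemma BA [simp, intro]: "b \<in> B \<Longrightarrow> b \<in> A"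
  using subalgebras by auto

lemma commutant_in_B_sa:
  assumes x: "x \<in> A" "adj x = x" and comm: "\<And>b. b \<in> B \<Longrightarrow> x * b = b * x"
  shows "x \<in> B"
proof -
  have "cstar_gen (insert x B) = B"
  proof -
    have "abelian (cstar_gen (insert x B))"
      using x comm B.comm by (intro abelian_cstar_gen) auto
    moreover have "cstar_gen (insert x B) \<subseteq> A"
      using x by (intro cstar_gen_least subalgebras) auto
    moreover have "B \<subseteq> cstar_gen (insert x B)" using cstar_gen_superset[of "insert x B"] by auto
    ultimately show ?thesis using maximal cstar_subalgebra_gen[of "insert x B"]
      by (auto simp: maximal_abelian_def)
  qed
  then show ?thesis using cstar_gen_superset[of "insert x B"] by auto
qed

lemma commutant_in_B:
  assumes x: "x \<in> A" and comm: "\<And>b. b \<in> B \<Longrightarrow> x * b = b * x"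
  shows "x \<in> B"
proof -
  have comm': "adj x * b = b * adj x" if "b \<in> B" for b
  proof -
    have "adj (x * adj b) = adj (adj b * x)" using comm[of "adj b"] that by simp
    then show ?thesis by (simp add: adj_mult adj_adj)
  qed
  have 1: "x + adj x \<in> B"
    using x comm comm' by (intro commutant_in_B_sa) (auto simp: adj_add adj_adj algebra_simps)
  have 2: "cscale \<i> (x - adj x) \<in> B"
    using x comm comm'
    by (intro commutant_in_B_sa)
      (auto simp: adj_diff adj_cscale adj_adj cscale_diff_right cscale_minus_left mult_cscale_left
        mult_cscale_right algebra_simps)
  have "cscale (1/2) ((x + adj x) + cscale (- \<i>) (cscale \<i> (x - adj x))) \<in> B" using 1 2 by auto
  also have "(x + adj x) + cscale (- \<i>) (cscale \<i> (x - adj x)) = cscale 2 x"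
    using cscale_add_left[of 1 1 x] by (simp add: cscale_cscale)
  finally show ?thesis by (simp add: cscale_cscale)
qed

abbreviation "N \<equiv> normalizers A B"

lemma N_A [simp]: "v \<in> N \<Longrightarrow> v \<in> A" and N_conj [simp]: "v \<in> N \<Longrightarrow> b \<in> B \<Longrightarrow> v * b * adj v \<in> B"
  and N_conj' [simp]: "v \<in> N \<Longrightarrow> b \<in> B \<Longrightarrow> adj v * b * v \<in> B"
  by (auto dest: normalizersD)

lemma N_adj [simp]: "v \<in> N \<Longrightarrow> adj v \<in> N"
  by (rule normalizers_adj[OF star_alg_A])

lemma N_mult [simp]: "v \<in> N \<Longrightarrow> w \<in> N \<Longrightarrow> v * w \<in> N"
  by (rule normalizers_mult[OF star_alg_A])

lemma B_N [simp]: "b \<in> B \<Longrightarrow> b \<in> N"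
  using subalgebra_normalizes[OF B.star_alg subalgebras(3)] by auto

lemma N_square [simp]: assumes "v \<in> N" shows "adj v * v \<in> B"
  by (rule commutant_in_B)
    (use normalizer_square_commutes[OF B.comm_star_alg_axioms assms] assms in auto)

lemma N_square' [simp]: "v \<in> N \<Longrightarrow> v * adj v \<in> B"
  using N_square[OF N_adj[of v]] by (simp add: adj_adj)

text \<open>This substitutes for an approximate unit: up to a small error \<open>v\<close> ends in a
  factor \<open>adj v * v\<close> from \<open>B\<close>, which can be moved about.\<close>

lemma N_approx_right:
  assumes "v \<in> N" "e > 0" obtains y where "y \<in> B" "norm (v - v * (adj v * v) * y) < e"
  using B.approx_unit[of v e] assms by auto

lemma N_approx_left:
  assumes "v \<in> N" "e > 0" obtains y where "y \<in> B" "norm (v - y * (v * adj v) * v) < e"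
proof -
  obtain y where y: "y \<in> B" "norm (adj v - adj v * (adj (adj v) * adj v) * y) < e"
    using N_approx_right[OF N_adj] assms by metis
  have "norm (adj (adj v - adj v * (adj (adj v) * adj v) * y)) < e" using y by (simp only: norm_adj)
  then show thesis using that[of "adj y"] y(1) by (simp add: adj_diff adj_mult adj_adj mult.assoc)
qed

section \<open>The conditional expectation: module laws, adjoints, contractivity\<close>

lemma E_B [simp]: "x \<in> A \<Longrightarrow> E x \<in> B"
  and E_id [simp]: "b \<in> B \<Longrightarrow> E b = b"
  and E_add: "x \<in> A \<Longrightarrow> y \<in> A \<Longrightarrow> E (x + y) = E x + E y"
  and E_cscale: "x \<in> A \<Longrightarrow> E (cscale a x) = cscale a (E x)"
  and E_bimod: "b \<in> B \<Longrightarrow> c \<in> B \<Longrightarrow> x \<in> A \<Longrightarrow> E (b * x * c) = b * E x * c"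
  using cond_exp by (auto simp: cond_exp_def)

lemma E_minus: "x \<in> A \<Longrightarrow> E (- x) = - E x"
  using E_cscale[of x "- 1"] by (simp add: cscale_minus_left)

lemma E_diff: "x \<in> A \<Longrightarrow> y \<in> A \<Longrightarrow> E (x - y) = E x - E y"
  using E_add[of x "- y"] E_minus[of y] by simp

lemma E_pos: assumes "x \<in> A" obtains y where "y \<in> B" "E (adj x * x) = adj y * y"
  using cond_exp assms by (auto simp: cond_exp_def positive_in_def)

lemma E_pos_sa: "x \<in> A \<Longrightarrow> adj (E (adj x * x)) = E (adj x * x)"
  by (erule E_pos) (simp add: adj_mult adj_adj)

lemma E_pos_char:
  assumes "x \<in> A" "character B \<phi>"
  shows "\<phi> (E (adj x * x)) = of_real (Re (\<phi> (E (adj x * x))))" "0 \<le> Re (\<phi> (E (adj x * x)))"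
proof -
  obtain y where "y \<in> B" "E (adj x * x) = adj y * y" using E_pos[OF assms(1)] .
  then have "\<phi> (E (adj x * x)) = of_real ((cmod (\<phi> y))\<^sup>2)"
    using assms(2) complex_norm_square[of "\<phi> y"]
    by (simp add: characterD[OF assms(2)] mult.commute)
  then show "\<phi> (E (adj x * x)) = of_real (Re (\<phi> (E (adj x * x))))" "0 \<le> Re (\<phi> (E (adj x * x)))"
    by simp_all
qed

text \<open>The module law of \<open>cond_exp\<close> is two-sided. The one-sided laws are derived
  by multiplying the defect by the same element on both sides, where only this nondegeneracy is left
  to apply.\<close>

lemma B_annihilator:
  assumes d: "d \<in> B" and 0: "\<And>b. b \<in> B \<Longrightarrow> b * d * b = 0" shows "d = 0"
proof -
  have "(adj d * d) * adj (adj d * d) = (adj d * d * adj d) * d" by (simp add: adj_mult adj_adj mult.assoc)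
  then have "(adj d * d) * adj (adj d * d) = 0" using 0[of "adj d"] d by simp
  then show ?thesis by simp
qed

lemma E_left: assumes b: "b \<in> B" and x: "x \<in> A" shows "E (b * x) = b * E x"
proof -
  define d where "d = E (b * x) - b * E x"
  have d: "d \<in> B" using b x by (simp add: d_def)
  have "b' * d * b' = 0" if b': "b' \<in> B" for b'
    using E_bimod[OF b' b', of "b * x"] E_bimod[of "b' * b" b' x] b b' x
    by (simp add: d_def left_diff_distrib right_diff_distrib mult.assoc)
  then have "d = 0" by (rule B_annihilator[OF d])
  then show ?thesis by (simp add: d_def)
qed

lemma E_right: assumes b: "b \<in> B" and x: "x \<in> A" shows "E (x * b) = E x * b"
proof -
  define d where "d = E (x * b) - E x * b"
  have d: "d \<in> B" using b x by (simp add: d_def)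
  have "b' * d * b' = 0" if b': "b' \<in> B" for b'
    using E_bimod[OF b' b', of "x * b"] E_bimod[of b' "b * b'" x] b b' x
    by (simp add: d_def left_diff_distrib right_diff_distrib mult.assoc)
  then have "d = 0" by (rule B_annihilator[OF d])
  then show ?thesis by (simp add: d_def)
qed

text \<open>Polarisation: for every scalar c the element E((x + c b)^* (x + c b)) is positive, hence
  self-adjoint. Comparing c = 1 and c = i isolates the mixed term, and taking \<open>b\<close> to be
  the adjoint of the defect removes \<open>b\<close>.\<close>

lemma E_adj: assumes x: "x \<in> A" shows "E (adj x) = adj (E x)"
proof -
  have *: "E (adj x) * b = adj (E x) * b" if b: "b \<in> B" for b
  proof -
    define u w where "u = E (adj x) * b" and "w = adj b * E x"
    have expand: "E (adj (x + cscale c b) * (x + cscale c b)) =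
        E (adj x * x) + (cscale c u + cscale (cnj c) w) + cscale (cnj c * c) (adj b * b)" for c
    proof -
      have "adj (x + cscale c b) * (x + cscale c b) =
          adj x * x + (cscale c (adj x * b) + cscale (cnj c) (adj b * x)) + cscale (cnj c * c) (adj b * b)"
        by (simp add: adj_add adj_cscale mult_cscale_left mult_cscale_right cscale_cscale algebra_simps
            cscale_add_right)
      then show ?thesis using x b
        by (simp add: E_add E_cscale E_left E_right u_def w_def)
    qed
    have sa: "adj (cscale c u + cscale (cnj c) w) = cscale c u + cscale (cnj c) w" for c
    proof -
      have "adj (E (adj (x + cscale c b) * (x + cscale c b))) = E (adj (x + cscale c b) * (x + cscale c b))"
        using x b by (intro E_pos_sa) auto
      then show ?thesis using E_pos_sa[OF x] unfolding expand
        by (simp add: adj_add adj_cscale adj_mult adj_adj mult.commute)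
    qed
    have 1: "adj u + adj w = u + w" using sa[of 1] by (simp add: adj_add)
    have "cscale (- \<i>) (adj (cscale \<i> u + cscale (cnj \<i>) w)) = cscale (- \<i>) (cscale \<i> u + cscale (cnj \<i>) w)"
      using sa[of \<i>] by simp
    then have 2: "adj w - adj u = u - w"
      by (simp add: adj_add adj_diff adj_cscale cscale_add_right cscale_diff_right cscale_cscale
          cscale_minus_left adj_minus)
    have "u + u = adj w + adj w" using 1 2 by (simp add: algebra_simps) (metis add.commute add.left_commute add_left_cancel)
    then have "u = adj w" by (rule double_cancel)
    then show ?thesis by (simp add: u_def w_def adj_mult adj_adj)
  qed
  define d where "d = E (adj x) - adj (E x)"
  have "d * adj d = 0" using *[of "adj d"] x by (simp add: d_def left_diff_distrib)
  then show ?thesis by (simp add: d_def)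
qed

text \<open>With \<open>q = \<surd>M - \<surd>(M - h)\<close>, where \<open>h = x\<^sup>*x\<close> and \<open>M = \<parallel>h\<parallel>\<close>, the element \<open>\<surd>M b - q b\<close>
plays the role of \<open>\<surd>(M - h) b\<close> although there is no unit.\<close>

lemma E_square_norm: assumes x: "x \<in> A" shows "norm (E (adj x * x)) \<le> (norm x)\<^sup>2"
proof (cases "x = 0")
  case True
  then show ?thesis by (simp add: E_id)
next
  case False
  define h where "h = adj x * x"
  define M where "M = norm h"
  have M: "M > 0" using False by (simp add: M_def h_def)
  have h: "h \<in> A" "adj h = h" using x by (simp_all add: h_def adj_mult adj_adj)
  obtain S where S: "comm_cstar S" "h \<in> S" "S \<subseteq> A" by (rule sa_comm_cstar[OF subalgebras(1) h])
  interpret S: comm_cstar S by fact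
  \<comment> \<open>The root difference is rewritten as t / (sqrt M + sqrt (M - t)), a multiple of
    t, since functional calculus produces multiples of \<open>h\<close>. The \<open>max 0\<close>
    keeps the denominator positive for every real t.\<close>
  have "sqrt M + sqrt (max 0 (M - t)) > 0" for t
    using M by (intro add_pos_nonneg) auto
  then have "sqrt M + sqrt (max 0 (M - t)) \<noteq> 0" for t by (metis less_irrefl)
  then have cont: "continuous_on UNIV (\<lambda>t. 1 / (sqrt M + sqrt (max 0 (M - t))))"
    by (intro continuous_intros) auto
  obtain q where q: "q \<in> S"
    "\<And>\<phi>. character S \<phi> \<Longrightarrow> \<phi> q = of_real (1 / (sqrt M + sqrt (max 0 (M - Re (\<phi> h))))) * \<phi> h"
    using S.functional_calculus[OF S(2) h(2) S(2) cont] by blast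
  have qv: "\<phi> q = of_real (sqrt M - sqrt (M - Re (\<phi> h)))" "Re (\<phi> h) \<le> M" if \<phi>: "character S \<phi>" for \<phi>
  proof -
    define t where "t = Re (\<phi> h)"
    have ht: "\<phi> h = of_real t" using character_sa[OF \<phi> S(2) h(2)] by (simp add: t_def)
    have tM: "t \<le> M" using character_norm[OF \<phi> S(2)] unfolding ht M_def by simp
    have "(sqrt M - sqrt (M - t)) * (sqrt M + sqrt (M - t)) = t"
      using M tM by (simp add: algebra_simps)
    moreover have "sqrt M + sqrt (M - t) > 0" using M tM by (intro add_pos_nonneg) auto
    ultimately have "1 / (sqrt M + sqrt (M - t)) * t = sqrt M - sqrt (M - t)"
      by (simp add: field_simps)
    moreover have "\<phi> q = of_real (1 / (sqrt M + sqrt (M - t)) * t)"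
      using q(2)[OF \<phi>] tM unfolding ht by simp
    ultimately show "\<phi> q = of_real (sqrt M - sqrt (M - Re (\<phi> h)))" "Re (\<phi> h) \<le> M"
      using tM by (simp_all add: t_def)
  qed
  have qsa: "adj q = q"
  proof (rule S.eq_characters)
    fix \<phi> assume \<phi>: "character S \<phi>"
    show "\<phi> (adj q) = \<phi> q" unfolding character_adj[OF \<phi> q(1)] qv(1)[OF \<phi>] by simp
  qed (use q in auto)
  have qq: "cscale (of_real (sqrt M)) (q + q) - q * q = h"
  proof (rule S.eq_characters)
    fix \<phi> assume \<phi>: "character S \<phi>"
    define s where "s = sqrt (M - Re (\<phi> h))"
    have ht: "\<phi> h = of_real (Re (\<phi> h))" by (rule character_sa[OF \<phi> S(2) h(2)])
    have "\<phi> (cscale (of_real (sqrt M)) (q + q) - q * q) = of_real (sqrt M * (2 * (sqrt M - s)) - (sqrt M - s)\<^sup>2)"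
      using q(1) qv[OF \<phi>]
      by (simp add: S.character_diff[OF \<phi>] characterD[OF \<phi>] s_def power2_eq_square)
    also have "sqrt M * (2 * (sqrt M - s)) - (sqrt M - s)\<^sup>2 = (sqrt M)\<^sup>2 - s\<^sup>2"
      by (simp add: power2_eq_square algebra_simps)
    also have "\<dots> = Re (\<phi> h)" using M qv[OF \<phi>] by (simp add: s_def)
    finally show "\<phi> (cscale (of_real (sqrt M)) (q + q) - q * q) = \<phi> h" using ht by simp
  qed (use q S in auto)
  define b where "b = E h"
  have b: "b \<in> B" using h by (simp add: b_def)
  define z where "z = cscale (of_real (sqrt M)) b - q * b"
  have zA: "z \<in> A" using b q S by (auto simp: z_def)
  have sM: "complex_of_real (sqrt M) * complex_of_real (sqrt M) = of_real M"
    using M by (simp flip: of_real_mult)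
  have "adj z * z = cscale (of_real M) (adj b * b) - adj b * (cscale (of_real (sqrt M)) (q + q) - q * q) * b"
    by (simp add: z_def adj_diff adj_cscale adj_mult qsa mult_cscale_left mult_cscale_right cscale_cscale
        cscale_diff_right cscale_add_right sM algebra_simps)
  then have zz: "adj z * z = cscale (of_real M) (adj b * b) - adj b * h * b" by (simp only: qq)
  have "E (adj z * z) = cscale (of_real M) (adj b * b) - adj b * b * b"
    unfolding zz using b h by (simp add: E_diff E_cscale E_bimod b_def)
  \<comment> \<open>At a character where \<open>b\<close> has value t, positivity of
    \<open>E (adj z * z)\<close> reads (M - t) t^2 \<ge> 0.\<close>
  moreover have "norm b \<le> M"
  proof (rule B.norm_le_characters[OF b])
    fix \<phi> assume \<phi>: "character B \<phi>"
    define t where "t = Re (\<phi> b)"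
    have t: "\<phi> b = of_real t" "0 \<le> t" using E_pos_char[OF x \<phi>] by (simp_all add: t_def b_def h_def)
    have "\<phi> (E (adj z * z)) = of_real (M * (t * t) - t * t * t)"
      using b t \<open>E (adj z * z) = _\<close> by (simp add: B.character_diff[OF \<phi>] characterD[OF \<phi>])
    then have "Re (\<phi> (E (adj z * z))) = M * (t * t) - t * t * t" by (simp only: Re_complex_of_real)
    then have "0 \<le> (M - t) * (t * t)" using E_pos_char(2)[OF zA \<phi>] by (simp add: algebra_simps)
    then have "t \<le> M \<or> t = 0" by (auto simp: zero_le_mult_iff mult_le_0_iff)
    then show "cmod (\<phi> b) \<le> M" using t M by auto
  qed
  ultimately show ?thesis by (simp add: b_def M_def h_def cstar_identity)
qed

text \<open>Schwarz inequality: positivity of the expectation of the square of x - E x says that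
  E(x)^* E(x) is dominated by E(x^* x) at every character; \<open>E_square_norm\<close> bounds the
  latter.\<close>

lemma E_norm: assumes x: "x \<in> A" shows "norm (E x) \<le> norm x"
proof (rule B.norm_le_characters)
  fix \<phi> assume \<phi>: "character B \<phi>"
  have "adj (x - E x) * (x - E x) = adj x * x - adj x * E x - adj (E x) * x + adj (E x) * E x"
    by (simp add: adj_diff algebra_simps)
  then have "E (adj (x - E x) * (x - E x)) = E (adj x * x) - adj (E x) * E x"
    using x by (simp add: E_add E_diff E_left E_right E_adj)
  then have "\<phi> (E (adj (x - E x) * (x - E x))) = \<phi> (E (adj x * x)) - of_real ((cmod (\<phi> (E x)))\<^sup>2)"
    using x complex_norm_square[of "\<phi> (E x)"]
    by (simp add: B.character_diff[OF \<phi>] characterD[OF \<phi>] mult.commute)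
  then have "(cmod (\<phi> (E x)))\<^sup>2 \<le> Re (\<phi> (E (adj x * x)))"
    using E_pos_char(2)[OF _ \<phi>, of "x - E x"] x by simp
  also have "\<dots> \<le> cmod (\<phi> (E (adj x * x)))" by (rule complex_Re_le_cmod)
  also have "\<dots> \<le> norm (E (adj x * x))" using x by (intro character_norm[OF \<phi>]) auto
  also have "\<dots> \<le> (norm x)\<^sup>2" by (rule E_square_norm[OF x])
  finally show "cmod (\<phi> (E x)) \<le> norm x" by (simp add: power2_le_iff_abs_le)
qed (use x in auto)

text \<open>Intuitively \<open>E w\<close> is \<open>w\<close> cut down to the points it fixes.
  Inserting \<open>w * adj w\<close> gives an element that commutes with \<open>B\<close> and so
  lies in \<open>B\<close>; approximation removes the insertion, and applying \<open>E\<close> to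
  \<open>adj w * E w\<close> then changes nothing. The identity is what makes the regularity proof
  work.\<close>

lemma normalizer_E:
  assumes w: "w \<in> N" shows "adj w * E w = adj (E w) * E w"
proof -
  define x where "x = adj w * (w * adj w) * E w"
  have x: "x \<in> B"
  proof (rule commutant_in_B)
    fix b assume b: "b \<in> B"
    have "b * (adj w * w) = (adj w * w) * b" using w b B.comm by simp
    then have "b * x = adj w * ((w * b * adj w) * E w)" by (simp add: x_def mult.assoc[symmetric])
    also have "(w * b * adj w) * E w = E ((w * b * adj w) * w)" using w b by (simp add: E_left)
    also have "(w * b * adj w) * w = (w * adj w) * w * b"
      using \<open>b * (adj w * w) = (adj w * w) * b\<close> by (simp add: mult.assoc)
    also have "E \<dots> = (w * adj w) * E w * b" using w b by (simp add: E_bimod)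
    finally show "x * b = b * x" by (simp add: x_def mult.assoc)
  qed (use w in \<open>auto simp: x_def\<close>)
  have "adj w * E w \<in> B"
  proof (rule closed_approxI[OF B.closed])
    fix e :: real assume e: "e > 0"
    then obtain e' where e': "e' > 0" "\<And>x. norm x < e' \<Longrightarrow> norm (adj w * x) < e"
      using small_mult by metis
    obtain y where y: "y \<in> B" "norm (w - y * (w * adj w) * w) < e'" by (rule N_approx_left[OF w e'(1)])
    have "E (w - y * (w * adj w) * w) = E w - y * (w * adj w) * E w"
      using w y by (simp add: E_diff E_left)
    then have 1: "norm (E w - y * (w * adj w) * E w) < e'"
      using E_norm[of "w - y * (w * adj w) * w"] w y by simp
    have "(w * adj w) * E w \<in> B" by (rule B.closed_ops(6)) (use w in auto)
    then have "y * (w * adj w) * E w = (w * adj w) * E w * y"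
      using B.comm[OF y(1)] by (simp only: mult.assoc)
    then have "adj w * E w - x * y = adj w * (E w - y * (w * adj w) * E w)"
      by (simp add: x_def right_diff_distrib mult.assoc)
    then have "norm (adj w * E w - x * y) < e" using e'(2)[OF 1] by simp
    then show "\<exists>b\<in>B. norm (adj w * E w - b) < e" using x y by blast
  qed
  then have "adj w * E w = E (adj w * E w)" by simp
  also have "\<dots> = adj (E w) * E w" using w by (simp add: E_right E_adj)
  finally show ?thesis .
qed

end

subsection \<open>Essential representations in Cartan inclusions\<close>

context cartan_incl
begin

lemma conj_mult:
  assumes n: "n \<in> N" and b: "b \<in> B" "c \<in> B"
  shows "(n * b * adj n) * (n * c * adj n) = (n * (b * c) * adj n) * (n * adj n)"
proof -
  have "(adj n * n) * c = c * (adj n * n)" using n b B.comm by simp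
  then have "n * b * (adj n * n * c) * adj n = n * b * (c * (adj n * n)) * adj n" by simp
  then show ?thesis by (simp add: mult.assoc)
qed

lemma conj_vanish:
  assumes n: "n \<in> N" and b: "b \<in> B" and \<phi>: "character B \<phi>" and 0: "\<phi> (n * adj n) = 0"
  shows "\<phi> (n * b * adj n) = 0"
proof -
  have "\<phi> (n * b * adj n) * \<phi> (n * adj b * adj n) = \<phi> ((n * b * adj n) * (n * adj b * adj n))"
    using n b by (simp add: character_mult[OF \<phi>])
  also have "\<dots> = 0"
    unfolding conj_mult[OF n b B.closed_ops(7)[OF b]] using n b 0 by (simp add: character_mult[OF \<phi>])
  finally have "\<phi> (n * b * adj n) * \<phi> (adj (n * b * adj n)) = 0"
    by (simp add: adj_mult adj_adj mult.assoc)
  then show ?thesis using character_adj[OF \<phi>, of "n * b * adj n"] n b by auto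
qed

text \<open>The partial action of a normalizer on the character space.\<close>

definition shift :: "'a \<Rightarrow> ('a \<Rightarrow> complex) \<Rightarrow> 'a \<Rightarrow> complex" where
  "shift n \<phi> b = \<phi> (n * b * adj n) / \<phi> (n * adj n)"

text \<open>Where \<open>n * adj n\<close> vanishes, division by zero makes \<open>shift\<close> 0,
  and \<open>conj_vanish\<close> shows the left side is 0 too, so the formula holds at every
  character.\<close>

lemma conj_shift:
  assumes "n \<in> N" "b \<in> B" "character B \<phi>"
  shows "\<phi> (n * b * adj n) = \<phi> (n * adj n) * shift n \<phi> b"
  using conj_vanish[OF assms] by (auto simp: shift_def)

context
  fixes n \<phi> assumes n: "n \<in> N" and \<phi>: "character B \<phi>" and nz: "\<phi> (n * adj n) \<noteq> 0"
begin

lemma shift_character: "character B (shift n \<phi>)"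
proof (rule B.characterI)
  fix x assume x: "x \<in> B"
  fix y assume y: "y \<in> B"
  have "n * (x + y) * adj n = n * x * adj n + n * y * adj n" by (simp add: algebra_simps)
  then show "shift n \<phi> (x + y) = shift n \<phi> x + shift n \<phi> y"
    using n x y by (simp add: shift_def character_add[OF \<phi>] add_divide_distrib)
  have "\<phi> ((n * x * adj n) * (n * y * adj n)) = \<phi> ((n * (x * y) * adj n) * (n * adj n))"
    by (simp only: conj_mult[OF n x y])
  then have "\<phi> (n * x * adj n) * \<phi> (n * y * adj n) = \<phi> (n * (x * y) * adj n) * \<phi> (n * adj n)"
    using n x y by (simp add: character_mult[OF \<phi>])
  then show "shift n \<phi> (x * y) = shift n \<phi> x * shift n \<phi> y"
    using nz by (simp add: shift_def divide_simps)
next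
  fix a x assume x: "x \<in> B"
  show "shift n \<phi> (cscale a x) = a * shift n \<phi> x"
    using n x by (simp add: shift_def character_cscale[OF \<phi>] mult_cscale_left mult_cscale_right)
next
  fix x assume x: "x \<in> B"
  have "adj (n * x * adj n) = n * adj x * adj n" "adj (n * adj n) = n * adj n"
    by (simp_all add: adj_mult adj_adj mult.assoc)
  then show "shift n \<phi> (adj x) = cnj (shift n \<phi> x)"
    using n x character_adj[OF \<phi>, of "n * x * adj n"] character_adj[OF \<phi>, of "n * adj n"]
    by (simp add: shift_def)
qed

lemma shift_square: "shift n \<phi> (adj n * n) = \<phi> (n * adj n)"
proof -
  have "\<phi> (n * (adj n * n) * adj n) = \<phi> (n * adj n) * \<phi> (n * adj n)"
    using character_mult[OF \<phi>, of "n * adj n" "n * adj n"] n by (simp add: mult.assoc)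
  then show ?thesis using nz by (simp add: shift_def)
qed

end

lemma ex_separating_element:
  assumes n: "n \<in> N" and \<phi>: "character B \<phi>" and nz: "\<phi> (n * adj n) \<noteq> 0"
    and c: "c \<in> B" "adj c = c" "\<phi> c \<noteq> shift n \<phi> c" and k: "k \<in> B" "\<phi> k \<noteq> 0"
  obtains u where "u \<in> B" "\<phi> u \<noteq> 0"
    "\<And>\<psi>. character B \<psi> \<Longrightarrow> \<psi> u \<noteq> 0 \<Longrightarrow> \<psi> (n * adj n) \<noteq> 0 \<and> \<psi> k \<noteq> 0 \<and> shift n \<psi> u = 0"
proof -
  define p r where "p = Re (\<phi> c)" and "r = Re (shift n \<phi> c)"
  have pr: "\<phi> c = of_real p" "shift n \<phi> c = of_real r"
    using character_sa[OF \<phi> c(1,2)] character_sa[OF shift_character[OF n \<phi> nz] c(1,2)] by (simp_all add: p_def r_def)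
  \<comment> \<open>Half the distance of the two values, so that the bumps \<open>g1\<close> and
    \<open>g2\<close> have disjoint supports.\<close>
  define \<delta> where "\<delta> = \<bar>p - r\<bar> / 2"
  have \<delta>: "\<delta> > 0" using c(3) pr by (auto simp: \<delta>_def)
  define g1 g2 where "g1 t = max 0 (\<delta> - \<bar>t - p\<bar>)" and "g2 t = max 0 (\<delta> - \<bar>t - r\<bar>)" for t
  have g0: "g1 t = 0 \<or> g2 t = 0" for t
    by (auto simp: g1_def g2_def \<delta>_def abs_if max_def field_simps)
  have cont: "continuous_on UNIV g1" "continuous_on UNIV g2"
    unfolding g1_def g2_def by (intro continuous_intros)+
  obtain z1 where z1: "z1 \<in> B" "\<And>\<psi>. character B \<psi> \<Longrightarrow> \<psi> z1 = of_real (g1 (Re (\<psi> c))) * \<psi> k"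
    using B.functional_calculus[OF c(1,2) k(1) cont(1)] by blast
  obtain z2 where z2: "z2 \<in> B" "\<And>\<psi>. character B \<psi> \<Longrightarrow> \<psi> z2 = of_real (g2 (Re (\<psi> c))) * \<psi> (adj n * n)"
    using B.functional_calculus[OF c(1,2) N_square[OF n] cont(2)] by blast
  define u where "u = z1 * (n * z2 * adj n)"
  have u: "u \<in> B" using z1 z2 n by (simp add: u_def)
  have uv: "\<psi> u = \<psi> z1 * (\<psi> (n * adj n) * shift n \<psi> z2)" if "character B \<psi>" for \<psi>
    using z1 z2 n conj_shift[OF n z2(1) that] by (simp add: u_def character_mult[OF that])
  show thesis
  proof (rule that[OF u])
    have "\<phi> z1 = of_real \<delta> * \<phi> k" using z1(2)[OF \<phi>] \<delta> by (simp add: pr g1_def)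
    moreover have "shift n \<phi> z2 = of_real \<delta> * \<phi> (n * adj n)"
      using z2(2)[OF shift_character[OF n \<phi> nz]] \<delta>
      by (simp add: pr g2_def shift_square[OF n \<phi> nz])
    ultimately show "\<phi> u \<noteq> 0" using uv[OF \<phi>] \<delta> nz k by simp
  next
    fix \<psi> assume \<psi>: "character B \<psi>" and nz\<psi>: "\<psi> u \<noteq> 0"
    then have nz': "\<psi> (n * adj n) \<noteq> 0" "\<psi> z1 \<noteq> 0" "shift n \<psi> z2 \<noteq> 0" using uv[OF \<psi>] by auto
    have s: "character B (shift n \<psi>)"
      by (rule shift_character[OF n \<psi> nz'(1)])
    have "\<psi> k \<noteq> 0" using nz'(2) z1(2)[OF \<psi>] by auto
    moreover have "g2 (Re (shift n \<psi> c)) \<noteq> 0" using nz'(3) z2(2)[OF s] by auto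
    then have "g1 (Re (shift n \<psi> c)) = 0" using g0 by blast
    then have "shift n \<psi> z1 = 0" using z1(2)[OF s] by simp
    then have "shift n \<psi> u = 0" using z1 z2 n by (simp add: u_def character_mult[OF s])
    ultimately show "\<psi> (n * adj n) \<noteq> 0 \<and> \<psi> k \<noteq> 0 \<and> shift n \<psi> u = 0" using nz' by blast
  qed
qed

text \<open>Take w^2 = max(0, h^2 - s) h^2, which is nonzero since s lies below the squared norm M
  of \<open>h\<close>. Where h^2 \<ge> s, one has h^(2m) \<ge> s^m and h^2 - s \<le> M, so h^(2m+2)
  - (s^m / M) w^2 is a square y^2. Positivity of \<open>E\<close> then yields the bound with
  \<kappa> = norm (E(w^2)) / M, which is positive by faithfulness.\<close>

lemma E_power_growth:
  assumes h: "h \<in> A" "adj h = h" and s: "0 < s" "s < (norm h)\<^sup>2"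
  obtains \<kappa> where "\<kappa> > 0" "\<And>m. \<kappa> * s ^ m \<le> norm (E ((((*) (h * h)) ^^ m) (h * h)))"
proof -
  define M where "M = (norm h)\<^sup>2"
  have M: "M > 0" using s unfolding M_def by linarith
  obtain S where S: "comm_cstar S" "h \<in> S" "S \<subseteq> A" by (rule sa_comm_cstar[OF subalgebras(1) h])
  interpret S: comm_cstar S by fact
  define P where "P m = (((*) (h * h)) ^^ m) (h * h)" for m
  have P: "P m \<in> S" for m by (induction m) (use S in \<open>auto simp: P_def\<close>)
  have hv: "\<phi> h = of_real (Re (\<phi> h))" "(Re (\<phi> h))\<^sup>2 \<le> M" if \<phi>: "character S \<phi>" for \<phi>
  proof -
    show 1: "\<phi> h = of_real (Re (\<phi> h))" by (rule character_sa[OF \<phi> S(2) h(2)])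
    have "\<bar>Re (\<phi> h)\<bar> \<le> norm h" using character_norm[OF \<phi> S(2)] abs_Re_le_cmod order_trans by blast
    then show "(Re (\<phi> h))\<^sup>2 \<le> M" using abs_le_square_iff[of "Re (\<phi> h)" "norm h"] by (simp add: M_def)
  qed
  have hh: "\<phi> h * \<phi> h = of_real ((Re (\<phi> h))\<^sup>2)" if \<phi>: "character S \<phi>" for \<phi>
    by (subst (1 2) hv(1)[OF \<phi>]) (simp add: power2_eq_square)
  have Pv: "\<phi> (P m) = of_real (((Re (\<phi> h))\<^sup>2) ^ m * (Re (\<phi> h))\<^sup>2)" if \<phi>: "character S \<phi>" for \<phi> m
  proof (induction m)
    case 0
    then show ?case using S hh[OF \<phi>] by (simp add: P_def character_mult[OF \<phi>])
  next
    case (Suc m)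
    have "\<phi> (P (Suc m)) = (\<phi> h * \<phi> h) * \<phi> (P m)"
      using S P[of m] by (simp add: P_def character_mult[OF \<phi>])
    also note hh[OF \<phi>]
    finally show ?case by (simp add: Suc)
  qed
  define G where "G t = sqrt (max 0 (t\<^sup>2 - s))" for t :: real
  have contG: "continuous_on UNIV G" unfolding G_def by (intro continuous_intros)
  obtain w where w: "w \<in> S" "\<And>\<phi>. character S \<phi> \<Longrightarrow> \<phi> w = of_real (G (Re (\<phi> h))) * \<phi> h"
    using S.functional_calculus[OF S(2) h(2) S(2) contG] by blast
  have sa: "adj z = z" if "z \<in> S" "\<And>\<phi>. character S \<phi> \<Longrightarrow> cnj (\<phi> z) = \<phi> z" for z
    by (rule S.eq_characters) (use that in \<open>auto simp: character_adj[of S]\<close>)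
  have wA: "w \<in> A" using w S by auto
  have wsa: "adj w = w"
  proof (rule sa[OF w(1)])
    fix \<phi> assume \<phi>: "character S \<phi>"
    show "cnj (\<phi> w) = \<phi> w" unfolding w(2)[OF \<phi>] by (subst (1 2) hv(1)[OF \<phi>]) simp
  qed
  define K where "K = norm (E (w * w))"
  have K: "K > 0"
  proof -
    obtain \<phi> where \<phi>: "character S \<phi>" "cmod (\<phi> h) = norm h" using S.gelfand[OF S(2)] by blast
    have "(Re (\<phi> h))\<^sup>2 = M" using hv(1)[OF \<phi>(1)] \<phi>(2) by (metis M_def norm_of_real power2_abs)
    then have "G (Re (\<phi> h)) \<noteq> 0" "\<phi> h \<noteq> 0" using s M \<phi>(2) by (auto simp: G_def M_def)
    then have "w \<noteq> 0" using w(2)[OF \<phi>(1)] S.character_0[OF \<phi>(1)] by auto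
    then show ?thesis using faithful[OF wA] wsa by (auto simp: K_def)
  qed
  show thesis
  proof (rule that[of "K / M"])
    show "K / M > 0" using K M by simp
    fix m
    define H where "H t = sqrt (max 0 ((t\<^sup>2) ^ m - s ^ m / M * max 0 (t\<^sup>2 - s)))" for t :: real
    have contH: "continuous_on UNIV H" unfolding H_def by (intro continuous_intros)
    obtain y where y: "y \<in> S" "\<And>\<phi>. character S \<phi> \<Longrightarrow> \<phi> y = of_real (H (Re (\<phi> h))) * \<phi> h"
      using S.functional_calculus[OF S(2) h(2) S(2) contH] by blast
    have yA: "y \<in> A" using y S by auto
    have ysa: "adj y = y"
    proof (rule sa[OF y(1)])
      fix \<phi> assume \<phi>: "character S \<phi>"
      show "cnj (\<phi> y) = \<phi> y" unfolding y(2)[OF \<phi>] by (subst (1 2) hv(1)[OF \<phi>]) simp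
    qed
    have Peq: "P m = y * y + cscale (of_real (s ^ m / M)) (w * w)"
    proof (rule S.eq_characters)
      fix \<phi> assume \<phi>: "character S \<phi>"
      define t where "t = Re (\<phi> h)"
      have ht: "\<phi> h = of_real t" using hv(1)[OF \<phi>] by (simp add: t_def)
      have tM: "t\<^sup>2 \<le> M" using hv(2)[OF \<phi>] by (simp add: t_def)
      have nonneg: "0 \<le> (t\<^sup>2) ^ m - s ^ m / M * max 0 (t\<^sup>2 - s)"
      proof (cases "t\<^sup>2 \<ge> s")
        case True
        have "s ^ m / M * max 0 (t\<^sup>2 - s) \<le> s ^ m / M * M"
          using s M tM True by (intro mult_left_mono) auto
        also have "\<dots> \<le> (t\<^sup>2) ^ m" using M s True by (simp add: power_mono)
        finally show ?thesis by simp
      qed simp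
      have "\<phi> (y * y + cscale (of_real (s ^ m / M)) (w * w)) =
          of_real ((H t)\<^sup>2 * t\<^sup>2 + s ^ m / M * ((G t)\<^sup>2 * t\<^sup>2))"
        using y(1) w(1) y(2)[OF \<phi>] w(2)[OF \<phi>] unfolding ht
        by (simp add: characterD[OF \<phi>] power2_eq_square mult_ac)
      also have "(H t)\<^sup>2 * t\<^sup>2 + s ^ m / M * ((G t)\<^sup>2 * t\<^sup>2) = (t\<^sup>2) ^ m * t\<^sup>2"
        using nonneg by (simp add: H_def G_def algebra_simps)
      finally show "\<phi> (P m) = \<phi> (y * y + cscale (of_real (s ^ m / M)) (w * w))"
        using Pv[OF \<phi>] by (simp add: t_def)
    qed (use y w P in auto)
    have EP: "E (P m) = E (adj y * y) + cscale (of_real (s ^ m / M)) (E (adj w * w))"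
      using yA wA by (simp add: Peq ysa wsa E_add E_cscale)
    have EwB: "E (adj w * w) \<in> B" using wA by auto
    obtain \<phi> where \<phi>: "character B \<phi>" "cmod (\<phi> (E (adj w * w))) = norm (E (adj w * w))"
      using B.gelfand[OF EwB] by blast
    define a b where "a = Re (\<phi> (E (adj y * y)))" and "b = Re (\<phi> (E (adj w * w)))"
    have ab: "\<phi> (E (adj y * y)) = of_real a" "0 \<le> a" "\<phi> (E (adj w * w)) = of_real b" "0 \<le> b"
      using E_pos_char[OF yA \<phi>(1)] E_pos_char[OF wA \<phi>(1)] by (simp_all add: a_def b_def)
    have bK: "b = K" using \<phi>(2) ab by (simp add: K_def wsa)
    have "\<phi> (E (P m)) = of_real (a + s ^ m / M * b)"
      using yA EwB ab by (simp add: EP characterD[OF \<phi>(1)])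
    then have "cmod (\<phi> (E (P m))) = \<bar>a + s ^ m / M * b\<bar>" by (simp only: norm_of_real)
    moreover have "E (P m) \<in> B" using P[of m] S by (intro E_B) auto
    ultimately have "\<bar>a + s ^ m / M * b\<bar> \<le> norm (E (P m))" using character_norm[OF \<phi>(1)] by metis
    then show "K / M * s ^ m \<le> norm (E (((*) (h * h) ^^ m) (h * h)))"
      using ab bK by (simp add: P_def mult.commute)
  qed
qed

end

text \<open>Generation of \<open>A\<close> by the image of \<open>C\<close> is deliberately absent,
  since the composite representation of \<open>C1\<close> through \<open>C2\<close> fails it in
  general.\<close>

locale cartan_rep = cartan_incl A B E
  for A B :: "'b::cstar_ambient set" and E +
  fixes C D :: "'a::cstar_ambient set" and f :: "'a \<Rightarrow> 'b"
  assumes C: "cstar_subalgebra C" and D: "cstar_subalgebra D" and DC: "D \<subseteq> C"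
    and regular_CD: "regular_incl C D" and f: "star_mono f C A" and fD: "f ` D \<subseteq> B"
    and fN: "regular_hom f C D A B" and iip: "ideal_intersection_property B (f ` D)"
begin

lemma f_hom: "star_hom f C A" and f_inj: "inj_on f C"
  using f by (auto simp: star_mono_def)

lemma star_alg_C: "star_alg C" and star_alg_D: "star_alg D"
  using C D by (simp_all add: cstar_subalgebra_iff)

lemmas C_ops [simp, intro] = star_algD[OF star_alg_C]
lemmas f_simps = star_homD(1-4)[OF f_hom] star_hom_0[OF f_hom star_alg_C]
  star_hom_minus[OF f_hom star_alg_C] star_hom_diff[OF f_hom star_alg_C]

lemma DC' [simp, intro]: "d \<in> D \<Longrightarrow> d \<in> C" using DC by auto
lemma f_A [simp, intro]: "c \<in> C \<Longrightarrow> f c \<in> A" using star_hom_in[OF f_hom] .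
lemma f_B [simp, intro]: "d \<in> D \<Longrightarrow> f d \<in> B" using fD by auto
lemma f_norm: "c \<in> C \<Longrightarrow> norm (f c) = norm c" using star_mono_norm[OF f C] .

lemma f_eqD: "f c = f c' \<Longrightarrow> c \<in> C \<Longrightarrow> c' \<in> C \<Longrightarrow> c = c'"
  using f_inj by (auto dest: inj_onD)

sublocale D: comm_cstar D
proof (rule comm_cstarI[OF D])
  have "d * e = e * d" if "d \<in> D" "e \<in> D" for d e
    by (rule f_eqD) (use that B.comm[of "f d" "f e"] in \<open>auto simp: f_simps\<close>)
  then show "abelian D" by (auto simp: abelian_def)
qed

abbreviation "ND \<equiv> normalizers C D"

lemma ND_C [simp]: "v \<in> ND \<Longrightarrow> v \<in> C" by (auto dest: normalizersD)
lemma ND_conj [simp]: "v \<in> ND \<Longrightarrow> d \<in> D \<Longrightarrow> v * d * adj v \<in> D"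
  and ND_conj' [simp]: "v \<in> ND \<Longrightarrow> d \<in> D \<Longrightarrow> adj v * d * v \<in> D"
  by (auto dest: normalizersD)
lemma ND_adj [simp]: "v \<in> ND \<Longrightarrow> adj v \<in> ND" by (rule normalizers_adj[OF star_alg_C])
lemma ND_mult [simp]: "v \<in> ND \<Longrightarrow> w \<in> ND \<Longrightarrow> v * w \<in> ND" by (rule normalizers_mult[OF star_alg_C])
lemma D_ND [simp]: "d \<in> D \<Longrightarrow> d \<in> ND" using subalgebra_normalizes[OF star_alg_D DC] by auto
lemma f_N [simp]: "v \<in> ND \<Longrightarrow> f v \<in> N" using fN by (auto simp: regular_hom_def)

text \<open>The closed ideal generated by \<open>u * B\<close> contains \<open>u * adj u\<close>, so
  it meets the image of \<open>D\<close>; and every character killing \<open>u\<close> kills this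
  ideal. Thus a nonzero element of \<open>D\<close> is supported inside the support of
  \<open>u\<close>.\<close>

lemma essential:
  assumes u: "u \<in> B" "u \<noteq> 0"
  obtains d where "d \<in> D" "d \<noteq> 0" "\<And>\<phi>. character B \<phi> \<Longrightarrow> \<phi> (f d) \<noteq> 0 \<Longrightarrow> \<phi> u \<noteq> 0"
proof -
  define J where "J = closure ((\<lambda>b. u * b) ` B)"
  have J: "J \<subseteq> B" unfolding J_def by (rule closure_minimal[OF _ B.closed]) (use u in auto)
  have seq: "x \<in> J \<longleftrightarrow> (\<exists>b. (\<forall>k. b k \<in> B) \<and> (\<lambda>k::nat. u * b k) \<longlonglongrightarrow> x)" for x
  proof
    assume "x \<in> J"
    then obtain y where y: "\<forall>k. y k \<in> (\<lambda>b. u * b) ` B" "y \<longlonglongrightarrow> x"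
      unfolding J_def closure_sequential by blast
    then have "\<forall>k. \<exists>b. b \<in> B \<and> y k = u * b" by blast
    then obtain b where b: "\<And>k. b k \<in> B" "\<And>k. y k = u * b k" by metis
    then have "y = (\<lambda>k. u * b k)" by auto
    then show "\<exists>b. (\<forall>k. b k \<in> B) \<and> (\<lambda>k. u * b k) \<longlonglongrightarrow> x" using b y by blast
  next
    assume "\<exists>b. (\<forall>k. b k \<in> B) \<and> (\<lambda>k::nat. u * b k) \<longlonglongrightarrow> x"
    then obtain b where "\<forall>k. b k \<in> B" "(\<lambda>k. u * b k) \<longlonglongrightarrow> x" by blast
    then show "x \<in> J" unfolding J_def closure_sequential by (intro exI[of _ "\<lambda>k. u * b k"]) auto
  qed
  have "closed_ideal B J"
    unfolding closed_ideal_def csubspace_def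
  proof (intro conjI ballI allI)
    show "J \<subseteq> B" by (rule J)
    show "0 \<in> J" unfolding seq by (intro exI[of _ "\<lambda>_. 0"]) auto
    show "closed J" by (simp add: J_def)
    fix x assume "x \<in> J"
    then obtain b where b: "\<And>k. b k \<in> B" "(\<lambda>k. u * b k) \<longlonglongrightarrow> x" unfolding seq by blast
    show "cscale a x \<in> J" for a
      unfolding seq using tendsto_cscale[OF b(2), of a] b(1)
      by (intro exI[of _ "\<lambda>k. cscale a (b k)"]) (auto simp: mult_cscale_right)
    show "x + y \<in> J" if "y \<in> J" for y
    proof -
      obtain b' where b': "\<And>k. b' k \<in> B" "(\<lambda>k. u * b' k) \<longlonglongrightarrow> y" using \<open>y \<in> J\<close> unfolding seq by blast
      then show ?thesis unfolding seq using tendsto_add[OF b(2) b'(2)] b(1)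
        by (intro exI[of _ "\<lambda>k. b k + b' k"]) (auto simp: distrib_left)
    qed
    fix c assume c: "c \<in> B"
    have "x \<in> B" using J \<open>x \<in> J\<close> by auto
    show r: "x * c \<in> J"
      unfolding seq using tendsto_mult_right[OF b(2), of c] b(1) c
      by (intro exI[of _ "\<lambda>k. b k * c"]) (auto simp: mult.assoc)
    then show "c * x \<in> J" using B.comm[OF c \<open>x \<in> B\<close>] by simp
  qed
  moreover have "u * adj u \<in> J" unfolding seq by (intro exI[of _ "\<lambda>_. adj u"]) (use u in auto)
  then have "J \<noteq> {0}" using u by auto
  ultimately have "J \<inter> f ` D \<noteq> {0}" using iip by (auto simp: ideal_intersection_property_def)
  moreover have "0 \<in> J \<inter> f ` D"
    using f_simps(5) by (auto simp: seq intro!: image_eqI[of _ _ 0] exI[of _ "\<lambda>_. 0"])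
  ultimately obtain d where d: "d \<in> D" "f d \<in> J" "f d \<noteq> 0" by auto
  then obtain b where b: "\<And>k. b k \<in> B" "(\<lambda>k. u * b k) \<longlonglongrightarrow> f d" unfolding seq by blast
  show thesis
  proof (rule that[OF d(1)])
    show "d \<noteq> 0" using d f_simps(5) by auto
    fix \<phi> assume \<phi>: "character B \<phi>" and nz: "\<phi> (f d) \<noteq> 0"
    show "\<phi> u \<noteq> 0"
    proof
      assume 0: "\<phi> u = 0"
      have "cmod (\<phi> (f d)) \<le> norm (u * b k - f d)" for k
        using character_norm[OF \<phi>, of "u * b k - f d"] b(1) u d 0
        by (simp add: B.character_diff[OF \<phi>] character_mult[OF \<phi>])
      moreover have "(\<lambda>k. norm (u * b k - f d)) \<longlonglongrightarrow> 0"
        using b(2) by (simp add: LIM_zero tendsto_norm_zero)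
      ultimately have "cmod (\<phi> (f d)) \<le> 0" by (intro LIMSEQ_le_const) auto
      then show False using nz by simp
    qed
  qed
qed

lemma f_nonzero_char:
  assumes "d \<in> D" "d \<noteq> 0" obtains \<phi> where "character B \<phi>" "\<phi> (f d) \<noteq> 0"
proof -
  obtain \<phi> where \<phi>: "character B \<phi>" "cmod (\<phi> (f d)) = norm (f d)"
    using B.gelfand[OF f_B[OF assms(1)]] by blast
  have "norm (f d) \<noteq> 0" using assms f_norm[of d] by auto
  then have "\<phi> (f d) \<noteq> 0" using \<phi>(2) by auto
  then show thesis by (rule that[OF \<phi>(1)])
qed

text \<open>If \<open>n\<close> moved a character, there would be a \<open>u\<close> whose support
  \<open>n\<close> displaces, and by essentiality a nonzero \<open>f d\<close> supported there; but
  commutation makes \<open>n\<close> fix the values of \<open>f d\<close>. So \<open>n\<close> fixes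
  all characters, that is \<open>n * c * adj n = c * (n * adj n)\<close>, which forces
  \<open>n\<close> to commute with \<open>B\<close>.\<close>

lemma commuting_normalizer_in_B:
  assumes n: "n \<in> N" and comm: "\<And>d. d \<in> D \<Longrightarrow> n * f d = f d * n"
  shows "n \<in> B"
proof -
  have conj: "n * c * adj n = c * (n * adj n)" if c: "c \<in> B" for c
  proof (rule B.eq_characters)
    fix \<phi> assume \<phi>: "character B \<phi>"
    show "\<phi> (n * c * adj n) = \<phi> (c * (n * adj n))"
    proof (rule ccontr)
      assume neq: "\<not> ?thesis"
      have nz: "\<phi> (n * adj n) \<noteq> 0"
        using neq conj_vanish[OF n c \<phi>] c n by (auto simp: character_mult[OF \<phi>])
      have "\<phi> c \<noteq> shift n \<phi> c"
        using neq conj_shift[OF n c \<phi>] c n by (auto simp: character_mult[OF \<phi>])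
      then obtain c' where c': "c' \<in> B" "adj c' = c'" "\<phi> c' \<noteq> shift n \<phi> c'"
        using B.characters_differ_sa[OF \<phi> shift_character[OF n \<phi> nz] c] by metis
      obtain u where u: "u \<in> B" "\<phi> u \<noteq> 0"
        and u': "\<And>\<psi>. character B \<psi> \<Longrightarrow> \<psi> u \<noteq> 0 \<Longrightarrow> \<psi> (n * adj n) \<noteq> 0 \<and> \<psi> (n * adj n) \<noteq> 0 \<and> shift n \<psi> u = 0"
        using ex_separating_element[OF n \<phi> nz c' N_square'[OF n] nz] by blast
      have "u \<noteq> 0" using u B.character_0[OF \<phi>] by auto
      obtain d where d: "d \<in> D" "d \<noteq> 0" "\<And>\<psi>. character B \<psi> \<Longrightarrow> \<psi> (f d) \<noteq> 0 \<Longrightarrow> \<psi> u \<noteq> 0"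
        using essential[OF u(1) \<open>u \<noteq> 0\<close>] by metis
      obtain \<psi> where \<psi>: "character B \<psi>" "\<psi> (f d) \<noteq> 0" using f_nonzero_char d by metis
      have 1: "\<psi> (n * adj n) \<noteq> 0" "shift n \<psi> u = 0" using u' \<psi> d by blast+
      have "n * f d * adj n = f d * (n * adj n)" using comm[OF d(1)] by (simp add: mult.assoc)
      then have "shift n \<psi> (f d) = \<psi> (f d)"
        using 1 n d character_mult[OF \<psi>(1), of "f d" "n * adj n"] by (simp add: shift_def)
      then have "shift n \<psi> u \<noteq> 0" using d(3)[OF shift_character[OF n \<psi>(1) 1(1)]] \<psi> by simp
      then show False using 1 by simp
    qed
  qed (use n c in auto)
  show ?thesis
  proof (rule commutant_in_B)
    fix c assume c: "c \<in> B"
    have P: "n * adj n \<in> B" using n by simp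
    have "(n * c - c * n) * adj (n * c - c * n) =
        n * (c * adj c) * adj n - (n * c * adj n) * adj c - c * (n * adj c * adj n) + c * (n * adj n) * adj c"
      by (simp add: adj_diff adj_mult algebra_simps)
    also have "\<dots> = 0"
      using conj[of "c * adj c"] conj[of c] conj[of "adj c"] c B.comm[OF P, of "adj c"]
      by (simp add: mult.assoc)
    finally show "n * c = c * n" by simp
  qed (use n in auto)
qed

text \<open>The two cases are the interior of the fixed point set of the partial homeomorphism induced
by \<open>v\<close>, and its complement.\<close>

lemma frolik_dichotomy:
  assumes v: "v \<in> ND" and d: "d \<in> D" "d \<noteq> 0"
  shows "(\<forall>c\<in>D. d * v * c = c * (d * v)) \<or> (\<exists>x\<in>D. d * x \<noteq> 0 \<and> (d * x) * v * (d * x) = 0)"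
proof (cases "\<exists>\<phi> c. character B \<phi> \<and> \<phi> (f d) \<noteq> 0 \<and> \<phi> (f v * adj (f v)) \<noteq> 0 \<and> c \<in> D \<and> \<phi> (f c) \<noteq> shift (f v) \<phi> (f c)")
  case True
  define n where "n = f v"
  have n: "n \<in> N" using v by (simp add: n_def)
  obtain \<phi> c where \<phi>: "character B \<phi>" "\<phi> (f d) \<noteq> 0" "\<phi> (n * adj n) \<noteq> 0" and c: "c \<in> D" "\<phi> (f c) \<noteq> shift n \<phi> (f c)"
    using True by (auto simp: n_def)
  obtain c' where c': "c' \<in> B" "adj c' = c'" "\<phi> c' \<noteq> shift n \<phi> c'"
    using B.characters_differ_sa[OF \<phi>(1) shift_character[OF n \<phi>(1,3)] f_B[OF c(1)] c(2)] by metis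
  obtain u where u: "u \<in> B" "\<phi> u \<noteq> 0"
    and u': "\<And>\<psi>. character B \<psi> \<Longrightarrow> \<psi> u \<noteq> 0 \<Longrightarrow> \<psi> (n * adj n) \<noteq> 0 \<and> \<psi> (f d) \<noteq> 0 \<and> shift n \<psi> u = 0"
    using ex_separating_element[OF n \<phi>(1,3) c' f_B[OF d(1)] \<phi>(2)] by blast
  have "u \<noteq> 0" using u B.character_0[OF \<phi>(1)] by auto
  obtain e where e: "e \<in> D" "e \<noteq> 0" "\<And>\<psi>. character B \<psi> \<Longrightarrow> \<psi> (f e) \<noteq> 0 \<Longrightarrow> \<psi> u \<noteq> 0"
    using essential[OF u(1) \<open>u \<noteq> 0\<close>] by metis
  have "d * e \<noteq> 0"
  proof
    assume "d * e = 0"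
    obtain \<psi> where \<psi>: "character B \<psi>" "\<psi> (f e) \<noteq> 0" using f_nonzero_char e by metis
    then have "\<psi> (f d) \<noteq> 0" using u' e by blast
    then have "\<psi> (f d * f e) \<noteq> 0" using \<psi> d e by (simp add: character_mult[OF \<psi>(1)])
    moreover have "f d * f e = 0" using \<open>d * e = 0\<close> d e f_simps(2)[of d e] f_simps(5) by simp
    ultimately show False using B.character_0[OF \<psi>(1)] by simp
  qed
  moreover have "e * v * e = 0"
  proof -
    define t where "t = f e * n * f e"
    have tt: "t * adj t = f e * (n * (f e * adj (f e)) * adj n) * adj (f e)"
      by (simp add: t_def adj_mult mult.assoc)
    have "t * adj t = 0"
    proof (rule B.eq_characters)
      fix \<psi> assume \<psi>: "character B \<psi>"
      \<comment> \<open>The support of \<open>f e\<close> lies in that of \<open>u\<close>, and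
        \<open>n\<close> displaces the latter, so a point and its shift cannot both lie in the
        former.\<close>
      have "\<psi> (f e) = 0 \<or> shift n \<psi> (f e * adj (f e)) = 0"
      proof (cases "\<psi> (f e) = 0")
        case False
        then have 1: "\<psi> (n * adj n) \<noteq> 0" "shift n \<psi> u = 0" using u' e \<psi> by blast+
        note s = shift_character[OF n \<psi> 1(1)]
        have "shift n \<psi> (f e) = 0" using 1 e(3)[OF s] by blast
        then show ?thesis using e by (simp add: character_mult[OF s])
      qed simp
      then show "\<psi> (t * adj t) = \<psi> 0"
        unfolding tt using e n conj_shift[OF n, of "f e * adj (f e)" \<psi>] \<psi>
        by (auto simp: character_mult[OF \<psi>] B.character_0[OF \<psi>])
    qed (use e n in \<open>simp_all add: tt\<close>)
    then have "f (e * v * e) = f 0" using e v by (simp add: t_def n_def f_simps)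
    then show ?thesis by (rule f_eqD) (use e v in auto)
  qed
  then have "(d * e) * v * (d * e) = 0"
  proof -
    have "(d * e) * v * (d * e) = d * (e * v * e) * d"
      using D.comm[OF d(1) e(1)] by (metis mult.assoc)
    then show ?thesis using \<open>e * v * e = 0\<close> by simp
  qed
  ultimately show ?thesis using e(1) by blast
next
  case False
  define n where "n = f v"
  have n: "n \<in> N" using v by (simp add: n_def)
  \<comment> \<open>Over the support of \<open>f d\<close> the elements of \<open>f(D)\<close>
    cannot distinguish a point from its shift, so there conjugation by \<open>n\<close> acts on
    \<open>f c\<close> as multiplication by \<open>n * adj n\<close>.\<close>
  have conj: "f d * (n * f c * adj n) = f d * (f c * (n * adj n))" if c: "c \<in> D" for c
  proof (rule B.eq_characters)
    fix \<phi> assume \<phi>: "character B \<phi>"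
    show "\<phi> (f d * (n * f c * adj n)) = \<phi> (f d * (f c * (n * adj n)))"
    proof (cases "\<phi> (f d) = 0 \<or> \<phi> (n * adj n) = 0")
      case True
      then show ?thesis using conj_shift[OF n f_B[OF c] \<phi>] c d n by (auto simp: character_mult[OF \<phi>])
    next
      case False': False
      then have "\<phi> (f c) = shift n \<phi> (f c)" using False \<phi> c unfolding n_def by blast
      then show ?thesis using conj_shift[OF n f_B[OF c] \<phi>] c d n by (simp add: character_mult[OF \<phi>])
    qed
  qed (use c d n in auto)
  have "d * v * c = c * (d * v)" if c: "c \<in> D" for c
  proof (rule f_eqD)
    have P: "n * adj n \<in> B" using n by simp
    define t where "t = f d * n * f c - f c * f d * n"
    have dc: "f c * f d = f d * f c" using B.comm c d by auto
    have c': "adj c \<in> D" "c * adj c \<in> D" using c by auto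
    have fc': "f (adj c) = adj (f c)" "f (c * adj c) = f c * adj (f c)" using c by (simp_all add: f_simps)
    have "t * adj t = (f d * (n * (f c * adj (f c)) * adj n) - (f d * (n * f c * adj n)) * adj (f c)
        - f c * (f d * (n * adj (f c) * adj n)) + f c * f d * (n * adj n) * adj (f c)) * adj (f d)"
      unfolding t_def by (simp add: adj_diff adj_mult algebra_simps dc)
        (use B.comm[of "adj (f c)" "adj (f d)"] B.left_comm[of "f c" "f d"] c d in \<open>simp add: mult.assoc\<close>)
    also have "\<dots> = (f d * (f c * adj (f c) * (n * adj n)) - f d * (f c * (n * adj n)) * adj (f c)
        - f c * (f d * (adj (f c) * (n * adj n))) + f c * f d * (n * adj n) * adj (f c)) * adj (f d)"
      using conj[OF c] conj[OF c'(1)] conj[OF c'(2)] by (simp only: fc')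
    also have "\<dots> = 0"
    proof -
      have 1: "(n * adj n) * adj (f c) = adj (f c) * (n * adj n)" using B.comm[OF P] c by simp
      have "f d * (f c * (n * adj n)) * adj (f c) = f d * (f c * adj (f c) * (n * adj n))"
        using 1 by (simp add: mult.assoc)
      moreover have "f c * (f d * (adj (f c) * (n * adj n))) = f d * (f c * adj (f c) * (n * adj n))"
        using dc by (metis mult.assoc)
      moreover have "f c * f d * (n * adj n) * adj (f c) = f d * (f c * adj (f c) * (n * adj n))"
        using dc 1 by (simp add: mult.assoc)
      ultimately show ?thesis by simp
    qed
    finally have "t = 0" by simp
    then show "f (d * v * c) = f (c * (d * v))" using c d v by (simp add: t_def n_def f_simps mult.assoc)
  qed (use c d v in auto)
  then show ?thesis by blast
qed

text \<open>The image of \<open>d * v\<close> is a normalizer commuting with \<open>f(D)\<close>,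
  hence already in \<open>B\<close>, where \<open>E\<close> is the identity.\<close>

lemma E_commuting:
  assumes v: "v \<in> ND" and d: "d \<in> D" and comm: "\<forall>c\<in>D. d * v * c = c * (d * v)"
  shows "f d * E (f v) = f (d * v)"
proof -
  have "f (d * v) \<in> B"
  proof (rule commuting_normalizer_in_B)
    show "f (d * v) \<in> N" using d v by simp
    show "f (d * v) * f c = f c * f (d * v)" if "c \<in> D" for c
      using comm that d v f_simps(2)[of "d * v" c] f_simps(2)[of c "d * v"] by simp
  qed
  then have "f (d * v) = E (f d * f v)" using d v by (simp add: f_simps)
  then show ?thesis using d v by (simp add: E_left)
qed

text \<open>By the module law, f(d) E(f v) f(d) = E(f(d v d)) = 0, and in the commutative algebra
  \<open>B\<close> a repeated factor may be dropped from a vanishing product.\<close>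

lemma E_disjoint:
  assumes v: "v \<in> ND" and d: "d \<in> D" and 0: "d * v * d = 0"
  shows "f d * E (f v) = 0"
proof (rule B.eq_characters)
  fix \<phi> assume \<phi>: "character B \<phi>"
  have "f d * E (f v) * f d = E (f (d * v * d))" using d v by (simp add: f_simps E_bimod)
  then have "f d * E (f v) * f d = 0" using 0 f_simps(5) by simp
  then have "\<phi> (f d * E (f v) * f d) = 0" using B.character_0[OF \<phi>] by simp
  then show "\<phi> (f d * E (f v)) = \<phi> 0" using d v B.character_0[OF \<phi>] by (auto simp: character_mult[OF \<phi>])
qed (use d v in auto)

text \<open>A quantitative form of essentiality: \<open>u\<close> is supported where |b| > s, and
  \<open>d\<close> is chosen inside that support. A character norming \<open>f (d * x)\<close> then
  sees \<open>b\<close> with modulus above s.\<close>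

lemma essential_norm:
  assumes b: "b \<in> B" and s: "0 \<le> s" "s < norm b"
  obtains d where "d \<in> D" "d \<noteq> 0" "\<And>x. x \<in> D \<Longrightarrow> s * norm (d * x) \<le> norm (f (d * x) * b)"
proof -
  define h where "h = adj b * b"
  have h: "h \<in> B" "adj h = h" using b by (simp_all add: h_def adj_mult adj_adj)
  have hv: "\<phi> h = of_real ((cmod (\<phi> b))\<^sup>2)" if \<phi>: "character B \<phi>" for \<phi>
    using b complex_norm_square[of "\<phi> b"] by (simp add: h_def characterD[OF \<phi>] mult.commute)
  have cont: "continuous_on UNIV (\<lambda>t. max 0 (t - s\<^sup>2))" by (intro continuous_intros)
  obtain u where u: "u \<in> B" "\<And>\<phi>. character B \<phi> \<Longrightarrow> \<phi> u = of_real (max 0 (Re (\<phi> h) - s\<^sup>2)) * \<phi> h"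
    using B.functional_calculus[OF h h(1) cont] by blast
  obtain \<phi> where \<phi>: "character B \<phi>" "cmod (\<phi> b) = norm b" using B.gelfand[OF b] by blast
  have "s\<^sup>2 < (norm b)\<^sup>2" using s by (intro power_strict_mono) auto
  moreover from this have "\<phi> u = of_real (((norm b)\<^sup>2 - s\<^sup>2) * (norm b)\<^sup>2)"
    using u(2)[OF \<phi>(1)] unfolding hv[OF \<phi>(1)] \<phi>(2) by simp
  moreover have "norm b \<noteq> 0" using s by auto
  ultimately have "\<phi> u \<noteq> 0" by (simp only: of_real_eq_0_iff) simp
  then have "u \<noteq> 0" using B.character_0[OF \<phi>(1)] by auto
  obtain d where d: "d \<in> D" "d \<noteq> 0" "\<And>\<psi>. character B \<psi> \<Longrightarrow> \<psi> (f d) \<noteq> 0 \<Longrightarrow> \<psi> u \<noteq> 0"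
    using essential[OF u(1) \<open>u \<noteq> 0\<close>] by metis
  show thesis
  proof (rule that[OF d(1,2)])
    fix x assume x: "x \<in> D"
    obtain \<psi> where \<psi>: "character B \<psi>" "cmod (\<psi> (f (d * x))) = norm (f (d * x))"
      using B.gelfand[of "f (d * x)"] d x by auto
    have nx: "norm (f (d * x)) = norm (d * x)" using d x by (intro f_norm) auto
    show "s * norm (d * x) \<le> norm (f (d * x) * b)"
    proof (cases "\<psi> (f d) = 0")
      case True
      then have "\<psi> (f (d * x)) = 0" using d x by (simp add: f_simps character_mult[OF \<psi>(1)])
      then show ?thesis using \<psi>(2) nx by simp
    next
      case False
      then have "\<psi> u \<noteq> 0" using d(3) \<psi> by blast
      then have "s\<^sup>2 < (cmod (\<psi> b))\<^sup>2" using u(2)[OF \<psi>(1)] hv[OF \<psi>(1)] by (auto simp: max_def split: if_splits)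
      then have "s < cmod (\<psi> b)" using power_less_imp_less_base norm_ge_zero by blast
      then have "s * norm (d * x) \<le> cmod (\<psi> (f (d * x))) * cmod (\<psi> b)"
        using \<psi>(2) nx by (metis less_imp_le mult.commute mult_left_mono norm_ge_zero)
      also have "\<dots> = cmod (\<psi> (f (d * x) * b))" using b d x by (simp add: character_mult[OF \<psi>(1)] norm_mult)
      also have "\<dots> \<le> norm (f (d * x) * b)" using b d x by (intro character_norm[OF \<psi>(1)]) auto
      finally show ?thesis .
    qed
  qed
qed

lemma zero_criterion:
  assumes a: "a \<in> A" and 0: "\<And>d. d \<in> D \<Longrightarrow> d \<noteq> 0 \<Longrightarrow> \<exists>x\<in>D. d * x \<noteq> 0 \<and> f (d * x) * a = 0"
  shows "a = 0"
proof -
  define b where "b = E (a * adj a)"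
  have b: "b \<in> B" using a by (simp add: b_def)
  have "b = 0"
  proof (rule ccontr)
    assume "b \<noteq> 0"
    then have "0 \<le> norm b / 2" "norm b / 2 < norm b" by auto
    then obtain d where d: "d \<in> D" "d \<noteq> 0" "\<And>x. x \<in> D \<Longrightarrow> norm b / 2 * norm (d * x) \<le> norm (f (d * x) * b)"
      using essential_norm[OF b] by metis
    then obtain x where x: "x \<in> D" "d * x \<noteq> 0" "f (d * x) * a = 0" using 0 by blast
    have "f (d * x) * b = E (f (d * x) * (a * adj a))" using x d a by (simp add: b_def E_left)
    also have "f (d * x) * (a * adj a) = 0" using x(3) by (simp add: mult.assoc[symmetric])
    finally have "f (d * x) * b = 0" by (simp add: E_id)
    then have "norm b / 2 * norm (d * x) \<le> 0" using d(3)[OF x(1)] by simp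
    then show False using \<open>b \<noteq> 0\<close> x by (simp add: mult_le_0_iff)
  qed
  then have "adj a = 0" using faithful[of "adj a"] a by (simp add: b_def adj_adj)
  then show ?thesis by simp
qed

end

subsection \<open>Comparing two representations\<close>

text \<open>The pairs \<open>(p(g\<^sub>1), p(g\<^sub>2))\<close> obtained by evaluating a noncommutative polynomial \<open>p\<close> at
corresponding generators.\<close>

inductive_set pairs :: "('b::cstar_ambient \<times> 'c::cstar_ambient) set \<Rightarrow> ('b \<times> 'c) set"
  for G where
  zero: "(0, 0) \<in> pairs G"
| gen: "(g, g') \<in> G \<Longrightarrow> (g, g') \<in> pairs G"
| add: "(a, a') \<in> pairs G \<Longrightarrow> (b, b') \<in> pairs G \<Longrightarrow> (a + b, a' + b') \<in> pairs G"
| scale: "(a, a') \<in> pairs G \<Longrightarrow> (cscale k a, cscale k a') \<in> pairs G"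
| mult: "(g, g') \<in> G \<Longrightarrow> (a, a') \<in> pairs G \<Longrightarrow> (g * a, g' * a') \<in> pairs G"

lemma pairs_mult:
  "(a, a') \<in> pairs G \<Longrightarrow> (b, b') \<in> pairs G \<Longrightarrow> (a * b, a' * b') \<in> pairs G"
  by (induction rule: pairs.induct)
    (auto simp: distrib_right mult_cscale_left mult.assoc intro: pairs.intros)

lemma pairs_adj:
  assumes "\<And>g g'. (g, g') \<in> G \<Longrightarrow> (adj g, adj g') \<in> G"
  shows "(a, a') \<in> pairs G \<Longrightarrow> (adj a, adj a') \<in> pairs G"
  by (induction rule: pairs.induct)
    (auto simp: adj_add adj_cscale adj_mult intro: pairs.intros pairs_mult assms)

lemma pairs_swap: "(a, a') \<in> pairs G \<Longrightarrow> (a', a) \<in> pairs (prod.swap ` G)"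
proof (induction rule: pairs.induct)
  case (gen g g')
  then show ?case by (intro pairs.gen) (auto intro!: image_eqI[of _ _ "(g, g')"])
next
  case (mult g g' a a')
  then show ?case by (intro pairs.mult) (auto intro!: image_eqI[of _ _ "(g, g')"])
qed (auto intro: pairs.intros)

locale two_reps = R1: cartan_rep A1 B1 E1 C D f1 + R2: cartan_rep A2 B2 E2 C D f2
  for A1 B1 :: "'b::cstar_ambient set" and E1
    and A2 B2 :: "'c::cstar_ambient set" and E2
    and C D :: "'a::cstar_ambient set" and f1 f2
begin

abbreviation "V \<equiv> normalizers C D"

definition gens :: "('b \<times> 'c) set" where
  "gens = (\<lambda>v. (f1 v, f2 v)) ` V \<union> (\<lambda>v. (E1 (f1 v), E2 (f2 v))) ` V"

text \<open>Heuristically, on a dense open set both entries come from common elements of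
  \<open>C\<close>. Asking for a multiple of an arbitrary nonzero \<open>d\<close> allows repeated
  refinement, which is how sums and products are treated.\<close>

definition good :: "'b \<Rightarrow> 'c \<Rightarrow> bool" where
  "good a1 a2 \<longleftrightarrow> (\<forall>d\<in>D. d \<noteq> 0 \<longrightarrow>
     (\<exists>x\<in>D. d * x \<noteq> 0 \<and> (\<exists>c\<in>C. f1 (d * x) * a1 = f1 c \<and> f2 (d * x) * a2 = f2 c)))"

lemma goodI:
  assumes "\<And>d. d \<in> D \<Longrightarrow> d \<noteq> 0 \<Longrightarrow>
    \<exists>x\<in>D. d * x \<noteq> 0 \<and> (\<exists>c\<in>C. f1 (d * x) * a1 = f1 c \<and> f2 (d * x) * a2 = f2 c)"
  shows "good a1 a2"
  using assms by (auto simp: good_def)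

lemma goodE:
  assumes "good a1 a2" "d \<in> D" "d \<noteq> 0"
  obtains x c where "x \<in> D" "d * x \<noteq> 0" "c \<in> C" "f1 (d * x) * a1 = f1 c" "f2 (d * x) * a2 = f2 c"
  using assms unfolding good_def by blast

text \<open>Supplies the nonzero multiple of \<open>d\<close> demanded by \<open>good\<close> when
  no genuine shrinking is needed.\<close>

lemma mult_adj_nonzero: "d \<in> D \<Longrightarrow> d \<noteq> 0 \<Longrightarrow> adj d \<in> D \<and> d * adj d \<noteq> 0 \<and> d * adj d = adj d * d"
  using R1.D.comm[of d "adj d"] by auto

lemma good_add:
  assumes a: "good a1 a2" and b: "good b1 b2"
  shows "good (a1 + b1) (a2 + b2)"
proof (rule goodI)
  fix d assume d: "d \<in> D" "d \<noteq> 0"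
  obtain x c where x: "x \<in> D" "d * x \<noteq> 0" "c \<in> C" "f1 (d * x) * a1 = f1 c" "f2 (d * x) * a2 = f2 c"
    by (rule goodE[OF a d])
  have dx: "d * x \<in> D" using d x by auto
  obtain y e where y: "y \<in> D" "d * x * y \<noteq> 0" "e \<in> C" "f1 (d * x * y) * b1 = f1 e" "f2 (d * x * y) * b2 = f2 e"
    by (rule goodE[OF b dx x(2)])
  have "d * x * y = y * (d * x)" using R1.D.comm[OF dx y(1)] .
  then have "f1 (d * x * y) * a1 = f1 (y * c)" "f2 (d * x * y) * a2 = f2 (y * c)"
    using dx y x R1.f_simps(2)[of y "d * x"] R1.f_simps(2)[of y c] R2.f_simps(2)[of y "d * x"] R2.f_simps(2)[of y c]
    by (simp_all add: mult.assoc)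
  then have "f1 (d * x * y) * (a1 + b1) = f1 (y * c + e)" "f2 (d * x * y) * (a2 + b2) = f2 (y * c + e)"
    using x y by (simp_all add: distrib_left R1.f_simps(1) R2.f_simps(1))
  then show "\<exists>x\<in>D. d * x \<noteq> 0 \<and> (\<exists>c\<in>C. f1 (d * x) * (a1 + b1) = f1 c \<and> f2 (d * x) * (a2 + b2) = f2 c)"
    using x y by (intro bexI[of _ "x * y"] conjI bexI[of _ "y * c + e"]) (auto simp: mult.assoc)
qed

lemma good_zero: "good 0 0"
proof (rule goodI)
  fix d assume "d \<in> D" "d \<noteq> 0"
  then show "\<exists>x\<in>D. d * x \<noteq> 0 \<and> (\<exists>c\<in>C. f1 (d * x) * 0 = f1 c \<and> f2 (d * x) * 0 = f2 c)"
    using mult_adj_nonzero[of d] by (intro bexI[of _ "adj d"] conjI bexI[of _ 0]) (auto simp: R1.f_simps(5) R2.f_simps(5))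
qed

lemma good_scale:
  assumes "good a1 a2" shows "good (cscale k a1) (cscale k a2)"
proof (rule goodI)
  fix d assume d: "d \<in> D" "d \<noteq> 0"
  obtain x c where "x \<in> D" "d * x \<noteq> 0" "c \<in> C" "f1 (d * x) * a1 = f1 c" "f2 (d * x) * a2 = f2 c"
    by (rule goodE[OF assms d])
  then show "\<exists>x\<in>D. d * x \<noteq> 0 \<and> (\<exists>c\<in>C. f1 (d * x) * cscale k a1 = f1 c \<and> f2 (d * x) * cscale k a2 = f2 c)"
    by (intro bexI[of _ x] conjI bexI[of _ "cscale k c"])
      (auto simp: mult_cscale_right R1.f_simps(3) R2.f_simps(3))
qed

lemma good_normalizer:
  assumes v: "v \<in> V" shows "good (f1 v) (f2 v)"
proof (rule goodI)
  fix d assume "d \<in> D" "d \<noteq> 0"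
  then show "\<exists>x\<in>D. d * x \<noteq> 0 \<and> (\<exists>c\<in>C. f1 (d * x) * f1 v = f1 c \<and> f2 (d * x) * f2 v = f2 c)"
    using mult_adj_nonzero[of d] v
    by (intro bexI[of _ "adj d"] conjI bexI[of _ "d * adj d * v"]) (auto simp: R1.f_simps(2) R2.f_simps(2))
qed

lemma (in cartan_rep) f_mult_transport:
  assumes "u \<in> C" "v \<in> C" "w \<in> C" "k \<in> C" "c \<in> C" "u * v = w * k" "f k * a = f c"
  shows "f u * (f v * a) = f (w * c)"
proof -
  have "f u * (f v * a) = f (u * v) * a" unfolding f_simps(2)[OF assms(1,2)] by (rule mult.assoc[symmetric])
  also have "\<dots> = f w * (f k * a)"
    unfolding assms(6) f_simps(2)[OF assms(3,4)] by (rule mult.assoc)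
  finally show ?thesis using f_simps(2)[OF assms(3,5)] by (simp only: assms(7))
qed

text \<open>A localising element on the left of \<open>v * a\<close> must be carried to the other
  side of \<open>v\<close>. So \<open>d\<close> is pulled back to
  \<open>m = adj v * (adj d * d) * v\<close>, refined there to a multiple \<open>k\<close> that
  works for \<open>a\<close>, and pushed forward to \<open>y = v * k * adj v\<close>; then d y v = d
  v (v^* v) k.\<close>

lemma good_mult_normalizer:
  assumes v: "v \<in> V" and a: "good a1 a2"
  shows "good (f1 v * a1) (f2 v * a2)"
proof (rule goodI)
  fix d assume d: "d \<in> D" "d \<noteq> 0"
  show "\<exists>x\<in>D. d * x \<noteq> 0 \<and> (\<exists>c\<in>C. f1 (d * x) * (f1 v * a1) = f1 c \<and> f2 (d * x) * (f2 v * a2) = f2 c)"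
  proof (cases "d * v = 0")
    case True
    have "d * adj d * v = 0" using mult_adj_nonzero[OF d] True by (simp add: mult.assoc)
    then have "f1 (d * adj d) * f1 v = 0" "f2 (d * adj d) * f2 v = 0"
      using d v R1.f_simps(2)[of "d * adj d" v] R2.f_simps(2)[of "d * adj d" v] R1.f_simps(5) R2.f_simps(5)
      by simp_all
    then have "f1 (d * adj d) * (f1 v * a1) = f1 0" "f2 (d * adj d) * (f2 v * a2) = f2 0"
      by (simp_all add: mult.assoc[symmetric] R1.f_simps(5) R2.f_simps(5))
    then show ?thesis using mult_adj_nonzero[OF d] by (intro bexI[of _ "adj d"] conjI bexI[of _ 0]) auto
  next
    case False
    define m where "m = adj v * (adj d * d) * v"
    have m: "m \<in> D" using v d by (simp add: m_def)
    have "m = adj (d * v) * (d * v)" by (simp add: m_def adj_mult mult.assoc)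
    then have "m \<noteq> 0" using False by simp
    obtain x c where x: "x \<in> D" "m * x \<noteq> 0" "c \<in> C" "f1 (m * x) * a1 = f1 c" "f2 (m * x) * a2 = f2 c"
      by (rule goodE[OF a m \<open>m \<noteq> 0\<close>])
    define k where "k = m * x"
    have k: "k \<in> D" using m x by (simp add: k_def)
    define y where "y = v * k * adj v"
    have y: "y \<in> D" using k v by (simp add: y_def)
    have hk: "adj v * v * k = k * (adj v * v)"
      by (rule normalizer_square_commutes[OF R1.D.comm_star_alg_axioms v k])
    have yv: "d * y * v = d * v * (adj v * v) * k" using hk by (simp add: y_def mult.assoc)
    \<comment> \<open>If it vanished, so would \<open>m * k * (adj v * v)\<close>. But at a
      character not killing \<open>f1 k\<close> neither \<open>f1 m\<close>, of which
      \<open>f1 k\<close> is a multiple, nor the image of \<open>adj v * v\<close> vanishes.\<close>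
    have "d * y \<noteq> 0"
    proof
      assume 0: "d * y = 0"
      have "k \<noteq> 0" using x by (simp add: k_def)
      obtain \<phi> where \<phi>: "character B1 \<phi>" "\<phi> (f1 k) \<noteq> 0" by (rule R1.f_nonzero_char[OF k \<open>k \<noteq> 0\<close>])
      have fm: "f1 m = adj (f1 v) * f1 (adj d * d) * adj (adj (f1 v))"
        using v d R1.f_simps(2)[of "adj v * (adj d * d)" v] R1.f_simps(2)[of "adj v" "adj d * d"] R1.f_simps(4)[of v]
        by (simp add: m_def adj_adj)
      have 1: "\<phi> (f1 m) \<noteq> 0" using \<phi> m x R1.f_simps(2)[of m x] by (auto simp: k_def character_mult[OF \<phi>(1)])
      have 2: "\<phi> (adj (f1 v) * f1 v) \<noteq> 0"
      proof
        assume "\<phi> (adj (f1 v) * f1 v) = 0"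
        then have "\<phi> (adj (f1 v) * adj (adj (f1 v))) = 0" by (simp add: adj_adj)
        moreover have "adj (f1 v) \<in> R1.N" "f1 (adj d * d) \<in> B1" using v d by simp_all
        ultimately have "\<phi> (f1 m) = 0" unfolding fm using R1.conj_vanish \<phi>(1) by blast
        then show False using 1 by simp
      qed
      have "m * k * (adj v * v) = adj v * adj d * (d * y) * v"
        by (simp add: m_def y_def mult.assoc)
      then have "m * k * (adj v * v) = 0" using 0 by simp
      then have "f1 (m * k * (adj v * v)) = 0" using R1.f_simps(5) by simp
      then have "f1 m * f1 k * (adj (f1 v) * f1 v) = 0"
        using v m k R1.f_simps(2)[of "m * k" "adj v * v"] R1.f_simps(2)[of m k] R1.f_simps(2)[of "adj v" v] R1.f_simps(4)[of v]
        by simp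
      then have "\<phi> (f1 m * f1 k * (adj (f1 v) * f1 v)) = 0" using R1.B.character_0[OF \<phi>(1)] by simp
      then show False using 1 2 \<phi>(2) v m k by (simp add: character_mult[OF \<phi>(1)])
    qed
    moreover have "f1 (d * y) * (f1 v * a1) = f1 (d * v * (adj v * v) * c)"
      by (rule R1.f_mult_transport[OF _ _ _ _ _ yv]) (use d y v k x in \<open>simp_all add: k_def\<close>)
    moreover have "f2 (d * y) * (f2 v * a2) = f2 (d * v * (adj v * v) * c)"
      by (rule R2.f_mult_transport[OF _ _ _ _ _ yv]) (use d y v k x in \<open>simp_all add: k_def\<close>)
    moreover have "d * v * (adj v * v) * c \<in> C" using d v x by simp
    ultimately show ?thesis using y by blast
  qed
qed

text \<open>Right multiplications and the identity are both instances of \<open>T\<^sub>1\<close> and \<open>T\<^sub>2\<close>.\<close>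

lemma good_E:
  assumes v: "v \<in> V" and a: "good (T1 (f1 v)) (T2 (f2 v))"
    and T: "\<And>x y. T1 (x * y) = x * T1 y" "\<And>x y. T2 (x * y) = x * T2 y"
  shows "good (T1 (E1 (f1 v))) (T2 (E2 (f2 v)))"
proof (rule goodI)
  have T0: "T1 0 = 0" "T2 0 = 0" using T(1)[of 0 0] T(2)[of 0 0] by simp_all
  fix d assume d: "d \<in> D" "d \<noteq> 0"
  show "\<exists>x\<in>D. d * x \<noteq> 0 \<and> (\<exists>c\<in>C. f1 (d * x) * T1 (E1 (f1 v)) = f1 c \<and> f2 (d * x) * T2 (E2 (f2 v)) = f2 c)"
    using R1.frolik_dichotomy[OF v d]
  proof
    assume comm: "\<forall>c\<in>D. d * v * c = c * (d * v)"
    obtain x c where x: "x \<in> D" "d * x \<noteq> 0" "c \<in> C" "f1 (d * x) * T1 (f1 v) = f1 c" "f2 (d * x) * T2 (f2 v) = f2 c"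
      by (rule goodE[OF a d])
    have dx: "d * x = x * d" using R1.D.comm d x by blast
    have "f1 (d * x) * E1 (f1 v) = f1 (d * x) * f1 v"
      using R1.E_commuting[OF v d(1) comm] d x v unfolding dx
      by (simp add: R1.f_simps(2) mult.assoc)
    moreover have "f2 (d * x) * E2 (f2 v) = f2 (d * x) * f2 v"
      using R2.E_commuting[OF v d(1) comm] d x v unfolding dx
      by (simp add: R2.f_simps(2) mult.assoc)
    ultimately have "f1 (d * x) * T1 (E1 (f1 v)) = f1 c" "f2 (d * x) * T2 (E2 (f2 v)) = f2 c"
      using x by (simp_all add: T[symmetric])
    then show ?thesis using x by blast
  next
    assume "\<exists>x\<in>D. d * x \<noteq> 0 \<and> d * x * v * (d * x) = 0"
    then obtain x where x: "x \<in> D" "d * x \<noteq> 0" "d * x * v * (d * x) = 0" by blast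
    have dx: "d * x \<in> D" using d x by simp
    have "f1 (d * x) * T1 (E1 (f1 v)) = f1 0" "f2 (d * x) * T2 (E2 (f2 v)) = f2 0"
      using R1.E_disjoint[OF v dx x(3)] R2.E_disjoint[OF v dx x(3)]
      by (simp_all add: T[symmetric] T0 R1.f_simps(5) R2.f_simps(5))
    then show ?thesis using x R1.star_alg_C star_alg_0 by blast
  qed
qed

lemma pairs_good: "(a1, a2) \<in> pairs gens \<Longrightarrow> good a1 a2"
proof (induction rule: pairs.induct)
  case (gen g g')
  then show ?case using good_normalizer good_E[where ?T1.0 = "\<lambda>x. x" and ?T2.0 = "\<lambda>x. x"]
    by (auto simp: gens_def)
next
  case (mult g g' a a')
  then show ?case
    using good_mult_normalizer good_E[where ?T1.0 = "\<lambda>x. x * a" and ?T2.0 = "\<lambda>x. x * a'"]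
    by (auto simp: gens_def mult.assoc)
qed (auto intro: good_zero good_add good_scale)

lemma pairs_in: "(a1, a2) \<in> pairs gens \<Longrightarrow> a1 \<in> A1 \<and> a2 \<in> A2"
  by (induction rule: pairs.induct) (auto simp: gens_def)

lemma gens_adj: "(g, g') \<in> gens \<Longrightarrow> (adj g, adj g') \<in> gens"
proof -
  assume "(g, g') \<in> gens"
  then consider v where "v \<in> V" "g = f1 v" "g' = f2 v" | v where "v \<in> V" "g = E1 (f1 v)" "g' = E2 (f2 v)"
    by (auto simp: gens_def)
  then show ?thesis
  proof cases
    case 1
    then have "(adj g, adj g') = (f1 (adj v), f2 (adj v))" by (simp add: R1.f_simps(4) R2.f_simps(4))
    then show ?thesis using R1.ND_adj[OF 1(1)] unfolding gens_def by blast
  next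
    case 2
    then have "(adj g, adj g') = (E1 (f1 (adj v)), E2 (f2 (adj v)))"
      by (simp add: R1.f_simps(4) R2.f_simps(4) R1.E_adj R2.E_adj)
    then show ?thesis using R1.ND_adj[OF 2(1)] unfolding gens_def by blast
  qed
qed

text \<open>A number s strictly between the norms leads to a contradiction: essentiality in
  \<open>B1\<close> bounds norm (f1(d x) b1) below by s norm(d x), while submultiplicativity bounds
  the other side above. Hence only \<open>b1\<close> must lie in the diagonal algebra.\<close>

lemma norm_le_if_eventually_le:
  assumes b: "b1 \<in> B1" "b2 \<in> A2"
    and le: "\<And>d. d \<in> D \<Longrightarrow> d \<noteq> 0 \<Longrightarrow> \<exists>x\<in>D. d * x \<noteq> 0 \<and> norm (f1 (d * x) * b1) \<le> norm (f2 (d * x) * b2)"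
  shows "norm b1 \<le> norm b2"
proof (rule ccontr)
  assume "\<not> ?thesis"
  then obtain s where s: "norm b2 < s" "s < norm b1" using dense by (meson not_le)
  then have "0 \<le> s" using norm_ge_zero[of b2] by linarith
  then obtain d where d: "d \<in> D" "d \<noteq> 0" "\<And>x. x \<in> D \<Longrightarrow> s * norm (d * x) \<le> norm (f1 (d * x) * b1)"
    using R1.essential_norm[OF b(1) _ s(2)] by metis
  obtain x where x: "x \<in> D" "d * x \<noteq> 0" "norm (f1 (d * x) * b1) \<le> norm (f2 (d * x) * b2)" using le d by blast
  have "norm (f2 (d * x)) = norm (d * x)" using d x by (intro R2.f_norm) simp
  then have "norm (f2 (d * x) * b2) \<le> norm b2 * norm (d * x)"
    using norm_mult_ineq[of "f2 (d * x)" b2] by (simp add: mult.commute)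
  then have "s * norm (d * x) \<le> norm b2 * norm (d * x)" using d(3)[OF x(1)] x(3) by linarith
  then show False using s x by simp
qed

lemma pairs_span:
  assumes "c \<in> cspan V"
  shows "(f1 c, f2 c) \<in> pairs gens" "(E1 (f1 c), E2 (f2 c)) \<in> pairs gens" "c \<in> C"
proof -
  obtain F k where F: "finite F" "F \<subseteq> V" "c = (\<Sum>v\<in>F. cscale (k v) v)" using assms by (auto simp: cspan_def)
  have "(\<Sum>v\<in>F. cscale (k v) v) \<in> C \<and> (f1 (\<Sum>v\<in>F. cscale (k v) v), f2 (\<Sum>v\<in>F. cscale (k v) v)) \<in> pairs gens \<and>
     (E1 (f1 (\<Sum>v\<in>F. cscale (k v) v)), E2 (f2 (\<Sum>v\<in>F. cscale (k v) v))) \<in> pairs gens"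
    using F(1,2)
  proof (induction F)
    case empty
    then show ?case using pairs.zero by (simp add: R1.f_simps(5) R2.f_simps(5))
  next
    case (insert v F)
    then have v: "v \<in> V" and IH: "(\<Sum>v\<in>F. cscale (k v) v) \<in> C"
      "(f1 (\<Sum>v\<in>F. cscale (k v) v), f2 (\<Sum>v\<in>F. cscale (k v) v)) \<in> pairs gens"
      "(E1 (f1 (\<Sum>v\<in>F. cscale (k v) v)), E2 (f2 (\<Sum>v\<in>F. cscale (k v) v))) \<in> pairs gens" by auto
    have g: "(f1 v, f2 v) \<in> pairs gens" "(E1 (f1 v), E2 (f2 v)) \<in> pairs gens"
      using v by (auto simp: gens_def intro: pairs.gen)
    show ?case using insert.hyps v IH pairs.add[OF pairs.scale[OF g(1)] IH(2)] pairs.add[OF pairs.scale[OF g(2)] IH(3)]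
      by (simp add: R1.f_simps(1,3) R2.f_simps(1,3) R1.E_add R2.E_add R1.E_cscale R2.E_cscale)
  qed
  then show "(f1 c, f2 c) \<in> pairs gens" "(E1 (f1 c), E2 (f2 c)) \<in> pairs gens" "c \<in> C" using F by auto
qed

lemma span_approx:
  assumes "c \<in> C" "e > 0" obtains c' where "c' \<in> cspan V" "norm (c - c') < e"
proof -
  have "c \<in> closure (cspan V)" using assms R1.regular_CD by (simp add: regular_incl_def)
  then show thesis using that assms(2) by (metis closure_approachable dist_norm norm_minus_commute)
qed

lemma E_f_lipschitz:
  assumes "c \<in> C" "c' \<in> C"
  shows "norm (E1 (f1 c) - E1 (f1 c')) \<le> norm (c - c')" "norm (E2 (f2 c) - E2 (f2 c')) \<le> norm (c - c')"
    "norm (f1 c - f1 c') \<le> norm (c - c')" "norm (f2 c - f2 c') \<le> norm (c - c')"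
proof -
  show 1: "norm (f1 c - f1 c') \<le> norm (c - c')" "norm (f2 c - f2 c') \<le> norm (c - c')"
    using assms R1.f_norm[of "c - c'"] R2.f_norm[of "c - c'"] by (simp_all add: R1.f_simps(7) R2.f_simps(7))
  show "norm (E1 (f1 c) - E1 (f1 c')) \<le> norm (c - c')" "norm (E2 (f2 c) - E2 (f2 c')) \<le> norm (c - c')"
    using assms R1.E_norm[of "f1 c - f1 c'"] R2.E_norm[of "f2 c - f2 c'"] 1
    by (simp_all add: R1.E_diff R2.E_diff)
qed

text \<open>The element of \<open>C\<close> produced by \<open>good\<close> is arbitrary, whereas
  pairs come from the span of the normalizers; density and contractivity of the expectations bridge
  the gap.\<close>

lemma E_f_norm_le:
  assumes c: "c \<in> C" shows "norm (E1 (f1 c)) \<le> norm (E2 (f2 c))"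
proof -
  have span: "norm (E1 (f1 c)) \<le> norm (E2 (f2 c))" if c: "c \<in> cspan V" for c
  proof (rule norm_le_if_eventually_le)
    note p = pairs_span[OF c]
    show "E1 (f1 c) \<in> B1" "E2 (f2 c) \<in> A2" using p by auto
    fix d assume d: "d \<in> D" "d \<noteq> 0"
    obtain x e where x: "x \<in> D" "d * x \<noteq> 0" "e \<in> C" "f1 (d * x) * E1 (f1 c) = f1 e" "f2 (d * x) * E2 (f2 c) = f2 e"
      by (rule goodE[OF pairs_good[OF p(2)] d])
    then show "\<exists>x\<in>D. d * x \<noteq> 0 \<and> norm (f1 (d * x) * E1 (f1 c)) \<le> norm (f2 (d * x) * E2 (f2 c))"
      using R1.f_norm[of e] R2.f_norm[of e] by (intro bexI[of _ x]) auto
  qed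
  show ?thesis
  proof (rule field_le_epsilon)
    fix e :: real assume "e > 0"
    then obtain c' where c': "c' \<in> cspan V" "norm (c - c') < e / 2" using span_approx[OF c, of "e/2"] by auto
    note l = E_f_lipschitz(1,2)[OF c pairs_span(3)[OF c'(1)]]
    have "norm (E1 (f1 c)) \<le> norm (E1 (f1 c')) + norm (E1 (f1 c) - E1 (f1 c'))"
      using norm_triangle_ineq[of "E1 (f1 c')" "E1 (f1 c) - E1 (f1 c')"] by simp
    moreover have "norm (E2 (f2 c')) \<le> norm (E2 (f2 c)) + norm (E2 (f2 c) - E2 (f2 c'))"
      using norm_triangle_ineq[of "E2 (f2 c)" "E2 (f2 c') - E2 (f2 c)"] by (simp add: norm_minus_commute)
    ultimately show "norm (E1 (f1 c)) \<le> norm (E2 (f2 c)) + e" using span[OF c'(1)] l c'(2) by linarith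
  qed
qed

text \<open>The localising factor passes through the expectation, which turns both sides into
  expectations of images of one element of \<open>C\<close>.\<close>

lemma E_pairs_norm_le:
  assumes a: "(a1, a2) \<in> pairs gens" shows "norm (E1 a1) \<le> norm (E2 a2)"
proof (rule norm_le_if_eventually_le)
  note in' = pairs_in[OF a]
  show "E1 a1 \<in> B1" "E2 a2 \<in> A2" using in' by auto
  fix d assume d: "d \<in> D" "d \<noteq> 0"
  obtain x e where x: "x \<in> D" "d * x \<noteq> 0" "e \<in> C" "f1 (d * x) * a1 = f1 e" "f2 (d * x) * a2 = f2 e"
    by (rule goodE[OF pairs_good[OF a] d])
  have "f1 (d * x) * E1 a1 = E1 (f1 e)" "f2 (d * x) * E2 a2 = E2 (f2 e)"
    using x d in' by (simp_all add: R1.E_left[symmetric] R2.E_left[symmetric])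
  then show "\<exists>x\<in>D. d * x \<noteq> 0 \<and> norm (f1 (d * x) * E1 a1) \<le> norm (f2 (d * x) * E2 a2)"
    using x E_f_norm_le[of e] by (intro bexI[of _ x]) auto
qed

lemma pairs_norm_le:
  assumes a: "(a1, a2) \<in> pairs gens" shows "norm a1 \<le> norm a2"
proof -
  \<comment> \<open>Passing to \<open>adj a * a\<close> makes the first entry self-adjoint, as
    \<open>E_power_growth\<close> requires, and stays within pairs.\<close>
  define h1 h2 where "h1 = adj a1 * a1" and "h2 = adj a2 * a2"
  have h: "(h1, h2) \<in> pairs gens"
    unfolding h1_def h2_def by (intro pairs_mult pairs_adj[OF gens_adj] a)
  have hA: "h1 \<in> A1" "h2 \<in> A2" using pairs_in[OF h] by auto
  have hsa: "adj h1 = h1" by (simp add: h1_def adj_mult adj_adj)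
  have P: "((((*) (h1 * h1)) ^^ m) (h1 * h1), (((*) (h2 * h2)) ^^ m) (h2 * h2)) \<in> pairs gens" for m
    by (induction m) (auto intro: pairs_mult h)
  define q where "q = (norm h2)\<^sup>2"
  have Pn: "norm ((((*) (h2 * h2)) ^^ m) (h2 * h2)) \<le> q ^ m * q" for m
  proof (induction m)
    case 0
    show ?case using norm_mult_ineq[of h2 h2] by (simp add: q_def power2_eq_square)
  next
    case (Suc m)
    have "norm ((((*) (h2 * h2)) ^^ Suc m) (h2 * h2)) \<le> norm (h2 * h2) * norm ((((*) (h2 * h2)) ^^ m) (h2 * h2))"
      by (simp add: norm_mult_ineq)
    also have "\<dots> \<le> q * (q ^ m * q)"
      using norm_mult_ineq[of h2 h2] Suc by (intro mult_mono) (auto simp: q_def power2_eq_square)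
    finally show ?case by simp
  qed
  have "(norm h1)\<^sup>2 \<le> q"
  proof (rule ccontr)
    assume "\<not> ?thesis"
    then obtain s where s: "q < s" "s < (norm h1)\<^sup>2" using dense by (meson not_le)
    have s0: "0 < s" using s(1) by (simp add: q_def) (meson le_less_trans zero_le_power2)
    obtain \<kappa> where \<kappa>: "\<kappa> > 0" "\<And>m. \<kappa> * s ^ m \<le> norm (E1 ((((*) (h1 * h1)) ^^ m) (h1 * h1)))"
      using R1.E_power_growth[OF hA(1) hsa s0 s(2)] by metis
    \<comment> \<open>Growth of rate at least s on the first side meets growth of rate at most q on
      the second; since q < s, letting m tend to infinity would force \<kappa> to be at most
      0.\<close>
    have bound: "\<kappa> \<le> (q / s) ^ m * q" for m
    proof -
      have "\<kappa> * s ^ m \<le> norm (E2 ((((*) (h2 * h2)) ^^ m) (h2 * h2)))"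
        using \<kappa>(2) E_pairs_norm_le[OF P] order_trans by blast
      also have "\<dots> \<le> norm ((((*) (h2 * h2)) ^^ m) (h2 * h2))"
        using pairs_in[OF P] by (intro R2.E_norm) auto
      also have "\<dots> \<le> q ^ m * q" by (rule Pn)
      finally show ?thesis using s0 by (simp add: power_divide field_simps)
    qed
    have "q \<ge> 0" by (simp add: q_def)
    then have "(\<lambda>m. (q / s) ^ m * q) \<longlonglongrightarrow> 0 * q"
      using s s0 by (intro tendsto_intros LIMSEQ_power_zero) auto
    then have "\<kappa> \<le> 0 * q" using bound by (intro LIMSEQ_le_const) auto
    then show False using \<kappa> by simp
  qed
  then have "(norm h1)\<^sup>2 \<le> (norm h2)\<^sup>2" by (simp add: q_def)
  then have "norm h1 \<le> norm h2" by (simp add: power2_le_iff_abs_le)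
  then have "(norm a1)\<^sup>2 \<le> (norm a2)\<^sup>2" by (simp add: h1_def h2_def cstar_identity)
  then show ?thesis by (simp add: power2_le_iff_abs_le)
qed

end

lemma (in two_reps) pairs_norm:
  assumes a: "(a1, a2) \<in> pairs gens" shows "norm a1 = norm a2"
proof -
  interpret swap: two_reps A2 B2 E2 A1 B1 E1 C D f2 f1
    by (rule two_reps.intro) (fact R2.cartan_rep_axioms R1.cartan_rep_axioms)+
  have "swap.gens = prod.swap ` gens" by (simp add: swap.gens_def gens_def image_Un image_image)
  then have "(a2, a1) \<in> pairs swap.gens" using pairs_swap[OF a] by simp
  then show ?thesis using pairs_norm_le[OF a] swap.pairs_norm_le[of a2 a1] by simp
qed

subsection \<open>The extension to the envelope\<close>

text \<open>Only the first representation generates its algebra. This makes the extension defined on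
  all of \<open>A1\<close>, while its range may be a proper part of \<open>A2\<close>.\<close>

locale envelope_rep = two_reps A1 B1 E1 A2 B2 E2 C D f1 f2
  for A1 B1 :: "'b::cstar_ambient set" and E1
    and A2 B2 :: "'c::cstar_ambient set" and E2
    and C D :: "'a::cstar_ambient set" and f1 f2 +
  assumes B1_gen: "B1 = cstar_gen (E1 ` f1 ` C)" and A1_gen: "A1 = cstar_gen (f1 ` C \<union> B1)"
begin

text \<open>Entries of a pair have equal norms, so this closed set is the graph of an
  isometry.\<close>

definition graph :: "('b \<times> 'c) set" where "graph = closure (pairs gens)"

lemma graph_iff: "(a, b) \<in> graph \<longleftrightarrow>
    (\<exists>x y. (\<forall>k. (x k, y k) \<in> pairs gens) \<and> x \<longlonglongrightarrow> a \<and> (y :: nat \<Rightarrow> 'c) \<longlonglongrightarrow> b)"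
proof
  assume "(a, b) \<in> graph"
  then obtain z where z: "\<And>k. z k \<in> pairs gens" "z \<longlonglongrightarrow> (a, b)"
    unfolding graph_def closure_sequential by blast
  have "(fst (z k), snd (z k)) \<in> pairs gens" for k using z(1)[of k] by simp
  then show "\<exists>x y. (\<forall>k. (x k, y k) \<in> pairs gens) \<and> x \<longlonglongrightarrow> a \<and> y \<longlonglongrightarrow> b"
    using tendsto_fst[OF z(2)] tendsto_snd[OF z(2)]
    by (intro exI[of _ "\<lambda>k. fst (z k)"] exI[of _ "\<lambda>k. snd (z k)"]) simp
next
  assume "\<exists>x y. (\<forall>k. (x k, y k) \<in> pairs gens) \<and> x \<longlonglongrightarrow> a \<and> y \<longlonglongrightarrow> b"
  then obtain x y where "\<And>k. (x k, y k) \<in> pairs gens" "x \<longlonglongrightarrow> a" "y \<longlonglongrightarrow> b" by blast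
  then show "(a, b) \<in> graph"
    unfolding graph_def closure_sequential by (intro exI[of _ "\<lambda>k. (x k, y k)"]) (auto intro: tendsto_Pair)
qed

lemma graphE:
  assumes "(a, b) \<in> graph"
  obtains x y where "\<And>k. (x k, y k) \<in> pairs gens" "x \<longlonglongrightarrow> a" "y \<longlonglongrightarrow> b"
  using assms unfolding graph_iff by blast

lemma pairs_graph: "(a, b) \<in> pairs gens \<Longrightarrow> (a, b) \<in> graph"
  using closure_subset by (auto simp: graph_def)

lemma graph_zero: "(0, 0) \<in> graph"
  by (intro pairs_graph pairs.zero)

lemma graph_add: assumes "(a, b) \<in> graph" "(a', b') \<in> graph" shows "(a + a', b + b') \<in> graph"
proof -
  obtain x y where 1: "\<And>k. (x k, y k) \<in> pairs gens" "x \<longlonglongrightarrow> a" "y \<longlonglongrightarrow> b" using graphE[OF assms(1)] by metis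
  obtain x' y' where 2: "\<And>k. (x' k, y' k) \<in> pairs gens" "x' \<longlonglongrightarrow> a'" "y' \<longlonglongrightarrow> b'" using graphE[OF assms(2)] by metis
  show ?thesis unfolding graph_iff
    using 1 2 by (intro exI[of _ "\<lambda>k. x k + x' k"] exI[of _ "\<lambda>k. y k + y' k"])
      (auto intro: pairs.add tendsto_add)
qed

lemma graph_mult: assumes "(a, b) \<in> graph" "(a', b') \<in> graph" shows "(a * a', b * b') \<in> graph"
proof -
  obtain x y where 1: "\<And>k. (x k, y k) \<in> pairs gens" "x \<longlonglongrightarrow> a" "y \<longlonglongrightarrow> b" using graphE[OF assms(1)] by metis
  obtain x' y' where 2: "\<And>k. (x' k, y' k) \<in> pairs gens" "x' \<longlonglongrightarrow> a'" "y' \<longlonglongrightarrow> b'" using graphE[OF assms(2)] by metis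
  show ?thesis unfolding graph_iff
    using 1 2 by (intro exI[of _ "\<lambda>k. x k * x' k"] exI[of _ "\<lambda>k. y k * y' k"])
      (auto intro: pairs_mult tendsto_mult)
qed

lemma graph_scale: assumes "(a, b) \<in> graph" shows "(cscale k a, cscale k b) \<in> graph"
proof -
  obtain x y where 1: "\<And>k. (x k, y k) \<in> pairs gens" "x \<longlonglongrightarrow> a" "y \<longlonglongrightarrow> b" using graphE[OF assms(1)] by metis
  show ?thesis unfolding graph_iff
    using 1 by (intro exI[of _ "\<lambda>j. cscale k (x j)"] exI[of _ "\<lambda>j. cscale k (y j)"])
      (auto intro: pairs.scale tendsto_cscale)
qed

lemma graph_adj: assumes "(a, b) \<in> graph" shows "(adj a, adj b) \<in> graph"
proof -
  obtain x y where 1: "\<And>k. (x k, y k) \<in> pairs gens" "x \<longlonglongrightarrow> a" "y \<longlonglongrightarrow> b" using graphE[OF assms(1)] by metis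
  show ?thesis unfolding graph_iff
    using 1 by (intro exI[of _ "\<lambda>j. adj (x j)"] exI[of _ "\<lambda>j. adj (y j)"])
      (auto intro: pairs_adj[OF gens_adj] tendsto_adj)
qed

lemma graph_diff: "(a, b) \<in> graph \<Longrightarrow> (a', b') \<in> graph \<Longrightarrow> (a - a', b - b') \<in> graph"
  using graph_add[of a b "- a'" "- b'"] graph_scale[of a' b' "- 1"] by (simp add: cscale_minus_left)

lemma graph_norm: assumes "(a, b) \<in> graph" shows "norm a = norm b"
proof -
  obtain x y where 1: "\<And>k. (x k, y k) \<in> pairs gens" "x \<longlonglongrightarrow> a" "y \<longlonglongrightarrow> b" using graphE[OF assms(1)] by metis
  have "(\<lambda>k. norm (x k)) = (\<lambda>k. norm (y k))" using pairs_norm[OF 1(1)] by auto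
  then show ?thesis using tendsto_norm[OF 1(2)] tendsto_norm[OF 1(3)] LIMSEQ_unique by metis
qed

lemma graph_in: assumes "(a, b) \<in> graph" shows "a \<in> A1" "b \<in> A2"
proof -
  obtain x y where 1: "\<And>k. (x k, y k) \<in> pairs gens" "x \<longlonglongrightarrow> a" "y \<longlonglongrightarrow> b" using graphE[OF assms(1)] by metis
  have "closed A1" "closed A2" using R1.subalgebras R2.subalgebras by (auto simp: cstar_subalgebra_iff)
  then show "a \<in> A1" "b \<in> A2"
    using closed_sequentially[of A1 x a] closed_sequentially[of A2 y b] pairs_in[OF 1(1)] 1 by auto
qed

lemma graph_closed:
  assumes "\<And>k. (x k, y k) \<in> graph" "x \<longlonglongrightarrow> a" "y \<longlonglongrightarrow> b" shows "(a, b) \<in> graph"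
proof -
  have "closed graph" by (simp add: graph_def)
  moreover have "(\<lambda>k. (x k, y k)) \<longlonglongrightarrow> (a, b)" by (intro tendsto_Pair assms)
  ultimately show ?thesis using closed_sequentially[of graph "\<lambda>k. (x k, y k)" "(a, b)"] assms(1) by simp
qed

lemma graph_unique: "(a, b) \<in> graph \<Longrightarrow> (a, b') \<in> graph \<Longrightarrow> b = b'"
  using graph_norm[OF graph_diff[of a b a b']] by simp

text \<open>It lets \<open>cstar_gen\<close> be exploited: a generated algebra lies in the domain
  once its generators do, with control of the target. For closedness, the isometry turns a
  convergent sequence of first entries into a Cauchy sequence of second ones.\<close>

lemma graph_preimage:
  assumes X: "cstar_subalgebra X" shows "cstar_subalgebra {a. \<exists>b\<in>X. (a, b) \<in> graph}" (is "cstar_subalgebra ?T")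
proof -
  have Xa: "star_alg X" and Xc: "closed X" using X by (auto simp: cstar_subalgebra_iff)
  have "closed ?T"
    unfolding closed_sequential_limits
  proof (intro allI impI, elim conjE)
    fix x a assume x: "\<forall>k. x k \<in> ?T" and lim: "x \<longlonglongrightarrow> a"
    then obtain y where y: "\<And>k. y k \<in> X" "\<And>k. (x k, y k) \<in> graph" by simp metis
    have "norm (y m - y n) = norm (x m - x n)" for m n
      using graph_norm[OF graph_diff[OF y(2) y(2)]] by simp
    moreover have "Cauchy x" using lim by (rule LIMSEQ_imp_Cauchy)
    ultimately have "Cauchy y" by (simp add: Cauchy_iff)
    then obtain b where b: "y \<longlonglongrightarrow> b" using Cauchy_convergent_iff convergent_def by blast
    have "b \<in> X" using closed_sequentially[OF Xc, of y b] y b by simp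
    then show "a \<in> ?T" using graph_closed[OF y(2) lim b] by blast
  qed
  moreover have "star_alg ?T"
    unfolding star_alg_def csubspace_def
  proof (intro conjI ballI allI)
    show "0 \<in> ?T" using star_alg_0[OF Xa] graph_zero by blast
    fix x assume "x \<in> ?T"
    then obtain b where b: "b \<in> X" "(x, b) \<in> graph" by blast
    show "cscale k x \<in> ?T" for k using star_alg_cscale[OF Xa b(1)] graph_scale[OF b(2)] by blast
    show "adj x \<in> ?T" using star_alg_adj[OF Xa b(1)] graph_adj[OF b(2)] by blast
    fix y assume "y \<in> ?T"
    then obtain c where c: "c \<in> X" "(y, c) \<in> graph" by blast
    show "x + y \<in> ?T" using star_alg_add[OF Xa b(1) c(1)] graph_add[OF b(2) c(2)] by blast
    show "x * y \<in> ?T" using star_alg_mult[OF Xa b(1) c(1)] graph_mult[OF b(2) c(2)] by blast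
  qed
  ultimately show ?thesis by (simp add: cstar_subalgebra_iff)
qed

lemma graph_f: assumes c: "c \<in> C" shows "(f1 c, f2 c) \<in> graph" "(E1 (f1 c), E2 (f2 c)) \<in> graph"
proof -
  have "\<exists>c'\<in>cspan V. norm (c - c') < inverse (Suc k)" for k :: nat
    using span_approx[OF c, of "inverse (Suc k)"] by (metis inverse_positive_iff_positive of_nat_0_less_iff zero_less_Suc)
  then obtain s where s: "\<And>k. s k \<in> cspan V" "\<And>k::nat. norm (c - s k) < inverse (Suc k)" by metis
  have sC: "s k \<in> C" for k using pairs_span(3)[OF s(1)] .
  have "(\<lambda>k. c - s k) \<longlonglongrightarrow> 0"
    by (rule Lim_null_comparison[OF _ LIMSEQ_inverse_real_of_nat])
      (intro always_eventually allI less_imp_le s(2))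
  then have "s \<longlonglongrightarrow> c" using tendsto_diff[OF tendsto_const, of "\<lambda>k. c - s k" 0 sequentially c] by simp
  then have conv: "g \<longlonglongrightarrow> l" if "\<And>k. norm (g k - l) \<le> norm (s k - c)" for g and l :: "'x::real_normed_vector"
    by (rule tendsto_norm_le[OF that])
  note l = E_f_lipschitz[OF sC c]
  show "(f1 c, f2 c) \<in> graph"
    by (rule graph_closed[OF pairs_graph[OF pairs_span(1)[OF s(1)]] conv conv]) (rule l)+
  show "(E1 (f1 c), E2 (f2 c)) \<in> graph"
    by (rule graph_closed[OF pairs_graph[OF pairs_span(2)[OF s(1)]] conv conv]) (rule l)+
qed

text \<open>Done before \<open>A1\<close>, with target \<open>B2\<close>, because this also shows
  that the extension carries \<open>B1\<close> into \<open>B2\<close>.\<close>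

lemma graph_B: "b \<in> B1 \<Longrightarrow> \<exists>b'\<in>B2. (b, b') \<in> graph"
proof -
  have "E1 (f1 c) \<in> {a. \<exists>b\<in>B2. (a, b) \<in> graph}" if "c \<in> C" for c
    using graph_f(2)[OF that] R2.E_B[OF R2.f_A[OF that]] by blast
  then have "cstar_gen (E1 ` f1 ` C) \<subseteq> {a. \<exists>b\<in>B2. (a, b) \<in> graph}"
    by (intro cstar_gen_least graph_preimage R2.subalgebras) blast
  then show "b \<in> B1 \<Longrightarrow> \<exists>b'\<in>B2. (b, b') \<in> graph" using B1_gen by auto
qed

lemma graph_A: "a \<in> A1 \<Longrightarrow> \<exists>b\<in>A2. (a, b) \<in> graph"
proof -
  have "cstar_gen (f1 ` C \<union> B1) \<subseteq> {a. \<exists>b\<in>A2. (a, b) \<in> graph}"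
  proof (intro cstar_gen_least graph_preimage R2.subalgebras)
    have "a \<in> B1 \<Longrightarrow> \<exists>b\<in>A2. (a, b) \<in> graph" for a using graph_B[of a] by blast
    then show "f1 ` C \<union> B1 \<subseteq> {a. \<exists>b\<in>A2. (a, b) \<in> graph}" using graph_f(1) by auto
  qed
  then show "a \<in> A1 \<Longrightarrow> \<exists>b\<in>A2. (a, b) \<in> graph" using A1_gen by auto
qed

definition ext :: "'b \<Rightarrow> 'c" where "ext a = (SOME b. (a, b) \<in> graph)"

lemma ext_graph: "a \<in> A1 \<Longrightarrow> (a, ext a) \<in> graph"
  unfolding ext_def using graph_A someI_ex by metis

lemma ext_eqI: "(a, b) \<in> graph \<Longrightarrow> ext a = b"
  using ext_graph graph_unique graph_in by blast

lemma ext_mono: "star_mono ext A1 A2"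
  unfolding star_mono_def star_hom_def
proof (intro conjI ballI allI)
  show "ext ` A1 \<subseteq> A2" using ext_graph graph_in by blast
  show "inj_on ext A1"
  proof (rule inj_onI)
    fix x y assume xy: "x \<in> A1" "y \<in> A1" "ext x = ext y"
    have "(x - y, ext x - ext y) \<in> graph" using graph_diff ext_graph xy by blast
    then have "norm (x - y) = norm (ext x - ext y)" by (rule graph_norm)
    then show "x = y" using xy(3) by simp
  qed
qed (auto intro!: ext_eqI graph_add graph_mult graph_scale graph_adj ext_graph)

lemma ext_f: "c \<in> C \<Longrightarrow> ext (f1 c) = f2 c" and ext_E_f: "c \<in> C \<Longrightarrow> ext (E1 (f1 c)) = E2 (f2 c)"
  using ext_eqI graph_f by blast+

lemma ext_B: "b \<in> B1 \<Longrightarrow> ext b \<in> B2"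
  using graph_B ext_eqI by blast

lemma ext_hom: "star_hom ext A1 A2"
  using ext_mono by (simp add: star_mono_def)

lemmas ext_simps = star_homD(1-4)[OF ext_hom] star_hom_0[OF ext_hom R1.star_alg_A]
  star_hom_diff[OF ext_hom R1.star_alg_A]

lemma ext_in [simp]: "a \<in> A1 \<Longrightarrow> ext a \<in> A2"
  using star_hom_in[OF ext_hom] .

lemma ext_norm: "a \<in> A1 \<Longrightarrow> norm (ext a) = norm a"
  using graph_norm ext_graph by metis

text \<open>\<open>A1\<close> is not generated by the image of \<open>C\<close> alone, so agreement
  there is not enough by itself. But multiplied by suitable \<open>f2 (d * x)\<close>, both
  \<open>g a1\<close> and \<open>a2\<close> become the image of one element of \<open>C\<close>, and
  \<open>zero_criterion\<close> applies to their difference.\<close>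

lemma unique_on_graph:
  assumes g: "star_mono g A1 A2" and gf: "\<And>c. c \<in> C \<Longrightarrow> g (f1 c) = f2 c" and a: "(a1, a2) \<in> graph"
  shows "g a1 = a2"
proof -
  have hom: "star_hom g A1 A2" using g by (simp add: star_mono_def)
  have *: "g a1 = a2" if p: "(a1, a2) \<in> pairs gens" for a1 a2
  proof -
    note in' = pairs_in[OF p]
    have "g a1 - a2 = 0"
    proof (rule R2.zero_criterion)
      show "g a1 - a2 \<in> A2" using in' star_hom_in[OF hom] by auto
      fix d assume d: "d \<in> D" "d \<noteq> 0"
      obtain x c where x: "x \<in> D" "d * x \<noteq> 0" "c \<in> C" "f1 (d * x) * a1 = f1 c" "f2 (d * x) * a2 = f2 c"
        by (rule goodE[OF pairs_good[OF p] d])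
      have "f2 (d * x) * g a1 = g (f1 (d * x) * a1)"
        using in' d x gf[of "d * x"] star_hom_mult[OF hom, of "f1 (d * x)" a1] by simp
      also have "\<dots> = f2 (d * x) * a2" using x gf by simp
      finally show "\<exists>x\<in>D. d * x \<noteq> 0 \<and> f2 (d * x) * (g a1 - a2) = 0"
        using x by (intro bexI[of _ x]) (auto simp: right_diff_distrib)
    qed
    then show ?thesis by simp
  qed
  obtain x y where xy: "\<And>k. (x k, y k) \<in> pairs gens" "x \<longlonglongrightarrow> a1" "y \<longlonglongrightarrow> a2" using graphE[OF a] by metis
  have a1: "a1 \<in> A1" using graph_in a by blast
  have xA: "x k \<in> A1" for k using pairs_in xy by blast
  have "norm (g a1 - y k) = norm (a1 - x k)" for k
    using *[OF xy(1)] star_mono_norm[OF g R1.subalgebras(1), of "a1 - x k"] star_hom_diff[OF hom R1.star_alg_A a1 xA[of k]] a1 xA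
    by simp
  then have "(\<lambda>k. norm (g a1 - y k)) = (\<lambda>k. norm (a1 - x k))" by blast
  moreover have "(\<lambda>k. norm (a1 - x k)) \<longlonglongrightarrow> norm (a1 - a1)" by (intro tendsto_intros xy)
  ultimately have "(\<lambda>k. norm (g a1 - y k)) \<longlonglongrightarrow> 0" by simp
  moreover have "(\<lambda>k. norm (g a1 - y k)) \<longlonglongrightarrow> norm (g a1 - a2)" by (intro tendsto_intros xy)
  ultimately have "0 = norm (g a1 - a2)" by (rule LIMSEQ_unique)
  then show ?thesis by simp
qed

lemma ext_unique:
  assumes "star_mono g A1 A2" "\<And>c. c \<in> C \<Longrightarrow> g (f1 c) = f2 c" "a \<in> A1"
  shows "g a = ext a"
  using unique_on_graph[OF assms(1,2) ext_graph[OF assms(3)]] by simp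

text \<open>After localisation both sides become the two expectations of one element of
  \<open>C\<close>, for which the identity is \<open>ext_E_f\<close>.\<close>

lemma ext_E:
  assumes a: "a \<in> A1" shows "ext (E1 a) = E2 (ext a)"
proof -
  have *: "(E1 a1, E2 a2) \<in> graph" if p: "(a1, a2) \<in> pairs gens" for a1 a2
  proof -
    note in' = pairs_in[OF p]
    have "ext (E1 a1) - E2 a2 = 0"
    proof (rule R2.zero_criterion)
      show "ext (E1 a1) - E2 a2 \<in> A2" using in' by auto
      fix d assume d: "d \<in> D" "d \<noteq> 0"
      obtain x c where x: "x \<in> D" "d * x \<noteq> 0" "c \<in> C" "f1 (d * x) * a1 = f1 c" "f2 (d * x) * a2 = f2 c"
        by (rule goodE[OF pairs_good[OF p] d])
      have "f2 (d * x) * ext (E1 a1) = ext (f1 (d * x) * E1 a1)"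
        using in' d x ext_f[of "d * x"] ext_simps(2)[of "f1 (d * x)" "E1 a1"] by simp
      also have "f1 (d * x) * E1 a1 = E1 (f1 c)"
        using x d in' R1.E_left[of "f1 (d * x)" a1] by simp
      also have "ext (E1 (f1 c)) = f2 (d * x) * E2 a2"
        using x d in' R2.E_left[of "f2 (d * x)" a2] by (simp add: ext_E_f)
      finally show "\<exists>x\<in>D. d * x \<noteq> 0 \<and> f2 (d * x) * (ext (E1 a1) - E2 a2) = 0"
        using x by (intro bexI[of _ x]) (auto simp: right_diff_distrib)
    qed
    then show ?thesis using ext_graph[of "E1 a1"] in' by simp
  qed
  obtain x y where xy: "\<And>k. (x k, y k) \<in> pairs gens" "x \<longlonglongrightarrow> a" "y \<longlonglongrightarrow> ext a"
    using graphE[OF ext_graph[OF a]] by metis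
  have xA: "x k \<in> A1" "y k \<in> A2" for k using pairs_in xy by blast+
  have "(\<lambda>k. E1 (x k)) \<longlonglongrightarrow> E1 a"
    by (rule tendsto_norm_le[OF _ xy(2)]) (use xA a R1.E_norm[of "x _ - a"] in \<open>simp add: R1.E_diff\<close>)
  moreover have "(\<lambda>k. E2 (y k)) \<longlonglongrightarrow> E2 (ext a)"
    by (rule tendsto_norm_le[OF _ xy(3)]) (use xA a R2.E_norm[of "y _ - ext a"] in \<open>simp add: R2.E_diff\<close>)
  ultimately have "(E1 a, E2 (ext a)) \<in> graph"
    by (rule graph_closed[of "\<lambda>k. E1 (x k)" "\<lambda>k. E2 (y k)", OF *[OF xy(1)]])
  then show ?thesis by (rule ext_eqI)
qed

text \<open>Polynomials are sums of products that need not normalize; up to closure they are sums of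
  elements \<open>b * f1 v\<close>, whose images are normalizers. This is where control over
  arbitrary elements of \<open>A1\<close> is gained in the regularity proof.\<close>

lemma normalizer_span_dense:
  assumes W: "csubspace W" "closed W" and BW: "\<And>b v. b \<in> B1 \<Longrightarrow> v \<in> V \<Longrightarrow> b * f1 v \<in> W"
  shows "A1 \<subseteq> W"
proof -
  \<comment> \<open>A given \<open>W\<close> need not be stable under left multiplication by the
    generators. The smallest such subspace is, since stability can be checked on the elements
    \<open>b * f1 v\<close>.\<close>
  define Q where "Q = \<Inter> {W. csubspace W \<and> closed W \<and> (\<forall>b\<in>B1. \<forall>v\<in>V. b * f1 v \<in> W)}"
  have Q: "csubspace Q" "closed Q" by (auto simp: Q_def csubspace_def)
  have BQ: "b * f1 v \<in> Q" if "b \<in> B1" "v \<in> V" for b v using that by (auto simp: Q_def)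
  have least: "Q \<subseteq> W" if "csubspace W" "closed W" "\<And>b v. b \<in> B1 \<Longrightarrow> v \<in> V \<Longrightarrow> b * f1 v \<in> W" for W
    using that by (auto simp: Q_def)
  have lmult: "g * a \<in> Q" if g: "\<And>b v. b \<in> B1 \<Longrightarrow> v \<in> V \<Longrightarrow> g * (b * f1 v) \<in> Q" and a: "a \<in> Q" for g a
  proof -
    have "csubspace {a. g * a \<in> Q}"
      using Q by (auto simp: csubspace_def distrib_left mult_cscale_right)
    moreover have "closed {a. g * a \<in> Q}"
      using continuous_closed_vimage[OF Q(2), of "\<lambda>a. g * a"] by (simp add: vimage_def continuous_mult_left)
    ultimately show ?thesis using least[of "{a. g * a \<in> Q}"] g a by blast
  qed
  have fE: "E1 (f1 u) * a \<in> Q" if u: "u \<in> V" and a: "a \<in> Q" for u a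
  proof (rule lmult[OF _ a])
    fix b v assume "b \<in> B1" "v \<in> V"
    then show "E1 (f1 u) * (b * f1 v) \<in> Q" using BQ[of "E1 (f1 u) * b" v] u by (simp add: mult.assoc)
  qed
  have fN: "f1 u * a \<in> Q" if u: "u \<in> V" and a: "a \<in> Q" for u a
  proof (rule lmult[OF _ a])
    fix b v assume b: "b \<in> B1" and v: "v \<in> V"
    define n where "n = f1 u"
    have n: "n \<in> R1.N" using u by (simp add: n_def)
    show "f1 u * (b * f1 v) \<in> Q"
    proof (rule closed_approxI[OF Q(2)])
      fix e :: real assume e: "e > 0"
      then obtain e' where e': "e' > 0" "\<And>x. norm x < e' \<Longrightarrow> norm (x * (b * f1 v)) < e"
        using small_mult by metis
      obtain y where y: "y \<in> B1" "norm (n - n * (adj n * n) * y) < e'" by (rule R1.N_approx_right[OF n e'(1)])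
      have yb: "y * b \<in> B1" using y b by simp
      have c: "(adj n * n) * (y * b) = (y * b) * (adj n * n)" using n yb R1.B.comm by simp
      have "n * (adj n * n) * y * (b * f1 v) = n * ((adj n * n) * (y * b)) * f1 v" by (simp add: mult.assoc)
      also have "\<dots> = n * (y * b) * adj n * (n * f1 v)" unfolding c by (simp add: mult.assoc)
      also have "n * f1 v = f1 (u * v)" using u v by (simp add: n_def R1.f_simps(2))
      finally have "n * (adj n * n) * y * (b * f1 v) \<in> Q" using BQ[of "n * (y * b) * adj n" "u * v"] n yb u v by simp
      moreover have "norm (n * (b * f1 v) - n * (adj n * n) * y * (b * f1 v)) < e"
        using e'(2)[OF y(2)] by (simp only: left_diff_distrib)
      ultimately show "\<exists>y\<in>Q. norm (f1 u * (b * f1 v) - y) < e" unfolding n_def by blast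
    qed
  qed
  have N: "f1 v \<in> Q" "E1 (f1 v) \<in> Q" if v: "v \<in> V" for v
  proof -
    define n where "n = f1 v"
    have n: "n \<in> R1.N" using v by (simp add: n_def)
    \<comment> \<open>The generators need a left factor from \<open>B1\<close>. For \<open>n\<close>
      it is \<open>y * (n * adj n)\<close>; for \<open>E1 n\<close> it is \<open>y * E1 n\<close>,
      and the remaining \<open>n * adj n\<close> is the image of the normalizer
      \<open>v * adj v\<close>.\<close>
    have "\<exists>x\<in>Q. norm (n - x) < e" "\<exists>x\<in>Q. norm (E1 n - x) < e" if e: "e > 0" for e
    proof -
      obtain y where y: "y \<in> B1" "norm (n - y * (n * adj n) * n) < e" by (rule R1.N_approx_left[OF n e])
      have "y * (n * adj n) * n \<in> Q" using BQ[of "y * (n * adj n)" v] y v n by (simp add: n_def)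
      then show "\<exists>x\<in>Q. norm (n - x) < e" using y by blast
      have nn: "n * adj n = f1 (v * adj v)" using v by (simp add: n_def R1.f_simps(2,4))
      have "E1 (y * (n * adj n) * n) = y * E1 n * (n * adj n)"
        using y n R1.E_left[of "y * (n * adj n)" n] R1.B.comm[of "n * adj n" "E1 n"] by (simp add: mult.assoc)
      then have "E1 (y * (n * adj n) * n) \<in> Q" using BQ[of "y * E1 n" "v * adj v"] y v n by (simp add: nn)
      moreover have "norm (E1 n - E1 (y * (n * adj n) * n)) < e"
        using y n R1.E_norm[of "n - y * (n * adj n) * n"] by (simp add: R1.E_diff)
      ultimately show "\<exists>x\<in>Q. norm (E1 n - x) < e" by blast
    qed
    then show "f1 v \<in> Q" "E1 (f1 v) \<in> Q" using closed_approxI[OF Q(2)] unfolding n_def by blast+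
  qed
  have pQ: "a \<in> Q" if "(a, a') \<in> pairs gens" for a a'
    using that
  proof (induction rule: pairs.induct)
    case (gen g g')
    then show ?case using N by (auto simp: gens_def)
  next
    case (mult g g' a a')
    then show ?case using fN fE by (auto simp: gens_def)
  qed (use csubspaceD[OF Q(1)] in auto)
  have "a \<in> Q" if a: "a \<in> A1" for a
  proof -
    obtain x y where xy: "\<And>k. (x k, y k) \<in> pairs gens" "x \<longlonglongrightarrow> a" "y \<longlonglongrightarrow> ext a"
      using graphE[OF ext_graph[OF a]] by metis
    then show ?thesis using closed_sequentially[OF Q(2), of x a] pQ[OF xy(1)] by simp
  qed
  then show ?thesis using least[OF W BW] by blast
qed

text \<open>The set \<open>T\<close> is a closed ideal of \<open>B1\<close>. If it contains
  \<open>adj n * n\<close>, then the claim follows, since p is approximated by p times the image of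
  \<open>(adj n * n) * y\<close>. As n^* n = E1(n^* n), density reduces the membership to the
  elements E1(n^* v') with v' of the form \<open>b0 * f1 v\<close>, whose image is known to be a
  normalizer.\<close>

lemma ext_normalizer_conj:
  assumes n: "n \<in> R1.N" and b: "b \<in> B2"
  shows "ext n * b * adj (ext n) \<in> B2"
proof -
  define p where "p = ext n"
  have nA: "n \<in> A1" using n by simp
  define T where "T = {j \<in> B1. \<forall>b\<in>B2. p * ext j * b * adj p \<in> B2}"
  have extB: "\<And>j. j \<in> B1 \<Longrightarrow> ext j \<in> B2" by (rule ext_B)
  have T: "csubspace T"
    unfolding csubspace_def T_def
    using extB by (auto simp: ext_simps distrib_left distrib_right mult_cscale_left mult_cscale_right)
  have Tmult: "j * k \<in> T" if j: "j \<in> T" and k: "k \<in> B1" for j k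
  proof -
    have "p * ext (j * k) * b * adj p \<in> B2" if "b \<in> B2" for b
    proof -
      have "p * ext j * (ext k * b) * adj p \<in> B2" using j that extB[OF k] by (auto simp: T_def)
      then show ?thesis using j k by (simp add: T_def ext_simps mult.assoc)
    qed
    then show ?thesis using j k by (simp add: T_def)
  qed
  have Tmult': "k * j \<in> T" if "j \<in> T" "k \<in> B1" for j k
    using Tmult[OF that] R1.B.comm[of k j] that by (simp add: T_def)
  have Tclosed: "closed T"
    unfolding closed_sequential_limits
  proof (intro allI impI, elim conjE)
    fix x j assume x: "\<forall>k. x k \<in> T" and lim: "x \<longlonglongrightarrow> j"
    have xB: "x k \<in> B1" for k using x by (simp add: T_def)
    have j: "j \<in> B1" using closed_sequentially[OF R1.B.closed, of x j] xB lim by simp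
    have lim': "(\<lambda>k. ext (x k)) \<longlonglongrightarrow> ext j"
      by (rule tendsto_norm_le[OF _ lim]) (use ext_norm[of "x _ - j"] xB j in \<open>simp add: ext_simps\<close>)
    have "p * ext j * b * adj p \<in> B2" if b: "b \<in> B2" for b
    proof (rule closed_sequentially[OF R2.B.closed])
      show "p * ext (x k) * b * adj p \<in> B2" for k using x b by (simp add: T_def)
      show "(\<lambda>k. p * ext (x k) * b * adj p) \<longlonglongrightarrow> p * ext j * b * adj p" by (intro tendsto_intros lim')
    qed
    then show "j \<in> T" using j by (simp add: T_def)
  qed
  have ET: "E1 (adj n * (b0 * f1 v)) \<in> T" if b0: "b0 \<in> B1" and v: "v \<in> V" for b0 v
  proof -
    define v' where "v' = b0 * f1 v"
    have v': "v' \<in> R1.N" using b0 v by (simp add: v'_def)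
    have ev': "ext v' \<in> R2.N" using b0 v by (simp add: v'_def ext_simps ext_f ext_B)
    define w where "w = adj n * v'"
    have w: "w \<in> R1.N" using n v' by (simp add: w_def)
    define h where "h = E1 w"
    have h: "h \<in> B1" using w by (simp add: h_def)
    have wh: "adj w * h = adj h * h" using R1.normalizer_E[OF w] by (simp add: h_def)
    define r where "r = w * adj w * h"
    have r: "r \<in> B1" unfolding r_def by (rule R1.B.closed_ops(6)) (use w h in auto)
    \<comment> \<open>By \<open>normalizer_E\<close> the unknown normalizer \<open>n\<close>
      survives only inside \<open>n * adj n\<close>, which lies in \<open>B1\<close>. So
      \<open>n * r\<close> is a product of factors whose images normalize \<open>B2\<close>; this
      gives first \<open>r * adj r\<close>, then \<open>r\<close>, then \<open>h\<close> in
      \<open>T\<close>.\<close>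
    have nr: "n * r = (n * adj n) * v' * (adj h * h)"
      unfolding r_def by (subst wh[symmetric]) (simp add: w_def mult.assoc)
    have "ext (n * r) = ext (n * adj n) * ext v' * ext (adj h * h)"
      unfolding nr using n v' h by (simp add: ext_simps)
    moreover have "ext (n * adj n) \<in> B2" "ext (adj h * h) \<in> B2" using n h by (auto intro: ext_B)
    ultimately have enr: "ext (n * r) \<in> R2.N" using ev' by simp
    have "r * adj r \<in> T"
    proof -
      have "p * ext (r * adj r) * b * adj p \<in> B2" if b: "b \<in> B2" for b
      proof -
        have "ext (n * r) * b * adj (ext (n * r)) \<in> B2" using enr b by simp
        also have "ext (n * r) * b * adj (ext (n * r)) = p * (ext r * (b * adj (ext r))) * adj p"
          using nA r by (simp add: p_def ext_simps adj_mult mult.assoc)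
        also have "b * adj (ext r) = adj (ext r) * b" using b extB[OF r] R2.B.comm by simp
        finally show ?thesis using r by (simp add: ext_simps mult.assoc)
      qed
      then show ?thesis using r by (simp add: T_def)
    qed
    have "r \<in> T"
    proof (rule closed_approxI[OF Tclosed])
      fix e :: real assume "e > 0"
      then obtain y where y: "y \<in> B1" "norm (r - y * (r * adj r) * r) < e"
        using R1.N_approx_left[OF R1.B_N[OF r]] by metis
      have "y * (r * adj r) * r \<in> T" by (rule Tmult[OF Tmult'[OF \<open>r * adj r \<in> T\<close> y(1)] r])
      then show "\<exists>y\<in>T. norm (r - y) < e" using y by blast
    qed
    have "h \<in> T"
    proof (rule closed_approxI[OF Tclosed])
      fix e :: real assume "e > 0"
      then obtain y where y: "y \<in> B1" "norm (w - y * (w * adj w) * w) < e"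
        using R1.N_approx_left[OF w] by metis
      have "E1 (w - y * (w * adj w) * w) = h - y * r"
        using w y R1.E_left[of "y * (w * adj w)" w] by (simp add: R1.E_diff h_def r_def mult.assoc)
      then have "norm (h - y * r) < e" using R1.E_norm[of "w - y * (w * adj w) * w"] w y by simp
      moreover have "y * r \<in> T" using \<open>r \<in> T\<close> y by (intro Tmult')
      ultimately show "\<exists>y\<in>T. norm (h - y) < e" by blast
    qed
    then show ?thesis by (simp add: h_def w_def v'_def)
  qed
  define W where "W = {a \<in> A1. E1 (adj n * a) \<in> T}"
  have "A1 \<subseteq> W"
  proof (rule normalizer_span_dense)
    show "csubspace W"
      using csubspaceD[OF T] nA csubspaceD[of A1] R1.B.character_0
      by (auto simp: csubspace_def W_def distrib_left mult_cscale_right R1.E_add R1.E_cscale)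
    show "closed W"
      unfolding closed_sequential_limits
    proof (intro allI impI, elim conjE)
      fix x a assume x: "\<forall>k. x k \<in> W" and lim: "x \<longlonglongrightarrow> a"
      have xA: "x k \<in> A1" for k using x by (simp add: W_def)
      have "closed A1" using R1.subalgebras by (simp add: cstar_subalgebra_iff)
      then have a: "a \<in> A1" using closed_sequentially[of A1 x a] xA lim by simp
      have "(\<lambda>k. adj n * x k) \<longlonglongrightarrow> adj n * a" by (intro tendsto_intros lim)
      then have "(\<lambda>k. E1 (adj n * x k)) \<longlonglongrightarrow> E1 (adj n * a)"
        by (rule tendsto_norm_le[rotated])
          (use R1.E_norm[of "adj n * x _ - adj n * a"] xA a nA in \<open>simp add: R1.E_diff\<close>)
      then have "E1 (adj n * a) \<in> T" using closed_sequentially[OF Tclosed, of "\<lambda>k. E1 (adj n * x k)"] x by (simp add: W_def)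
      then show "a \<in> W" using a by (simp add: W_def)
    qed
    show "b0 * f1 v \<in> W" if "b0 \<in> B1" "v \<in> V" for b0 v using ET that by (simp add: W_def)
  qed
  then have "E1 (adj n * n) \<in> T" using nA by (auto simp: W_def)
  then have nn: "adj n * n \<in> T" using n by simp
  show ?thesis
  proof (rule closed_approxI[OF R2.B.closed])
    fix e :: real assume e: "e > 0"
    then obtain d where d: "d > 0" "\<And>x. norm x < d \<Longrightarrow> norm (x * (b * adj p)) < e"
      using small_mult by metis
    \<comment> \<open>It suffices to insert the image of an element of \<open>T\<close> on one side
      of \<open>b\<close>; the other factor \<open>adj p\<close> is left untouched.\<close>
    obtain y where y: "y \<in> B1" "norm (n - n * (adj n * n) * y) < d" by (rule R1.N_approx_right[OF n d(1)])
    define j where "j = adj n * n * y"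
    have j: "j \<in> T" "j \<in> B1" using Tmult[OF nn y(1)] by (simp_all add: j_def T_def)
    have "norm (n - n * j) < d" using y by (simp add: j_def mult.assoc)
    moreover have "p - p * ext j = ext (n - n * j)" using nA j by (simp add: p_def ext_simps)
    ultimately have 1: "norm (p - p * ext j) < d" using ext_norm[of "n - n * j"] nA j by simp
    have "norm (p * b * adj p - p * ext j * b * adj p) < e"
      using d(2)[OF 1] by (simp add: left_diff_distrib mult.assoc)
    moreover have "p * ext j * b * adj p \<in> B2" using j b by (simp add: T_def)
    ultimately show "\<exists>z\<in>B2. norm (ext n * b * adj (ext n) - z) < e" unfolding p_def by blast
  qed
qed

lemma ext_regular: "regular_hom ext A1 B1 A2 B2"
  unfolding regular_hom_def
proof
  fix p assume "p \<in> ext ` R1.N"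
  then obtain n where n: "n \<in> R1.N" "p = ext n" by blast
  have 1: "p * b * adj p \<in> B2" if "b \<in> B2" for b
    using ext_normalizer_conj[OF n(1) that] n(2) by simp
  have "ext (adj n) = adj p" using n by (simp add: ext_simps)
  then have 2: "adj p * b * p \<in> B2" if "b \<in> B2" for b
    using ext_normalizer_conj[OF R1.N_adj[OF n(1)] that] by (simp add: adj_adj)
  have "p \<in> A2" using n by simp
  then show "p \<in> R2.N" unfolding normalizers_def using 1 2 by blast
qed

lemma ext_expansion: "expansion A1 B1 A2 B2 ext"
  using R1.subalgebras R2.subalgebras ext_mono ext_B by (auto simp: expansion_def inclusion_def)

text \<open>The image of \<open>D\<close> already meets every nonzero closed ideal of
  \<open>B2\<close>, and it is contained in the image of \<open>B1\<close>.\<close>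

lemma ext_iip: "ideal_intersection_property B2 (ext ` B1)"
  unfolding ideal_intersection_property_def
proof (intro allI impI)
  fix J assume J: "closed_ideal B2 J \<and> J \<noteq> {0}"
  then have "J \<inter> f2 ` D \<noteq> {0}" using R2.iip by (auto simp: ideal_intersection_property_def)
  moreover have "0 \<in> J \<inter> f2 ` D"
    using J R2.f_simps(5) by (auto simp: closed_ideal_def csubspace_def intro!: image_eqI[of _ _ 0])
  ultimately obtain d where d: "d \<in> D" "f2 d \<in> J" "f2 d \<noteq> 0" by auto
  have "f2 d = ext (f1 d)" using d by (simp add: ext_f)
  then have "f2 d \<in> ext ` B1" using d by auto
  then show "J \<inter> ext ` B1 \<noteq> {0}" using d by auto
qed

end

section \<open>From the envelopes to the two representations of the smaller inclusion\<close>

lemma cartan_envelope_rep: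
  assumes "pseudo_cartan C D" "cartan_envelope C D A B \<tau> E"
  shows "cartan_rep A B E C D \<tau>"
  using assms
  by unfold_locales (auto simp: cartan_envelope_def regular_expansion_def essential_expansion_def
      expansion_def inclusion_def)

text \<open>An ideal of \<open>B\<close> pulls back along \<open>f\<close> to a nonzero closed ideal
  of \<open>D\<close>, which then meets \<open>D'\<close>; injectivity keeps the element found
  nonzero in \<open>B\<close>.\<close>

lemma iip_trans:
  assumes B: "abelian B" and f: "star_mono f D B" and D: "cstar_subalgebra D"
    and 1: "ideal_intersection_property B (f ` D)" and 2: "ideal_intersection_property D D'" and sub: "D' \<subseteq> D"
    and 0: "0 \<in> D'"
  shows "ideal_intersection_property B (f ` D')"
  unfolding ideal_intersection_property_def
proof (intro allI impI)
  fix J assume J: "closed_ideal B J \<and> J \<noteq> {0}"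
  have hom: "star_hom f D B" and inj: "inj_on f D" using f by (auto simp: star_mono_def)
  have Da: "star_alg D" and Dc: "closed D" using D by (auto simp: cstar_subalgebra_iff)
  note ops = star_algD[OF Da]
  have Js: "csubspace J" "closed J" "\<And>b j. b \<in> B \<Longrightarrow> j \<in> J \<Longrightarrow> b * j \<in> J \<and> j * b \<in> J"
    using J by (auto simp: closed_ideal_def)
  note J0 = csubspaceD[OF Js(1)]
  have "J \<inter> f ` D \<noteq> {0}" using 1 J by (auto simp: ideal_intersection_property_def)
  moreover have "0 \<in> J \<inter> f ` D" using J0 star_hom_0[OF hom Da] ops by (metis IntI image_eqI)
  ultimately obtain d where d: "d \<in> D" "f d \<in> J" "f d \<noteq> 0" by auto
  define I where "I = {d \<in> D. f d \<in> J}"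
  have "closed I"
    unfolding closed_sequential_limits
  proof (intro allI impI, elim conjE)
    fix x a assume x: "\<forall>k. x k \<in> I" and lim: "x \<longlonglongrightarrow> a"
    have xD: "x k \<in> D" for k using x by (simp add: I_def)
    have a: "a \<in> D" using closed_sequentially[OF Dc, of x a] xD lim by simp
    have "(\<lambda>k. f (x k)) \<longlonglongrightarrow> f a"
      by (rule tendsto_norm_le[OF _ lim])
        (use star_mono_norm[OF f D, of "x _ - a"] xD a ops star_hom_diff[OF hom Da xD a] in simp)
    then have "f a \<in> J" using closed_sequentially[OF Js(2), of "\<lambda>k. f (x k)"] x by (simp add: I_def)
    then show "a \<in> I" using a by (simp add: I_def)
  qed
  moreover have "csubspace I"
    using J0 ops star_hom_0[OF hom Da] by (auto simp: csubspace_def I_def star_homD[OF hom])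
  moreover have "c * j \<in> I \<and> j * c \<in> I" if "c \<in> D" "j \<in> I" for c j
    using that Js(3)[of "f c" "f j"] star_hom_in[OF hom] ops by (auto simp: I_def star_homD[OF hom])
  ultimately have "closed_ideal D I" by (auto simp: closed_ideal_def I_def)
  moreover have "d \<in> I" "d \<noteq> 0" using d star_hom_0[OF hom Da] by (auto simp: I_def)
  ultimately have "I \<inter> D' \<noteq> {0}" using 2 by (auto simp: ideal_intersection_property_def)
  moreover have "0 \<in> I \<inter> D'" using 0 J0 ops star_hom_0[OF hom Da] by (simp add: I_def)
  ultimately obtain e where e: "e \<in> I" "e \<in> D'" "e \<noteq> 0" by auto
  have "f e \<noteq> 0"
  proof
    assume "f e = 0"
    then have "f e = f 0" using star_hom_0[OF hom Da] by simp
    then show False using inj e ops by (auto simp: I_def dest: inj_onD)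
  qed
  then show "J \<inter> f ` D' \<noteq> {0}" using e by (auto simp: I_def)
qed

theorem theorem6p1p11:
  fixes C1 D1 :: "'a::cstar_ambient set"
    and C2 D2 :: "'b::cstar_ambient set"
    and A1 B1 :: "'c::cstar_ambient set"
    and A2 B2 :: "'d::cstar_ambient set"
    and \<alpha> :: "'a \<Rightarrow> 'b" and \<tau>1 :: "'a \<Rightarrow> 'c" and \<tau>2 :: "'b \<Rightarrow> 'd"
    and \<Delta>1 :: "'c \<Rightarrow> 'c" and \<Delta>2 :: "'d \<Rightarrow> 'd"
  assumes "pseudo_cartan C1 D1" and "pseudo_cartan C2 D2"
    and "regular_expansion C1 D1 C2 D2 \<alpha>" and "essential_expansion C1 D1 C2 D2 \<alpha>"
    and "cartan_envelope C1 D1 A1 B1 \<tau>1 \<Delta>1"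
    and "cartan_envelope C2 D2 A2 B2 \<tau>2 \<Delta>2"
  shows "\<exists>\<beta> :: 'c \<Rightarrow> 'd.
           (star_mono \<beta> A1 A2 \<and> (\<forall>c\<in>C1. \<beta> (\<tau>1 c) = \<tau>2 (\<alpha> c)) \<and>
            (\<forall>\<gamma>. star_mono \<gamma> A1 A2 \<and> (\<forall>c\<in>C1. \<gamma> (\<tau>1 c) = \<tau>2 (\<alpha> c))
                 \<longrightarrow> (\<forall>a\<in>A1. \<gamma> a = \<beta> a))) \<and>
           (regular_expansion A1 B1 A2 B2 \<beta> \<and> essential_expansion A1 B1 A2 B2 \<beta>) \<and>
           ((\<forall>a\<in>A1. \<beta> (\<Delta>1 a) = \<Delta>2 (\<beta> a)) \<and>
            (\<forall>c\<in>C1. \<beta> (\<Delta>1 (\<tau>1 c)) = \<Delta>2 (\<tau>2 (\<alpha> c))))"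
proof -
  interpret R1: cartan_rep A1 B1 \<Delta>1 C1 D1 \<tau>1 by (rule cartan_envelope_rep[OF assms(1,5)])
  interpret R2: cartan_rep A2 B2 \<Delta>2 C2 D2 \<tau>2 by (rule cartan_envelope_rep[OF assms(2,6)])
  have \<alpha>: "star_mono \<alpha> C1 C2" "\<alpha> ` D1 \<subseteq> D2" "regular_hom \<alpha> C1 D1 C2 D2" "ideal_intersection_property D2 (\<alpha> ` D1)"
    using assms(3,4) by (auto simp: regular_expansion_def essential_expansion_def expansion_def)
  have hom: "star_hom \<alpha> C1 C2" using \<alpha> by (simp add: star_mono_def)
  have \<alpha>C: "\<alpha> c \<in> C2" if "c \<in> C1" for c using star_hom_in[OF hom that] .
  \<comment> \<open>The composite is the second representation of \<open>C1\<close>. Its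
    essentiality is transported through \<open>D2\<close>, everything else composes
    directly.\<close>
  interpret R: cartan_rep A2 B2 \<Delta>2 C1 D1 "\<lambda>c. \<tau>2 (\<alpha> c)"
  proof
    show "cstar_subalgebra C1" "cstar_subalgebra D1" "D1 \<subseteq> C1" "regular_incl C1 D1"
      by (rule R1.C R1.D R1.DC R1.regular_CD)+
    show "star_mono (\<lambda>c. \<tau>2 (\<alpha> c)) C1 A2"
      unfolding star_mono_def star_hom_def
    proof (intro conjI ballI allI)
      have "inj_on \<alpha> C1" using \<alpha>(1) by (simp add: star_mono_def)
      then show "inj_on (\<lambda>c. \<tau>2 (\<alpha> c)) C1"
        using R2.f_inj \<alpha>C by (auto simp: inj_on_def)
    qed (auto simp: star_homD(1-4)[OF hom] R2.f_simps \<alpha>C)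
    show "(\<lambda>c. \<tau>2 (\<alpha> c)) ` D1 \<subseteq> B2" using \<alpha>(2) R2.fD by auto
    show "regular_hom (\<lambda>c. \<tau>2 (\<alpha> c)) C1 D1 A2 B2" using \<alpha>(3) R2.fN by (auto simp: regular_hom_def)
    have "star_mono \<tau>2 D2 B2"
      using R2.f R2.fD R2.DC by (auto simp: star_mono_def star_hom_def intro: inj_on_subset)
    then have "ideal_intersection_property B2 (\<tau>2 ` (\<alpha> ` D1))"
    proof (rule iip_trans[OF R2.B.abelian _ R2.D R2.iip \<alpha>(4,2)])
      show "0 \<in> \<alpha> ` D1" using star_hom_0[OF hom R1.star_alg_C] star_alg_0[OF R1.star_alg_D] by (metis image_eqI)
    qed
    then show "ideal_intersection_property B2 ((\<lambda>c. \<tau>2 (\<alpha> c)) ` D1)" by (simp add: image_image)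
  qed
  interpret envelope_rep A1 B1 \<Delta>1 A2 B2 \<Delta>2 C1 D1 \<tau>1 "\<lambda>c. \<tau>2 (\<alpha> c)"
    by unfold_locales (use assms(5) in \<open>simp_all add: cartan_envelope_def\<close>)
  show ?thesis
  proof (intro exI[of _ ext] conjI ballI allI impI)
    show "star_mono ext A1 A2" by (rule ext_mono)
    show "regular_expansion A1 B1 A2 B2 ext"
      using ext_expansion ext_regular by (simp add: regular_expansion_def)
    show "essential_expansion A1 B1 A2 B2 ext"
      using ext_expansion ext_iip by (simp add: essential_expansion_def)
    show "\<gamma> a = ext a" if "star_mono \<gamma> A1 A2 \<and> (\<forall>c\<in>C1. \<gamma> (\<tau>1 c) = \<tau>2 (\<alpha> c))" "a \<in> A1" for \<gamma> a
      using ext_unique[of \<gamma> a] that by blast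
  qed (simp_all add: ext_f ext_E ext_E_f)
qed

end
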